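(* Let $T_\theta^{(0)}$ denote the self-adjoint realizations of the Bessel expression $-\frac{d^2}{dx^2}-\frac{1}{4x^2}$ on $(0,\infty)$ defined in the context. If $\theta\in(0,\pi)$ and $z\in\rho\big(T_0^{(0)}\big)\cap\rho\big(T_\theta^{(0)}\big)$, then $$\big(T_\theta^{(0)}-zI\big)^{-1}-\big(T_0^{(0)}-zI\big)^{-1}=\left[\cot(\theta)+\ln\left(\tfrac12z^{1/2}\right)+\gamma-\frac{i\pi}{2}\right]^{-1}\langle w_{\overline z,0},\,\cdot\,\rangle\,w_{z,0},$$ where $$w_{z,0}(x)=\frac{i\pi}{2}x^{1/2}H_0^{(1)}\big(z^{1/2}x\big),\qquad x\in(0,\infty).$$ In particular, $\big(T_\theta^{(0)}-zI\big)^{-1}-\big(T_0^{(0)}-zI\big)^{-1}$ is trace class on $L^2((0,\infty);dx)$, and $$\operatorname{tr}\Big(\big(T_\theta^{(0)}-zI\big)^{-1}-\big(T_0^{(0)}-zI\big)^{-1}\Big)=-\frac{1}{2z\left(\cot(\theta)+\ln\left(\frac12z^{1/2}\right)+\gamma-\frac{i\pi}{2}\right)}.$$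
   Context: $I$, $\langle\cdot,\cdot\rangle$ (linear in the second argument) are the identity and inner product in $L^2((0,\infty);dx)$. $\mathfrak D(0,\infty)$ is the set of $f\in AC_{\mathrm{loc}}(0,\infty)$ with $f'\in AC_{\mathrm{loc}}(0,\infty)$, and $\tau_0 f=-f''-\frac{1}{4x^2}f$. The maximal operator $T_{\max}^{(0)}$ acts as $\tau_0$ on $\{g\in\mathfrak D(0,\infty): g,\tau_0 g\in L^2((0,\infty);dx)\}$, and $T_{\min}^{(0)}=(T_{\max}^{(0)})^*$. Write $[f,g](x)=f(x)\overline{g'(x)}-f'(x)\overline{g(x)}$ and $[f,g](0)=\lim_{x\downarrow0}[f,g](x)$, which exists for $f,g\in\operatorname{dom}(T_{\max}^{(0)})$. Fix real-valued $\phi_{0,0},\psi_{0,0}\in\operatorname{dom}(T_{\max}^{(0)})$ vanishing in a neighborhood of $\infty$ with $\phi_{0,0}(x)=x^{1/2}$ and $\psi_{0,0}(x)=-x^{1/2}\ln(x)$ for $x\in(0,1)$. For $\theta\in[0,\pi)$, $T_\theta^{(0)}$ is the restriction of $T_{\max}^{(0)}$ to $$\{g\in\operatorname{dom}(T_{\max}^{(0)}):\cos(\theta)[g,\phi_{0,0}](0)+\sin(\theta)[g,\psi_{0,0}](0)=0\}.$$ These are known to be exactly the self-adjoint extensions of $T_{\min}^{(0)}$; $T_0^{(0)}$ is the Friedrichs extension and $\sigma(T_0^{(0)})=[0,\infty)$. $H_0^{(1)}=J_0+iY_0$ is the Hankel function of the first kind and $\gamma$ is the Euler–Mascheroni constant.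 Powers and logarithms use the branch $\arg(z)\in[0,2\pi)$ for $z\neq0$: $z^{1/2}=|z|^{1/2}e^{i\arg(z)/2}$ (so $\operatorname{Im}(z^{1/2})\ge0$) and $\ln(z)=\ln|z|+i\arg(z)$. *)

theory Defs
  imports "HOL-Analysis.Analysis"
begin

section \<open>The Hilbert space of square-integrable functions on the half-line\<close>

abbreviation half_line :: "real measure" where
  "half_line \<equiv> lebesgue_on {0<..}"

definition square_integrable :: "(real \<Rightarrow> complex) \<Rightarrow> bool" where
  "square_integrable f \<longleftrightarrow>
     f \<in> borel_measurable half_line \<and> integrable half_line (\<lambda>x. (cmod (f x))\<^sup>2)"

lemma square_integrable_measurable:
  "square_integrable f \<Longrightarrow> f \<in> borel_measurable half_line"
  by (simp add: square_integrable_def)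

lemma measurable_cnj:
  "f \<in> borel_measurable M \<Longrightarrow> (\<lambda>x. cnj (f x)) \<in> borel_measurable M"
  by (rule borel_measurable_continuous_on[of cnj, OF continuous_on_cnj[OF continuous_on_id]])

lemma square_integrable_zero: "square_integrable (\<lambda>x. 0)"
  by (simp add: square_integrable_def)

lemma square_integrable_scale:
  assumes "square_integrable f"
  shows "square_integrable (\<lambda>x. c * f x)"
  using assms by (auto simp: square_integrable_def norm_mult power_mult_distrib)

lemma square_integrable_add:
  assumes "square_integrable f" "square_integrable g"
  shows "square_integrable (\<lambda>x. f x + g x)"
proof -
  have [measurable]: "f \<in> borel_measurable half_line" "g \<in> borel_measurable half_line"
    using assms by (auto simp: square_integrable_def)
  have "integrable half_line (\<lambda>x. (cmod (f x + g x))\<^sup>2)"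
  proof (rule Bochner_Integration.integrable_bound)
    show "integrable half_line (\<lambda>x. 2 * (cmod (f x))\<^sup>2 + 2 * (cmod (g x))\<^sup>2)"
      using assms by (auto simp: square_integrable_def)
    show "(\<lambda>x. (cmod (f x + g x))\<^sup>2) \<in> borel_measurable half_line"
      by measurable
    have "(cmod (f x + g x))\<^sup>2 \<le> 2 * (cmod (f x))\<^sup>2 + 2 * (cmod (g x))\<^sup>2" for x
    proof -
      have "(cmod (f x + g x))\<^sup>2 \<le> (cmod (f x) + cmod (g x))\<^sup>2"
        by (intro power_mono norm_triangle_ineq) auto
      moreover have "0 \<le> (cmod (f x) - cmod (g x))\<^sup>2"
        by simp
      ultimately show ?thesis
        unfolding power2_sum power2_diff by linarith
    qed
    then show "AE x in half_line. norm ((cmod (f x + g x))\<^sup>2)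
        \<le> norm (2 * (cmod (f x))\<^sup>2 + 2 * (cmod (g x))\<^sup>2)"
      by (intro AE_I2) simp
  qed
  then show ?thesis
    by (simp add: square_integrable_def)
qed

lemma square_integrable_product:
  assumes "square_integrable f" "square_integrable g"
  shows "integrable half_line (\<lambda>x. cnj (f x) * g x)"
proof -
  have [measurable]: "f \<in> borel_measurable half_line" "g \<in> borel_measurable half_line"
    using assms by (auto simp: square_integrable_def)
  show ?thesis
  proof (rule Bochner_Integration.integrable_bound)
    show "integrable half_line (\<lambda>x. (cmod (f x))\<^sup>2 + (cmod (g x))\<^sup>2)"
      using assms by (auto simp: square_integrable_def)
    show "(\<lambda>x. cnj (f x) * g x) \<in> borel_measurable half_line"
      by (intro borel_measurable_times measurable_cnj square_integrable_measurable assms)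
    have "cmod (f x) * cmod (g x) \<le> (cmod (f x))\<^sup>2 + (cmod (g x))\<^sup>2" for x
    proof -
      have "0 \<le> (cmod (f x) - cmod (g x))\<^sup>2" "0 \<le> cmod (f x) * cmod (g x)"
        by auto
      then show ?thesis
        unfolding power2_diff by linarith
    qed
    then show "AE x in half_line. norm (cnj (f x) * g x)
        \<le> norm ((cmod (f x))\<^sup>2 + (cmod (g x))\<^sup>2)"
      by (intro AE_I2) (simp add: norm_mult)
  qed
qed

quotient_type L2 = "real \<Rightarrow> complex" / partial:
  "\<lambda>f g. square_integrable f \<and> square_integrable g \<and> (AE x in half_line. f x = g x)"
  morphisms rep_L2 abs_L2
proof (rule part_equivpI)
  show "\<exists>f. square_integrable f \<and> square_integrable f \<and> (AE x in half_line. f x = f x)"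
    by (rule exI[of _ "\<lambda>x. 0"]) (simp add: square_integrable_zero)
  show "symp (\<lambda>f g. square_integrable f \<and> square_integrable g \<and> (AE x in half_line. f x = g x))"
    by (rule sympI) (simp add: eq_commute)
  show "transp (\<lambda>f g. square_integrable f \<and> square_integrable g \<and> (AE x in half_line. f x = g x))"
  proof (rule transpI, elim conjE, intro conjI)
    fix f g h :: "real \<Rightarrow> complex"
    assume "AE x in half_line. f x = g x" "AE x in half_line. g x = h x"
    then show "AE x in half_line. f x = h x"
      by eventually_elim simp
  qed
qed

lemma abs_L2_eq_iff:
  assumes "square_integrable f" "square_integrable g"
  shows "abs_L2 f = abs_L2 g \<longleftrightarrow> (AE x in half_line. f x = g x)"
  using Quotient3_rel[OF Quotient3_L2, of f g] assms by simp

lift_definition cscale :: "complex \<Rightarrow> L2 \<Rightarrow> L2"  (infixr \<open>*\<^sub>C\<close> 75)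
  is "\<lambda>c f x. c * f x"
proof (elim conjE, intro conjI square_integrable_scale)
  fix c :: complex and f g :: "real \<Rightarrow> complex"
  assume "AE x in half_line. f x = g x"
  then show "AE x in half_line. c * f x = c * g x"
    by eventually_elim simp
qed

lift_definition cinner :: "L2 \<Rightarrow> L2 \<Rightarrow> complex"
  is "\<lambda>f g. \<integral>x. cnj (f x) * g x \<partial>half_line"
proof -
  fix f f' g g' :: "real \<Rightarrow> complex"
  assume f: "square_integrable f \<and> square_integrable f' \<and> (AE x in half_line. f x = f' x)"
    and g: "square_integrable g \<and> square_integrable g' \<and> (AE x in half_line. g x = g' x)"
  have "AE x in half_line. f x = f' x" "AE x in half_line. g x = g' x"
    using f g by simp_all
  then have "AE x in half_line. cnj (f x) * g x = cnj (f' x) * g' x"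
    by eventually_elim simp
  moreover have "(\<lambda>x. cnj (f x) * g x) \<in> borel_measurable half_line"
    "(\<lambda>x. cnj (f' x) * g' x) \<in> borel_measurable half_line"
    using f g by (simp_all add: square_integrable_product borel_measurable_integrable)
  ultimately show "(\<integral>x. cnj (f x) * g x \<partial>half_line) = (\<integral>x. cnj (f' x) * g' x \<partial>half_line)"
    by (intro integral_cong_AE)
qed

instantiation L2 :: real_inner
begin

lift_definition zero_L2 :: L2 is "\<lambda>x. 0"
  by (simp add: square_integrable_zero)

lift_definition plus_L2 :: "L2 \<Rightarrow> L2 \<Rightarrow> L2" is "\<lambda>f g x. f x + g x"
proof (elim conjE, intro conjI square_integrable_add)
  fix f f' g g' :: "real \<Rightarrow> complex"
  assume "AE x in half_line. f x = f' x" "AE x in half_line. g x = g' x"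
  then show "AE x in half_line. f x + g x = f' x + g' x"
    by eventually_elim simp
qed

definition uminus_L2 :: "L2 \<Rightarrow> L2" where
  "uminus_L2 f = (- 1) *\<^sub>C f"

definition minus_L2 :: "L2 \<Rightarrow> L2 \<Rightarrow> L2" where
  "minus_L2 f g = f + (- 1) *\<^sub>C g"

definition scaleR_L2 :: "real \<Rightarrow> L2 \<Rightarrow> L2" where
  "scaleR_L2 r f = of_real r *\<^sub>C f"

definition inner_L2 :: "L2 \<Rightarrow> L2 \<Rightarrow> real" where
  "inner_L2 f g = Re (cinner f g)"

definition norm_L2 :: "L2 \<Rightarrow> real" where
  "norm_L2 f = sqrt (inner f f)"

definition sgn_L2 :: "L2 \<Rightarrow> L2" where
  "sgn_L2 f = of_real (inverse (norm f)) *\<^sub>C f"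

definition dist_L2 :: "L2 \<Rightarrow> L2 \<Rightarrow> real" where
  "dist_L2 f g = norm (f - g)"

definition uniformity_L2 :: "(L2 \<times> L2) filter" where
  "uniformity_L2 = (INF e\<in>{0<..}. principal {(x, y). dist x y < e})"

definition open_L2 :: "L2 set \<Rightarrow> bool" where
  "open_L2 U \<longleftrightarrow> (\<forall>x\<in>U. \<forall>\<^sub>F (x', y) in uniformity. x' = x \<longrightarrow> y \<in> U)"

instance
proof
  fix f g h :: L2 and r s :: real
  show "f + g + h = f + (g + h)"
    by transfer (simp add: square_integrable_add add.assoc)
  show "f + g = g + f"
    by transfer (simp add: square_integrable_add add.commute)
  show "0 + f = f"
    by transfer simp
  show "- f + f = 0"
    unfolding uminus_L2_def
    by transfer (simp add: square_integrable_zero)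
  show "f - g = f + - g"
    by (simp add: minus_L2_def uminus_L2_def)
  have "c *\<^sub>C (f + g) = c *\<^sub>C f + c *\<^sub>C g" for c
    by transfer (simp only: distrib_left square_integrable_add square_integrable_scale simp_thms AE_I2)
  then show "r *\<^sub>R (f + g) = r *\<^sub>R f + r *\<^sub>R g"
    by (simp only: scaleR_L2_def)
  have "(c + d) *\<^sub>C f = c *\<^sub>C f + d *\<^sub>C f" for c d
    by transfer (simp only: distrib_right square_integrable_add square_integrable_scale simp_thms AE_I2)
  then show "(r + s) *\<^sub>R f = r *\<^sub>R f + s *\<^sub>R f"
    by (simp only: scaleR_L2_def of_real_add)
  have "c *\<^sub>C d *\<^sub>C f = (c * d) *\<^sub>C f" for c d
    by transfer (simp only: mult.assoc square_integrable_scale simp_thms AE_I2)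
  then show "r *\<^sub>R s *\<^sub>R f = (r * s) *\<^sub>R f"
    by (simp only: scaleR_L2_def of_real_mult)
  have "1 *\<^sub>C f = f"
    by transfer simp
  then show "1 *\<^sub>R f = f"
    by (simp only: scaleR_L2_def of_real_1)
  show "inner f g = inner g f"
  proof -
    have "cinner f g = cnj (cinner g f)"
      by transfer (simp add: mult.commute flip: Bochner_Integration.integral_cnj)
    then show ?thesis
      by (simp add: inner_L2_def)
  qed
  show "inner (f + g) h = inner f h + inner g h"
    unfolding inner_L2_def
    by transfer (simp add: distrib_right square_integrable_product)
  show "inner (r *\<^sub>R f) g = r * inner f g"
    unfolding inner_L2_def scaleR_L2_def
    by transfer (simp add: mult.assoc)
  have inner_self: "(inner (abs_L2 u) (abs_L2 u)) = (\<integral>x. (cmod (u x))\<^sup>2 \<partial>half_line)"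
    if "square_integrable u" for u
  proof -
    have "cinner (abs_L2 u) (abs_L2 u) = (\<integral>x. cnj (u x) * u x \<partial>half_line)"
      using that by (intro cinner.abs_eq) auto
    also have "\<dots> = (\<integral>x. complex_of_real ((cmod (u x))\<^sup>2) \<partial>half_line)"
      by (rule arg_cong[where f = "integral\<^sup>L half_line"])
         (simp add: fun_eq_iff complex_norm_square mult.commute del: of_real_power)
    also have "\<dots> = complex_of_real (\<integral>x. (cmod (u x))\<^sup>2 \<partial>half_line)"
      by (rule integral_complex_of_real)
    finally show ?thesis
      by (simp add: inner_L2_def)
  qed
  obtain u where u: "square_integrable u" "f = abs_L2 u"
    by (induction f rule: L2.abs_induct) simp
  show "0 \<le> inner f f"
    by (simp add: u inner_self)
  show "inner f f = 0 \<longleftrightarrow> f = 0"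
  proof -
    have int: "integrable half_line (\<lambda>x. (cmod (u x))\<^sup>2)"
      using u(1) by (simp add: square_integrable_def)
    have "inner f f = 0 \<longleftrightarrow> (AE x in half_line. (cmod (u x))\<^sup>2 = 0)"
      unfolding u(2) inner_self[OF u(1)] by (intro integral_nonneg_eq_0_iff_AE int) simp
    also have "\<dots> \<longleftrightarrow> f = 0"
      using u by (simp add: zero_L2_def abs_L2_eq_iff square_integrable_zero)
    finally show ?thesis .
  qed
  show "norm f = sqrt (inner f f)"
    by (rule norm_L2_def)
  show "sgn f = inverse (norm f) *\<^sub>R f"
    by (simp only: sgn_L2_def scaleR_L2_def)
  show "dist f g = norm (f - g)"
    by (rule dist_L2_def)
  show "uniformity = (INF e\<in>{0<..}. principal {(x :: L2, y). dist x y < e})"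
    by (rule uniformity_L2_def)
  show "open U \<longleftrightarrow> (\<forall>x\<in>U. \<forall>\<^sub>F (x', y) in uniformity. x' = x \<longrightarrow> y \<in> U)" for U :: "L2 set"
    by (rule open_L2_def)
qed

end

section \<open>Bounded operators, orthonormal bases, trace class\<close>

definition bounded_clinear :: "(L2 \<Rightarrow> L2) \<Rightarrow> bool" where
  "bounded_clinear A \<longleftrightarrow> bounded_linear A \<and> (\<forall>c f. A (c *\<^sub>C f) = c *\<^sub>C A f)"

definition orthonormal :: "L2 set \<Rightarrow> bool" where
  "orthonormal E \<longleftrightarrow> (\<forall>e\<in>E. \<forall>f\<in>E. cinner e f = (if e = f then 1 else 0))"

definition orthonormal_basis :: "L2 set \<Rightarrow> bool" where
  "orthonormal_basis E \<longleftrightarrow> orthonormal E \<and> (\<forall>f. (\<forall>e\<in>E. cinner e f = 0) \<longrightarrow> f = 0)"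

lemma orthonormal_basis_exists: "\<exists>E. orthonormal_basis E"
proof -
  have "\<exists>M\<in>Collect orthonormal. \<forall>E\<in>Collect orthonormal. M \<subseteq> E \<longrightarrow> E = M"
  proof (rule subset_Zorn)
    fix C assume C: "subset.chain (Collect orthonormal) C"
    have "orthonormal (\<Union>C)"
      unfolding orthonormal_def
    proof (intro ballI)
      fix e f assume "e \<in> \<Union>C" "f \<in> \<Union>C"
      then obtain X Y where "X \<in> C" "e \<in> X" "Y \<in> C" "f \<in> Y"
        by blast
      moreover have "X \<subseteq> Y \<or> Y \<subseteq> X"
        using C \<open>X \<in> C\<close> \<open>Y \<in> C\<close> by (auto simp: subset.chain_def)
      moreover have "orthonormal X" "orthonormal Y"
        using C \<open>X \<in> C\<close> \<open>Y \<in> C\<close> by (auto simp: subset.chain_def)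
      ultimately show "cinner e f = (if e = f then 1 else 0)"
        unfolding orthonormal_def by blast
    qed
    then show "\<exists>U\<in>Collect orthonormal. \<forall>X\<in>C. X \<subseteq> U"
      by auto
  qed
  then obtain E where E: "orthonormal E" and max: "\<And>F. orthonormal F \<Longrightarrow> E \<subseteq> F \<Longrightarrow> F = E"
    by blast
  have "f = 0" if orth: "\<And>e. e \<in> E \<Longrightarrow> cinner e f = 0" for f
  proof (rule ccontr)
    assume "f \<noteq> 0"
    define u where "u = of_real (inverse (norm f)) *\<^sub>C f"
    have comm: "cinner g h = cnj (cinner h g)" for g h
      by transfer (simp add: mult.commute flip: Bochner_Integration.integral_cnj)
    have scale: "cinner g (c *\<^sub>C h) = c * cinner g h" for g h c
    proof transfer
      fix g h :: "real \<Rightarrow> complex" and c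
      have "(\<integral>x. cnj (g x) * (c * h x) \<partial>half_line) = (\<integral>x. c * (cnj (g x) * h x) \<partial>half_line)"
        by (simp only: mult.left_commute)
      then show "(\<integral>x. cnj (g x) * (c * h x) \<partial>half_line) = c * (\<integral>x. cnj (g x) * h x \<partial>half_line)"
        by simp
    qed
    have "norm u = 1"
      using \<open>f \<noteq> 0\<close> unfolding u_def scaleR_L2_def[symmetric] by simp
    then have "Re (cinner u u) = 1"
      by (simp add: norm_L2_def inner_L2_def)
    moreover have "Im (cinner u u) = 0"
      using arg_cong[OF comm[of u u], of Im] by simp
    ultimately have uu: "cinner u u = 1"
      by (simp add: complex_eq_iff)
    have eu: "cinner e u = 0" if "e \<in> E" for e
      unfolding u_def scale using orth[OF that] by simp
    then have ue: "cinner u e = 0" if "e \<in> E" for e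
      using comm[of u e] that by simp
    have "orthonormal (insert u E)"
      using E eu ue uu unfolding orthonormal_def by auto
    then have "u \<in> E"
      using max[of "insert u E"] by blast
    then show False
      using eu uu by force
  qed
  then show ?thesis
    using E unfolding orthonormal_basis_def by blast
qed

definition positive_operator :: "(L2 \<Rightarrow> L2) \<Rightarrow> bool" where
  "positive_operator P \<longleftrightarrow> bounded_clinear P \<and> (\<forall>f. cinner f (P f) \<in> \<real>\<^sub>\<ge>\<^sub>0)"

(* P is the square root of A* A; the equation P P = A* A is written in weak form,
   which avoids naming the adjoint of A. *)
definition is_operator_abs :: "(L2 \<Rightarrow> L2) \<Rightarrow> (L2 \<Rightarrow> L2) \<Rightarrow> bool" where
  "is_operator_abs A P \<longleftrightarrow>
     positive_operator P \<and> (\<forall>f g. cinner f (P (P g)) = cinner (A f) (A g))"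

definition trace_class :: "(L2 \<Rightarrow> L2) \<Rightarrow> bool" where
  "trace_class A \<longleftrightarrow> bounded_clinear A \<and>
     (\<exists>P. is_operator_abs A P \<and>
          (\<forall>E. orthonormal_basis E \<longrightarrow> (\<lambda>e. cinner e (P e)) summable_on E))"

definition op_trace :: "(L2 \<Rightarrow> L2) \<Rightarrow> complex" where
  "op_trace A = (THE t. \<forall>E. orthonormal_basis E \<longrightarrow> ((\<lambda>e. cinner e (A e)) has_sum t) E)"

section \<open>Unbounded operators and resolvents\<close>

(* An unbounded operator T is represented by its graph; (f, h) in T means
   that f lies in dom T and T f = h. *)
type_synonym operator = "(L2 \<times> L2) set"

definition shifted :: "operator \<Rightarrow> complex \<Rightarrow> operator" where
  "shifted T z = {(f, h - z *\<^sub>C f) | f h. (f, h) \<in> T}"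

definition resolvent :: "operator \<Rightarrow> complex \<Rightarrow> L2 \<Rightarrow> L2" where
  "resolvent T z f = (THE g. (g, f) \<in> shifted T z)"

definition resolvent_set :: "operator \<Rightarrow> complex set" where
  "resolvent_set T = {z. (\<forall>f. \<exists>!g. (g, f) \<in> shifted T z) \<and> bounded_clinear (resolvent T z)}"

section \<open>The Bessel operators on the half-line\<close>

definition absolutely_continuous_on :: "real \<Rightarrow> real \<Rightarrow> (real \<Rightarrow> complex) \<Rightarrow> bool" where
  "absolutely_continuous_on a b f \<longleftrightarrow>
     (\<forall>\<epsilon>>0. \<exists>\<delta>>0. \<forall>D. finite D \<and> (\<forall>(s, t)\<in>D. a \<le> s \<and> s \<le> t \<and> t \<le> b) \<and>
        disjoint_family_on (\<lambda>(s, t). {s<..<t}) D \<and> (\<Sum>(s, t)\<in>D. t - s) < \<delta> \<longrightarrow>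
        (\<Sum>(s, t)\<in>D. cmod (f t - f s)) < \<epsilon>)"

definition AC_loc :: "(real \<Rightarrow> complex) set" where
  "AC_loc = {f. \<forall>a b. 0 < a \<and> a \<le> b \<longrightarrow> absolutely_continuous_on a b f}"

abbreviation D1 :: "(real \<Rightarrow> complex) \<Rightarrow> real \<Rightarrow> complex" where
  "D1 f x \<equiv> vector_derivative f (at x)"

(* Functions are total on the reals, but only their values on (0, infinity) matter.
   The derivative of f belongs to AC_loc as a function, so it has to exist at every x > 0. *)
definition regular_functions :: "(real \<Rightarrow> complex) set" where
  "regular_functions = {f \<in> AC_loc. (\<forall>x>0. f differentiable at x) \<and> D1 f \<in> AC_loc}"

(* D1 f is absolutely continuous for f in regular_functions, hence differentiable almost
   everywhere; the value at the exceptional points is irrelevant for the class in L2. *)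
definition tau0 :: "(real \<Rightarrow> complex) \<Rightarrow> real \<Rightarrow> complex" where
  "tau0 f x = - D1 (D1 f) x - of_real (1 / (4 * x\<^sup>2)) * f x"

definition dom_Tmax :: "(real \<Rightarrow> complex) set" where
  "dom_Tmax = {g \<in> regular_functions. square_integrable g \<and> square_integrable (tau0 g)}"

definition bracket :: "(real \<Rightarrow> complex) \<Rightarrow> (real \<Rightarrow> complex) \<Rightarrow> real \<Rightarrow> complex" where
  "bracket f g x = f x * cnj (D1 g x) - D1 f x * cnj (g x)"

definition bracket0 :: "(real \<Rightarrow> complex) \<Rightarrow> (real \<Rightarrow> complex) \<Rightarrow> complex" where
  "bracket0 f g = Lim (at_right 0) (bracket f g)"

definition dom_T :: "(real \<Rightarrow> complex) \<Rightarrow> (real \<Rightarrow> complex) \<Rightarrow> real \<Rightarrow> (real \<Rightarrow> complex) set" where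
  "dom_T \<phi> \<psi> \<theta> =
     {g \<in> dom_Tmax. of_real (cos \<theta>) * bracket0 g \<phi> + of_real (sin \<theta>) * bracket0 g \<psi> = 0}"

definition T_op :: "(real \<Rightarrow> complex) \<Rightarrow> (real \<Rightarrow> complex) \<Rightarrow> real \<Rightarrow> operator" where
  "T_op \<phi> \<psi> \<theta> = (\<lambda>g. (abs_L2 g, abs_L2 (tau0 g))) ` dom_T \<phi> \<psi> \<theta>"

section \<open>The Hankel function and the Weyl solution\<close>

(* The cut of both functions is [0, infinity): the argument is taken in [0, 2 pi). *)
definition branch_sqrt :: "complex \<Rightarrow> complex" where
  "branch_sqrt z = of_real (sqrt (cmod z)) * cis (Arg2pi z / 2)"

definition branch_ln :: "complex \<Rightarrow> complex" where
  "branch_ln z = of_real (ln (cmod z)) + \<i> * of_real (Arg2pi z)"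

definition bessel_J0 :: "complex \<Rightarrow> complex" where
  "bessel_J0 \<zeta> = (\<Sum>k. (- 1) ^ k * (\<zeta> / 2) ^ (2 * k) / (fact k)\<^sup>2)"

(* Standard series of Y_0 (Abramowitz-Stegun 9.1.13, DLMF 10.8.2); harm k is the k-th harmonic
   number. In the open upper half-plane this branch is the principal one. *)
definition bessel_Y0 :: "complex \<Rightarrow> complex" where
  "bessel_Y0 \<zeta> =
     of_real (2 / pi) * (branch_ln (\<zeta> / 2) + euler_mascheroni) * bessel_J0 \<zeta>
     - of_real (2 / pi) * (\<Sum>k. (- 1) ^ k * harm k * (\<zeta> / 2) ^ (2 * k) / (fact k)\<^sup>2)"

definition hankel_H0 :: "complex \<Rightarrow> complex" where
  "hankel_H0 \<zeta> = bessel_J0 \<zeta> + \<i> * bessel_Y0 \<zeta>"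

definition w_sol :: "complex \<Rightarrow> real \<Rightarrow> complex" where
  "w_sol z x = \<i> * of_real (pi / 2) * of_real (sqrt x) * hankel_H0 (branch_sqrt z * of_real x)"

end

theory Submission
  imports Defs "HOL-Real_Asymp.Real_Asymp"
begin

text \<open>
  Write \<open>\<tau>\<close> for the differential expression and \<open>w\<close> for \<open>w_sol z\<close>, the solution of \<open>\<tau> w = z w\<close> that is square
  integrable on the half-line. The two operators act by the same expression and differ only in the boundary
  condition at 0, so their resolvents differ by a multiple of \<open>w\<close>. Given \<open>f\<close>, let \<open>g\<close> solve
  \<open>(\<tau> - z) g = f\<close> with \<open>[g,\<phi>](0) = 0\<close>. Every \<open>g + c w\<close> solves the same equation. As \<open>[w,\<phi>](0) = 1\<close>, it
  satisfies the condition of angle \<open>\<theta>\<close> exactly for \<open>c = - [g,\<psi>](0) / D\<close>, where \<open>D = cot \<theta> + [w,\<psi>](0)\<close>.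
  The Lagrange identity turns \<open>- [g,\<psi>](0)\<close> into the integral of \<open>w f\<close>, which is the inner product of
  \<open>w_sol (cnj z)\<close> with \<open>f\<close>. This is the rank-one formula (\<open>resolvent_difference\<close>). If \<open>D\<close> were 0, then \<open>w\<close>
  would be an eigenfunction for \<open>\<theta>\<close> and \<open>z\<close> would not be a resolvent point (\<open>denominator_nonzero\<close>). The trace is
  the integral of \<open>w\<^sup>2\<close> divided by \<open>D\<close>, and \<open>w\<^sup>2\<close> has an elementary antiderivative in terms of Bessel functions
  (\<open>integral_w_sol_square\<close>).

  The following facts carry this argument.

  Functions in the maximal domain have an absolutely continuous derivative, and \<open>\<tau>\<close> sees only the pointwise second
  derivative. Integrating the Lagrange identity therefore requires the fundamental theorem of calculus for
  absolutely continuous functions (\<open>AC_fundamental_theorem\<close>).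

  The Weyl solution is \<open>\<surd>x K(\<kappa> x)\<close> with \<open>\<kappa> = - \<i> \<surd>z\<close>, \<open>Re \<kappa> > 0\<close>, and \<open>K\<close> the Macdonald function, in the form
  of the series that comes from the Hankel function. The series gives the boundary values at 0, among them
  \<open>[w,\<psi>](0) = ln (\<kappa> / 2) + \<gamma>\<close>. The decay at infinity is visible only in the representation of \<open>K\<close> as the
  integral of \<open>exp (- s cosh t)\<close>, and the two are identified by their behaviour at 0
  (\<open>bessel_K_eq_laplace\<close>); this is where the Euler constant enters.

  All this needs \<open>z\<close> outside \<open>[0,\<infinity>)\<close>. For \<open>z \<ge> 0\<close> an energy estimate shows that a square-integrable solution of
  \<open>(\<tau> - z) g = f\<close> with \<open>f\<close> supported in \<open>(0,1]\<close> vanishes beyond 1. Then \<open>f\<close> is orthogonal to the regular solution,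
  so \<open>\<tau> - z\<close> is not surjective on the domain for \<open>\<theta> = 0\<close> (\<open>resolvent_set_avoids_half_line\<close>).

  Finally, the trace is a sum over an arbitrary orthonormal basis. Its value for a rank-one operator is Parseval's
  identity, which holds because the space of square-integrable functions is complete.
\<close>

section \<open>Absolutely continuous functions\<close>

text \<open>
  Degenerate intervals are excluded. They contribute nothing to the sums below, but distinct intervals of the
  family could become equal degenerate ones when they are clipped.
\<close>

definition nonoverlapping :: "real \<Rightarrow> real \<Rightarrow> (real \<times> real) set \<Rightarrow> bool" where
  "nonoverlapping a b D \<longleftrightarrow> finite D \<and> (\<forall>(s, t)\<in>D. a \<le> s \<and> s < t \<and> t \<le> b) \<and>
     disjoint_family_on (\<lambda>(s, t). {s<..<t}) D"

definition increments :: "(real \<Rightarrow> complex) \<Rightarrow> (real \<times> real) set \<Rightarrow> real" where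
  "increments f D = (\<Sum>(s, t)\<in>D. cmod (f t - f s))"

definition variation :: "(real \<Rightarrow> complex) \<Rightarrow> real \<Rightarrow> real \<Rightarrow> real" where
  "variation f a b = (SUP D\<in>Collect (nonoverlapping a b). increments f D)"

lemma nonoverlapping_empty: "nonoverlapping a b {}"
  by (simp add: nonoverlapping_def disjoint_family_on_def)

lemma nonoverlapping_length_measure:
  assumes D: "nonoverlapping a b D" and A: "A \<in> sets lborel" "\<And>s t. (s, t) \<in> D \<Longrightarrow> {s<..<t} \<subseteq> A"
  shows "ennreal (\<Sum>(s, t)\<in>D. t - s) \<le> emeasure lborel A"
proof -
  have D: "finite D" "disjoint_family_on (\<lambda>(s, t). {s<..<t}) D"
    and st: "\<And>s t. (s, t) \<in> D \<Longrightarrow> a \<le> s \<and> s < t \<and> t \<le> b"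
    using assms by (auto simp: nonoverlapping_def)
  have "ennreal (\<Sum>(s, t)\<in>D. t - s) = (\<Sum>p\<in>D. ennreal (case p of (s, t) \<Rightarrow> t - s))"
    using st by (intro sum_ennreal[symmetric]) (fastforce split: prod.splits)
  also have "\<dots> = (\<Sum>p\<in>D. emeasure lborel (case p of (s, t) \<Rightarrow> {s<..<t}))"
    using st by (intro sum.cong) (force split: prod.splits)+
  also have "\<dots> = emeasure lborel (\<Union>p\<in>D. case p of (s, t) \<Rightarrow> {s<..<t})"
    using D by (intro sum_emeasure) auto
  also have "\<dots> \<le> emeasure lborel A"
    using A by (intro emeasure_mono) auto
  finally show ?thesis .
qed

lemma nonoverlapping_length:
  assumes "nonoverlapping a b D" "a \<le> b"
  shows "(\<Sum>(s, t)\<in>D. t - s) \<le> b - a"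
proof -
  have "{s<..<t} \<subseteq> {a..b}" if "(s, t) \<in> D" for s t
    using assms that by (fastforce simp: nonoverlapping_def)
  then have "ennreal (\<Sum>(s, t)\<in>D. t - s) \<le> ennreal (b - a)"
    using nonoverlapping_length_measure[OF assms(1), of "{a..b}"] assms by simp
  then show ?thesis
    using assms(2) by (simp add: ennreal_le_iff)
qed

text \<open>
  Clip every interval at \<open>c\<close>, once from above and once from below. The two kinds of clipping are instances of one
  monotone map \<open>h\<close>, and the intervals that collapse under it are dropped; an interval that straddles \<open>c\<close> is
  handled by the triangle inequality.
\<close>

lemma nonoverlapping_split:
  assumes D: "nonoverlapping a b D"
  obtains D1 D2 where "nonoverlapping a c D1" "nonoverlapping c b D2"
    "increments f D \<le> increments f D1 + increments f D2"
proof -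
  have fin: "finite D" and st: "\<And>s t. (s, t) \<in> D \<Longrightarrow> a \<le> s \<and> s < t \<and> t \<le> b"
    and disj: "\<And>s t s' t'. (s, t) \<in> D \<Longrightarrow> (s', t') \<in> D \<Longrightarrow> (s, t) \<noteq> (s', t')
      \<Longrightarrow> {s<..<t} \<inter> {s'<..<t'} = {}"
    using D unfolding nonoverlapping_def disjoint_family_on_def by fast+
  have clip: "nonoverlapping a' b' {p \<in> (\<lambda>(s, t). (h s, h t)) ` D. fst p < snd p}"
      "increments f {p \<in> (\<lambda>(s, t). (h s, h t)) ` D. fst p < snd p}
        = (\<Sum>(s, t)\<in>D. cmod (f (h t) - f (h s)))"
    if h: "mono h" and clip: "\<And>x y. x < y \<Longrightarrow> h x < h y \<Longrightarrow> x \<le> h x \<and> h y \<le> y"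
      and range: "\<And>x y. a \<le> x \<Longrightarrow> x < y \<Longrightarrow> y \<le> b \<Longrightarrow> h x < h y \<Longrightarrow> a' \<le> h x \<and> h y \<le> b'" for h a' b'
  proof -
    let ?h = "\<lambda>(s, t). (h s, h t)" and ?D = "{p \<in> (\<lambda>(s, t). (h s, h t)) ` D. fst p < snd p}"
    have sub: "{h s<..<h t} \<subseteq> {s<..<t}" if "(s, t) \<in> D" for s t
    proof (cases "h s < h t")
      case True
      then show ?thesis
        using clip[of s t] st[OF that] by auto
    qed auto
    show "nonoverlapping a' b' ?D"
      unfolding nonoverlapping_def
    proof (intro conjI ballI)
      show "finite ?D"
        using fin by simp
      show "case p of (s, t) \<Rightarrow> a' \<le> s \<and> s < t \<and> t \<le> b'" if "p \<in> ?D" for p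
      proof -
        obtain s t where "(s, t) \<in> D" "p = (h s, h t)" "h s < h t"
          using \<open>p \<in> ?D\<close> by auto
        then show ?thesis
          using st[of s t] range[of s t] by simp
      qed
      show "disjoint_family_on (\<lambda>(s, t). {s<..<t}) ?D"
      proof (unfold disjoint_family_on_def, intro ballI impI)
        fix p q assume "p \<in> ?D" "q \<in> ?D" "p \<noteq> q"
        then obtain s t s' t' where "(s, t) \<in> D" "(s', t') \<in> D" "p = (h s, h t)" "q = (h s', h t')"
          by auto
        moreover then have "(s, t) \<noteq> (s', t')"
          using \<open>p \<noteq> q\<close> by auto
        ultimately show "(case p of (s, t) \<Rightarrow> {s<..<t}) \<inter> (case q of (s, t) \<Rightarrow> {s<..<t}) = {}"
          using Int_mono[OF sub[of s t] sub[of s' t']] disj[of s t s' t']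
          by (simp del: Int_subset_iff Int_greaterThanLessThan)
      qed
    qed
    have "increments f ?D = (\<Sum>(s, t)\<in>?h ` D. cmod (f t - f s))"
      unfolding increments_def
    proof (rule sum.mono_neutral_left)
      show "\<forall>i\<in>?h ` D - ?D. (case i of (s, t) \<Rightarrow> cmod (f t - f s)) = 0"
      proof
        fix i assume i: "i \<in> ?h ` D - ?D"
        then obtain s t where "(s, t) \<in> D" "i = (h s, h t)"
          by auto
        moreover then have "h s = h t"
          using st[of s t] monoD[OF h, of s t] i by force
        ultimately show "(case i of (s, t) \<Rightarrow> cmod (f t - f s)) = 0"
          by simp
      qed
    qed (use fin in auto)
    also have "\<dots> = (\<Sum>(s, t)\<in>D. cmod (f (h t) - f (h s)))"
    proof (subst sum.reindex_nontrivial)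
      fix p q assume pq: "p \<in> D" "q \<in> D" "p \<noteq> q" "?h p = ?h q"
      obtain s t s' t' where eq: "p = (s, t)" "q = (s', t')"
        by (cases p; cases q)
      have "h s = h t"
      proof (rule ccontr)
        assume "h s \<noteq> h t"
        then have "h s < h t"
          using monoD[OF h, of s t] st[of s t] pq eq by simp
        have "{h s<..<h t} \<subseteq> {s<..<t} \<inter> {s'<..<t'}"
          using sub[of s t] sub[of s' t'] pq eq by (simp del: Int_greaterThanLessThan)
        then show False
          using disj[of s t s' t'] pq eq \<open>h s < h t\<close> by simp
      qed
      then show "(case ?h p of (s, t) \<Rightarrow> cmod (f t - f s)) = 0"
        using eq by simp
    qed (use fin in \<open>auto intro!: sum.cong\<close>)
    finally show "increments f ?D = (\<Sum>(s, t)\<in>D. cmod (f (h t) - f (h s)))" .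
  qed
  have low: "mono (\<lambda>x. min x c)" and high: "mono (\<lambda>x. max x c)"
    by (auto simp: mono_def)
  note l = clip[OF low, of a c]
  note u = clip[OF high, of c b]
  show ?thesis
  proof (rule that)
    show "nonoverlapping a c {p \<in> (\<lambda>(s, t). (min s c, min t c)) ` D. fst p < snd p}"
      by (rule l) auto
    show "nonoverlapping c b {p \<in> (\<lambda>(s, t). (max s c, max t c)) ` D. fst p < snd p}"
      by (rule u) auto
    have "increments f D \<le> (\<Sum>(s, t)\<in>D. cmod (f (min t c) - f (min s c)) + cmod (f (max t c) - f (max s c)))"
      unfolding increments_def
    proof (rule sum_mono)
      fix p assume "p \<in> D"
      obtain s t where p: "p = (s, t)"
        by (cases p)
      have "s < t"
        using st[of s t] p \<open>p \<in> D\<close> by simp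
      have "cmod (f t - f s) \<le> cmod (f c - f s) + cmod (f t - f c)"
        by (metis add.commute diff_add_cancel add_diff_eq norm_triangle_ineq)
      then show "(case p of (s, t) \<Rightarrow> cmod (f t - f s)) \<le> (case p of (s, t) \<Rightarrow>
          cmod (f (min t c) - f (min s c)) + cmod (f (max t c) - f (max s c)))"
        using \<open>s < t\<close> by (auto simp: p min_def max_def)
    qed
    also have "\<dots> = increments f {p \<in> (\<lambda>(s, t). (min s c, min t c)) ` D. fst p < snd p}
        + increments f {p \<in> (\<lambda>(s, t). (max s c, max t c)) ` D. fst p < snd p}"
    proof -
      have "increments f {p \<in> (\<lambda>(s, t). (min s c, min t c)) ` D. fst p < snd p}
          = (\<Sum>(s, t)\<in>D. cmod (f (min t c) - f (min s c)))"
        by (rule l) auto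
      moreover have "increments f {p \<in> (\<lambda>(s, t). (max s c, max t c)) ` D. fst p < snd p}
          = (\<Sum>(s, t)\<in>D. cmod (f (max t c) - f (max s c)))"
        by (rule u) auto
      ultimately show ?thesis
        by (simp add: sum.distrib case_prod_unfold)
    qed
    finally show "increments f D \<le> increments f {p \<in> (\<lambda>(s, t). (min s c, min t c)) ` D. fst p < snd p}
        + increments f {p \<in> (\<lambda>(s, t). (max s c, max t c)) ` D. fst p < snd p}" .
  qed
qed

lemma absolutely_continuous_onD:
  assumes "absolutely_continuous_on a b f" "0 < \<epsilon>"
  obtains \<delta> where "0 < \<delta>"
    "\<And>D. nonoverlapping a b D \<Longrightarrow> (\<Sum>(s, t)\<in>D. t - s) < \<delta> \<Longrightarrow> increments f D < \<epsilon>"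
proof -
  obtain \<delta> where d: "\<delta> > 0" "\<forall>D. finite D \<and> (\<forall>(s, t)\<in>D. a \<le> s \<and> s \<le> t \<and> t \<le> b) \<and>
        disjoint_family_on (\<lambda>(s, t). {s<..<t}) D \<and> (\<Sum>(s, t)\<in>D. t - s) < \<delta> \<longrightarrow>
        (\<Sum>(s, t)\<in>D. cmod (f t - f s)) < \<epsilon>"
    using assms unfolding absolutely_continuous_on_def by blast
  show ?thesis
  proof (rule that[OF d(1)])
    fix D assume D: "nonoverlapping a b D" "(\<Sum>(s, t)\<in>D. t - s) < \<delta>"
    have "\<forall>(s, t)\<in>D. a \<le> s \<and> s \<le> t \<and> t \<le> b"
      using D(1) by (auto simp: nonoverlapping_def)
    then show "increments f D < \<epsilon>"
      using D d(2) unfolding increments_def nonoverlapping_def by blast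
  qed
qed

lemma nonoverlapping_subinterval:
  "nonoverlapping c d D \<Longrightarrow> a \<le> c \<Longrightarrow> d \<le> b \<Longrightarrow> nonoverlapping a b D"
  by (fastforce simp: nonoverlapping_def)

text \<open>
  Cut \<open>[a,b]\<close> into pieces shorter than the \<open>\<delta>\<close> that belongs to \<open>\<epsilon> = 1\<close>. On each piece the variation is at most 1,
  so the number of pieces bounds the variation.
\<close>

lemma bounded_variation_of_AC:
  assumes ac: "absolutely_continuous_on a b f" and "a \<le> b"
  shows "bdd_above (increments f ` Collect (nonoverlapping a b))"
proof -
  obtain \<delta> where d: "\<delta> > 0"
    "\<And>D. nonoverlapping a b D \<Longrightarrow> (\<Sum>(s, t)\<in>D. t - s) < \<delta> \<Longrightarrow> increments f D < 1"
    using absolutely_continuous_onD[OF ac, of 1] by auto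
  \<comment> \<open>A step of half the length keeps the total length of each piece strictly below \<open>\<delta>\<close>.\<close>
  have "\<forall>D. nonoverlapping a (min b (a + n * (\<delta> / 2))) D \<longrightarrow> increments f D \<le> n" for n :: nat
  proof (induction n)
    case 0
    have *: "D = {}" if "nonoverlapping a (min b a) D" for D
    proof -
      have "\<And>p. p \<in> D \<Longrightarrow> False"
        using that by (fastforce simp: nonoverlapping_def)
      then show ?thesis by auto
    qed
    have "increments f D \<le> 0" if "nonoverlapping a (min b a) D" for D
      using *[of D] \<open>nonoverlapping a (min b a) D\<close> unfolding increments_def by (metis sum.empty order_refl)
    then show ?case
      by simp
  next
    case (Suc n)
    show ?case
    proof (intro allI impI)
      fix D assume D: "nonoverlapping a (min b (a + Suc n * (\<delta> / 2))) D"
      let ?c = "min b (a + n * (\<delta> / 2))" and ?d = "min b (a + Suc n * (\<delta> / 2))"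
      obtain D1 D2 where D12: "nonoverlapping a ?c D1" "nonoverlapping ?c ?d D2"
        "increments f D \<le> increments f D1 + increments f D2"
        using nonoverlapping_split[OF D, of ?c f] by blast
      have cd: "?c \<le> ?d" "?d - ?c \<le> \<delta> / 2"
      proof -
        have eq: "a + Suc n * (\<delta> / 2) = a + n * (\<delta> / 2) + \<delta> / 2"
          by (simp add: algebra_simps)
        have "min b X \<le> min b (X + e) \<and> min b (X + e) - min b X \<le> e" if "e \<ge> 0" for X e :: real
          using that by (auto simp: min_def)
        from this[of "\<delta> / 2" "a + n * (\<delta> / 2)"] show "?c \<le> ?d" "?d - ?c \<le> \<delta> / 2"
          using d(1) unfolding eq by linarith+
      qed
      have "(\<Sum>(s, t)\<in>D2. t - s) < \<delta>"
        using nonoverlapping_length[OF D12(2) cd(1)] cd(2) d(1) by linarith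
      moreover have "nonoverlapping a b D2"
        using D12(2) \<open>a \<le> b\<close> d(1) by (intro nonoverlapping_subinterval[OF D12(2)]) auto
      ultimately have "increments f D2 < 1"
        by (intro d(2))
      then show "increments f D \<le> real (Suc n)"
        using D12 Suc.IH by force
    qed
  qed
  moreover obtain n :: nat where "(b - a) / (\<delta> / 2) \<le> n"
    using real_arch_simple by blast
  then have "min b (a + n * (\<delta> / 2)) = b"
    using d(1) by (auto simp: min_def field_simps)
  ultimately show ?thesis
    by (intro bdd_aboveI2[of _ _ "real n"]) (metis mem_Collect_eq)
qed

lemma AC_subinterval:
  assumes "absolutely_continuous_on a b f" "a \<le> c" "d \<le> b"
  shows "absolutely_continuous_on c d f"
proof -
  have "\<forall>(s, t)\<in>D. a \<le> s \<and> s \<le> t \<and> t \<le> b" if "\<forall>(s, t)\<in>D. c \<le> s \<and> s \<le> t \<and> t \<le> d" for D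
    using that assms(2,3) by fastforce
  then show ?thesis
    using assms(1) unfolding absolutely_continuous_on_def by meson
qed

lemma increments_le_variation:
  assumes "absolutely_continuous_on a b f" "a \<le> b" "nonoverlapping a b D"
  shows "increments f D \<le> variation f a b"
  unfolding variation_def
  by (rule cSUP_upper) (use assms bounded_variation_of_AC in auto)

lemma variation_superadditive:
  assumes ac: "absolutely_continuous_on a b f" and st: "a \<le> s" "s \<le> t" "t \<le> b"
  shows "variation f a s + cmod (f t - f s) \<le> variation f a t"
proof (cases "s = t")
  case False
  then have "s < t"
    using st by simp
  have "increments f D \<le> variation f a t - cmod (f t - f s)" if D: "nonoverlapping a s D" for D
  proof -
    have fin: "finite D" and notin: "(s, t) \<notin> D"
      using D \<open>s < t\<close> by (auto simp: nonoverlapping_def)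
    have "nonoverlapping a t (insert (s, t) D)"
      unfolding nonoverlapping_def
    proof (intro conjI)
      show "disjoint_family_on (\<lambda>(s, t). {s<..<t}) (insert (s, t) D)"
        using D notin by (subst disjoint_family_on_insert) (fastforce simp: nonoverlapping_def)+
      show "\<forall>(s', t')\<in>insert (s, t) D. a \<le> s' \<and> s' < t' \<and> t' \<le> t"
        using D \<open>s < t\<close> st by (fastforce simp: nonoverlapping_def)
    qed (use fin in simp)
    then have "increments f (insert (s, t) D) \<le> variation f a t"
      using st by (intro increments_le_variation AC_subinterval[OF ac]) auto
    then show ?thesis
      using fin notin by (simp add: increments_def)
  qed
  then have "variation f a s \<le> variation f a t - cmod (f t - f s)"
    unfolding variation_def[of f a s] using nonoverlapping_empty by (intro cSUP_least) auto
  then show ?thesis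
    by simp
qed simp

lemma variation_subadditive:
  assumes ac: "absolutely_continuous_on a b f" and st: "a \<le> s" "s \<le> t" "t \<le> b"
  shows "variation f a t \<le> variation f a s + variation f s t"
  unfolding variation_def[of f a t]
proof (rule cSUP_least)
  show "Collect (nonoverlapping a t) \<noteq> {}"
    using nonoverlapping_empty by auto
  fix D assume "D \<in> Collect (nonoverlapping a t)"
  then obtain D1 D2 where D: "nonoverlapping a s D1" "nonoverlapping s t D2"
    "increments f D \<le> increments f D1 + increments f D2"
    using nonoverlapping_split[of a t D s f] by auto
  have "increments f D1 \<le> variation f a s" "increments f D2 \<le> variation f s t"
    using D st by (auto intro!: increments_le_variation AC_subinterval[OF ac])
  then show "increments f D \<le> variation f a s + variation f s t"
    using D by simp
qed

text \<open>
  Replace each interval of a family of small total length by a subfamily that nearly exhausts the variation on it.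
  The union is again a nonoverlapping family of small total length, so the increments of \<open>f\<close> over it are small.
\<close>

lemma variation_AC:
  assumes ac: "absolutely_continuous_on a b f" and "a \<le> b"
  shows "absolutely_continuous_on a b (\<lambda>x. complex_of_real (variation f a x))"
  unfolding absolutely_continuous_on_def
proof (intro allI impI)
  fix \<epsilon> :: real assume "\<epsilon> > 0"
  then obtain \<delta> where \<delta>: "\<delta> > 0"
    "\<And>D. nonoverlapping a b D \<Longrightarrow> (\<Sum>(s, t)\<in>D. t - s) < \<delta> \<Longrightarrow> increments f D < \<epsilon> / 2"
    using absolutely_continuous_onD[OF ac, of "\<epsilon> / 2"] by auto
  show "\<exists>\<delta>>0. \<forall>D. finite D \<and> (\<forall>(s, t)\<in>D. a \<le> s \<and> s \<le> t \<and> t \<le> b) \<and>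
        disjoint_family_on (\<lambda>(s, t). {s<..<t}) D \<and> (\<Sum>(s, t)\<in>D. t - s) < \<delta> \<longrightarrow>
        (\<Sum>(s, t)\<in>D. cmod (complex_of_real (variation f a t) - complex_of_real (variation f a s))) < \<epsilon>"
  proof (intro exI[of _ \<delta>] conjI \<delta>(1) allI impI)
    fix D0 :: "(real \<times> real) set"
    assume D0: "finite D0 \<and> (\<forall>(s, t)\<in>D0. a \<le> s \<and> s \<le> t \<and> t \<le> b) \<and>
        disjoint_family_on (\<lambda>(s, t). {s<..<t}) D0 \<and> (\<Sum>(s, t)\<in>D0. t - s) < \<delta>"
    define D where "D = {p\<in>D0. fst p < snd p}"
    have fin: "finite D" and st: "\<And>p. p \<in> D \<Longrightarrow> a \<le> fst p \<and> fst p < snd p \<and> snd p \<le> b"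
      using D0 by (auto simp: D_def)
    have disj: "{fst p<..<snd p} \<inter> {fst q<..<snd q} = {}" if "p \<in> D" "q \<in> D" "p \<noteq> q" for p q
      using D0 that unfolding D_def disjoint_family_on_def case_prod_unfold by blast
    \<comment> \<open>The error allowed for each of the intervals, so that all errors together stay below \<open>\<epsilon> / 2\<close>.\<close>
    define \<eta> where "\<eta> = \<epsilon> / (2 * (card D + 1))"
    have \<eta>: "\<eta> > 0" "card D * \<eta> < \<epsilon> / 2"
      using \<open>\<epsilon> > 0\<close> by (auto simp: \<eta>_def field_simps)
    have "\<exists>E. nonoverlapping (fst p) (snd p) E \<and>
        variation f a (snd p) - variation f a (fst p) - \<eta> \<le> increments f E" if "p \<in> D" for p
    proof -
      have "variation f (fst p) (snd p) - \<eta> < variation f (fst p) (snd p)"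
        using \<eta> by simp
      moreover have "bdd_above (increments f ` Collect (nonoverlapping (fst p) (snd p)))"
        using st[OF that] by (intro bounded_variation_of_AC AC_subinterval[OF ac]) auto
      ultimately obtain E where E: "nonoverlapping (fst p) (snd p) E"
          "variation f (fst p) (snd p) - \<eta> < increments f E"
        unfolding variation_def using nonoverlapping_empty by (subst (asm) less_cSUP_iff) auto
      moreover have "variation f a (snd p) \<le> variation f a (fst p) + variation f (fst p) (snd p)"
        using st[OF that] by (intro variation_subadditive[OF ac]) auto
      ultimately show ?thesis
        by (intro exI[of _ E]) auto
    qed
    then obtain E where E: "\<And>p. p \<in> D \<Longrightarrow> nonoverlapping (fst p) (snd p) (E p)"
      and var: "\<And>p. p \<in> D \<Longrightarrow> variation f a (snd p) - variation f a (fst p) - \<eta> \<le> increments f (E p)"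
      by metis
    have inE: "fst p \<le> s \<and> s < t \<and> t \<le> snd p" if "p \<in> D" "(s, t) \<in> E p" for p s t
      using E[OF that(1)] that(2) by (auto simp: nonoverlapping_def)
    have finE: "\<And>p. p \<in> D \<Longrightarrow> finite (E p)"
      using E by (auto simp: nonoverlapping_def)
    have cross: "{s<..<t} \<inter> {s'<..<t'} = {}"
      if "p \<in> D" "q \<in> D" "p \<noteq> q" "(s, t) \<in> E p" "(s', t') \<in> E q" for p q s t s' t'
    proof -
      have "{s<..<t} \<inter> {s'<..<t'} \<subseteq> {fst p<..<snd p} \<inter> {fst q<..<snd q}"
        using inE[OF that(1,4)] inE[OF that(2,5)] by (intro Int_mono) auto
      then show ?thesis
        unfolding disj[OF that(1-3)] by (rule subset_empty[THEN iffD1])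
    qed
    have disjE: "E p \<inter> E q = {}" if "p \<in> D" "q \<in> D" "p \<noteq> q" for p q
    proof (rule ccontr)
      assume "E p \<inter> E q \<noteq> {}"
      then obtain s t where "(s, t) \<in> E p" "(s, t) \<in> E q"
        by auto
      then show False
        using cross[OF that, of s t s t] inE[OF that(1), of s t] by simp
    qed
    have U: "nonoverlapping a b (\<Union>p\<in>D. E p)"
      unfolding nonoverlapping_def
    proof (intro conjI)
      show "finite (\<Union>p\<in>D. E p)"
        using fin finE by auto
      show "\<forall>(s, t)\<in>\<Union>p\<in>D. E p. a \<le> s \<and> s < t \<and> t \<le> b"
        using inE st by fastforce
      show "disjoint_family_on (\<lambda>(s, t). {s<..<t}) (\<Union>p\<in>D. E p)"
      proof (unfold disjoint_family_on_def, intro ballI impI)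
        fix u v assume uv: "u \<in> (\<Union>p\<in>D. E p)" "v \<in> (\<Union>p\<in>D. E p)" "u \<noteq> v"
        then obtain p q where pq: "p \<in> D" "q \<in> D" "u \<in> E p" "v \<in> E q"
          by auto
        show "(case u of (s, t) \<Rightarrow> {s<..<t}) \<inter> (case v of (s, t) \<Rightarrow> {s<..<t}) = {}"
        proof (cases "p = q")
          case True
          then show ?thesis
            using E[OF pq(1)] pq uv(3) unfolding nonoverlapping_def disjoint_family_on_def by blast
        next
          case False
          then show ?thesis
            using cross[OF pq(1,2) False, of "fst u" "snd u" "fst v" "snd v"] pq
            by (simp add: case_prod_unfold)
        qed
      qed
    qed
    have "(\<Sum>(s, t)\<in>(\<Union>p\<in>D. E p). t - s) = (\<Sum>p\<in>D. \<Sum>(s, t)\<in>E p. t - s)"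
      using fin finE disjE by (intro sum.UNION_disjoint) auto
    also have "\<dots> \<le> (\<Sum>p\<in>D. snd p - fst p)"
      using E st by (intro sum_mono nonoverlapping_length) (auto simp: less_imp_le)
    also have "\<dots> = (\<Sum>p\<in>D0. snd p - fst p)"
      using D0 by (intro sum.mono_neutral_left) (fastforce simp: D_def)+
    also have "\<dots> < \<delta>"
      using D0 by (simp add: case_prod_unfold)
    finally have "increments f (\<Union>p\<in>D. E p) < \<epsilon> / 2"
      using U \<delta>(2) by blast
    moreover have "increments f (\<Union>p\<in>D. E p) = (\<Sum>p\<in>D. increments f (E p))"
      unfolding increments_def using fin finE disjE by (intro sum.UNION_disjoint) auto
    ultimately have inc: "(\<Sum>p\<in>D. increments f (E p)) < \<epsilon> / 2"
      by simp
    have "(\<Sum>p\<in>D0. cmod (complex_of_real (variation f a (snd p)) - complex_of_real (variation f a (fst p))))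
      = (\<Sum>p\<in>D. cmod (complex_of_real (variation f a (snd p)) - complex_of_real (variation f a (fst p))))"
      using D0 by (intro sum.mono_neutral_right) (fastforce simp: D_def)+
    also have "\<dots> = (\<Sum>p\<in>D. variation f a (snd p) - variation f a (fst p))"
    proof (rule sum.cong[OF refl])
      fix p assume p: "p \<in> D"
      have "variation f a (fst p) + cmod (f (snd p) - f (fst p)) \<le> variation f a (snd p)"
        using st[OF p] by (intro variation_superadditive[OF ac]) auto
      then show "cmod (complex_of_real (variation f a (snd p)) - complex_of_real (variation f a (fst p)))
          = variation f a (snd p) - variation f a (fst p)"
        unfolding of_real_diff[symmetric] norm_of_real by (smt (verit) norm_ge_zero)
    qed
    also have "\<dots> \<le> (\<Sum>p\<in>D. increments f (E p) + \<eta>)"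
      using var by (intro sum_mono) (simp add: algebra_simps)
    also have "\<dots> = (\<Sum>p\<in>D. increments f (E p)) + card D * \<eta>"
      by (simp add: sum.distrib)
    also have "\<dots> < \<epsilon>"
      using inc \<eta> by simp
    finally show "(\<Sum>(s, t)\<in>D0. cmod (complex_of_real (variation f a t) - complex_of_real (variation f a s))) < \<epsilon>"
      by (simp add: case_prod_unfold)
  qed
qed

lemma AC_two_points:
  assumes ac: "absolutely_continuous_on a b f" and "\<epsilon> > 0"
  obtains \<delta> where "\<delta> > 0" "\<And>s t. a \<le> s \<Longrightarrow> s \<le> t \<Longrightarrow> t \<le> b \<Longrightarrow> t - s < \<delta> \<Longrightarrow> cmod (f t - f s) < \<epsilon>"
proof -
  obtain \<delta> where \<delta>: "\<delta> > 0"
    "\<And>D. nonoverlapping a b D \<Longrightarrow> (\<Sum>(s, t)\<in>D. t - s) < \<delta> \<Longrightarrow> increments f D < \<epsilon>"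
    using absolutely_continuous_onD[OF assms] by blast
  show ?thesis
  proof (rule that[OF \<delta>(1)])
    fix s t assume "a \<le> s" "s \<le> t" "t \<le> b" "t - s < \<delta>"
    then show "cmod (f t - f s) < \<epsilon>"
      using \<delta>(2)[of "{(s, t)}"] \<open>\<epsilon> > 0\<close>
      by (cases "s = t") (auto simp: nonoverlapping_def disjoint_family_on_def increments_def)
  qed
qed

lemma AC_continuous_on:
  assumes ac: "absolutely_continuous_on a b f"
  shows "continuous_on {a..b} f"
  unfolding continuous_on_iff
proof (intro ballI allI impI)
  fix x \<epsilon> :: real assume x: "x \<in> {a..b}" and "\<epsilon> > 0"
  then obtain \<delta> where \<delta>: "\<delta> > 0" "\<And>s t. a \<le> s \<Longrightarrow> s \<le> t \<Longrightarrow> t \<le> b \<Longrightarrow> t - s < \<delta> \<Longrightarrow> cmod (f t - f s) < \<epsilon>"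
    using AC_two_points[OF ac] by blast
  show "\<exists>d>0. \<forall>x'\<in>{a..b}. dist x' x < d \<longrightarrow> dist (f x') (f x) < \<epsilon>"
  proof (intro exI[of _ \<delta>] conjI \<delta>(1) ballI impI)
    fix y assume y: "y \<in> {a..b}" "dist y x < \<delta>"
    show "dist (f y) (f x) < \<epsilon>"
      using \<delta>(2)[of x y] \<delta>(2)[of y x] x y
      by (cases "x \<le> y") (auto simp: dist_norm norm_minus_commute)
  qed
qed

text \<open>
  A monotone continuous function defines a measure that assigns \<open>F t - F s\<close> to \<open>[s,t]\<close>. Absolute continuity of
  \<open>F\<close> makes this measure absolutely continuous with respect to Lebesgue measure: a null set lies in an open set of
  small measure, and the covering lemma fills it by countably many nonoverlapping intervals inside that open set.
  The Radon-Nikodym theorem then provides the density.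
\<close>

lemma mono_AC_density:
  fixes F :: "real \<Rightarrow> real"
  assumes ab: "a \<le> b" and mono: "\<And>s t. a \<le> s \<Longrightarrow> s \<le> t \<Longrightarrow> t \<le> b \<Longrightarrow> F s \<le> F t"
    and ac: "absolutely_continuous_on a b (\<lambda>x. complex_of_real (F x))"
  obtains h where "integrable lborel h"
    "\<And>x. x \<in> {a..b} \<Longrightarrow> F x - F a = (LINT y:{a..x}|lborel. h y)"
proof (cases "a = b")
  case True
  show ?thesis
    by (rule that[of "\<lambda>_. 0"]) (use True in \<open>auto simp: set_lebesgue_integral_def\<close>)
next
  case False
  then have "a < b"
    using ab by simp
  \<comment> \<open>Constant continuation beyond \<open>[a,b]\<close>, because interval measures are defined by functions on the whole line.\<close>
  define G where "G x = F (max a (min b x))" for x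
  have Geq: "G x = F x" if "x \<in> {a..b}" for x
    using that by (simp add: G_def)
  have Gmono: "G x \<le> G y" if "x \<le> y" for x y
    unfolding G_def using that ab by (intro mono) auto
  have "continuous_on {a..b} (\<lambda>x. Re (complex_of_real (F x)))"
    by (intro continuous_intros AC_continuous_on[OF ac])
  then have "continuous_on UNIV (\<lambda>x. F (max a (min b x)))"
    by (intro continuous_on_compose2[of "{a..b}" F UNIV "\<lambda>x. max a (min b x)"] continuous_on_max continuous_on_min
        continuous_on_id continuous_on_const) (use ab in auto)
  then have Gcont: "continuous_on UNIV G"
    unfolding G_def by simp
  define M where "M = interval_measure G"
  have Icc: "emeasure M {s..t} = ennreal (G t - G s)" if "s \<le> t" for s t
    unfolding M_def using that Gmono Gcont by (intro emeasure_interval_measure_Icc) auto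
  have [measurable_cong, simp]: "sets M = sets borel"
    by (simp add: M_def)
  define N where "N = density M (indicator {a..b})"
  have Neq: "emeasure N A = emeasure M (A \<inter> {a..b})" if "A \<in> sets borel" for A
  proof -
    have "emeasure N A = (\<integral>\<^sup>+x. indicator {a..b} x * indicator A x \<partial>M)"
      unfolding N_def using that by (subst emeasure_density) auto
    also have "\<dots> = (\<integral>\<^sup>+x. indicator (A \<inter> {a..b}) x \<partial>M)"
      by (intro nn_integral_cong) (auto simp: indicator_def)
    finally show ?thesis
      using that by simp
  qed
  have "absolutely_continuous lborel N"
    unfolding absolutely_continuous_def
  proof
    fix A :: "real set" assume A: "A \<in> null_sets lborel"
    define S where "S = A \<inter> {a..b}"
    have S: "S \<in> sets borel" "S \<subseteq> cbox a b" "emeasure lborel S = 0"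
    proof -
      show "S \<in> sets borel"
        using A by (auto simp: S_def)
      show "S \<subseteq> cbox a b"
        by (auto simp: S_def)
      show "emeasure lborel S = 0"
        using A by (metis S_def null_setsD1 null_set_Int2 sets_lborel borel_closed closed_real_atLeastAtMost Int_commute)
    qed
    have "emeasure M S \<le> 0 + ennreal \<epsilon>" if "\<epsilon> > 0" for \<epsilon>
    proof -
      obtain \<delta> where \<delta>: "\<delta> > 0" "\<And>D. nonoverlapping a b D \<Longrightarrow> (\<Sum>(s, t)\<in>D. t - s) < \<delta>
          \<Longrightarrow> increments (\<lambda>x. complex_of_real (F x)) D < \<epsilon>"
        using absolutely_continuous_onD[OF ac \<open>\<epsilon> > 0\<close>] by blast
      obtain U where U: "open U" "S \<subseteq> U" "emeasure lborel (U - S) < \<delta>"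
        using outer_regular_lborel[OF S(1) \<delta>(1)] by blast
      have "emeasure lborel U \<le> emeasure lborel (U - S) + emeasure lborel S"
        using U S by (metis emeasure_subadditive Un_Diff_cancel2 Un_absorb2 sets.Diff sets_lborel borel_open)
      then have U\<delta>: "emeasure lborel U < \<delta>"
        using U(3) S(3) by simp
      \<comment> \<open>This gauge forces every interval of the covering into \<open>U\<close>.\<close>
      have "gauge (\<lambda>x. if x \<in> U then U else UNIV)"
        using U(1) by (auto simp: gauge_def)
      then obtain \<D> where \<D>: "countable \<D>" "\<Union>\<D> \<subseteq> cbox a b"
          "\<And>K. K \<in> \<D> \<Longrightarrow> interior K \<noteq> {} \<and> (\<exists>c d. K = cbox c d)"
          "pairwise (\<lambda>A B. interior A \<inter> interior B = {}) \<D>"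
          "\<And>K. K \<in> \<D> \<Longrightarrow> \<exists>x \<in> S \<inter> K. K \<subseteq> (if x \<in> U then U else UNIV)"
          "S \<subseteq> \<Union>\<D>"
        using covering_lemma[OF S(2), of "\<lambda>x. if x \<in> U then U else UNIV"] \<open>a < b\<close>
        by (smt (verit) box_real(1) greaterThanLessThan_empty_iff)
      have KU: "K \<subseteq> U" if "K \<in> \<D>" for K
        using \<D>(5)[OF that] U(2) by (auto split: if_splits)
      have Kcd: "K = {Inf K..Sup K} \<and> Inf K < Sup K \<and> a \<le> Inf K \<and> Sup K \<le> b" if "K \<in> \<D>" for K
      proof -
        obtain c d where K: "K = {c..d}" "interior K \<noteq> {}"
          using \<D>(3)[OF \<open>K \<in> \<D>\<close>] by auto
        then have "c < d"
          by simp
        moreover have "K \<subseteq> {a..b}"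
          using \<D>(2) that by auto
        ultimately show ?thesis
          using K(1) by (auto simp: cInf_atLeastAtMost cSup_atLeastAtMost)
      qed
      \<comment> \<open>Absolute continuity speaks about finite families only; continuity from below extends the bound to all of \<open>\<D>\<close>.\<close>
      have fin: "emeasure M (\<Union>\<F>) \<le> ennreal \<epsilon>" if "finite \<F>" "\<F> \<subseteq> \<D>" for \<F>
      proof -
        define P where "P = (\<lambda>K. (Inf K, Sup K)) ` \<F>"
        have inj: "inj_on (\<lambda>K. (Inf K, Sup K)) \<F>"
          by (rule inj_onI) (metis Kcd Pair_inject subsetD \<open>\<F> \<subseteq> \<D>\<close>)
        have P: "nonoverlapping a b P"
          unfolding nonoverlapping_def
        proof (intro conjI)
          show "\<forall>(s, t)\<in>P. a \<le> s \<and> s < t \<and> t \<le> b"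
          proof
            fix p assume "p \<in> P"
            then obtain K where "K \<in> \<D>" "p = (Inf K, Sup K)"
              using \<open>\<F> \<subseteq> \<D>\<close> by (auto simp: P_def)
            then show "case p of (s, t) \<Rightarrow> a \<le> s \<and> s < t \<and> t \<le> b"
              using Kcd[of K] by simp
          qed
          show "disjoint_family_on (\<lambda>(s, t). {s<..<t}) P"
            unfolding disjoint_family_on_def
          proof (intro ballI impI)
            fix p q assume "p \<in> P" "q \<in> P" "p \<noteq> q"
            then obtain K L where KL: "K \<in> \<F>" "L \<in> \<F>" "p = (Inf K, Sup K)" "q = (Inf L, Sup L)" "K \<noteq> L"
              by (auto simp: P_def)
            then have "interior K \<inter> interior L = {}"
              using \<D>(4) that by (auto simp: pairwise_def)
            moreover have "interior K = {Inf K<..<Sup K}" "interior L = {Inf L<..<Sup L}"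
              using Kcd[of K] Kcd[of L] KL that by (metis interior_atLeastAtMost_real subsetD)+
            ultimately show "(case p of (s, t) \<Rightarrow> {s<..<t}) \<inter> (case q of (s, t) \<Rightarrow> {s<..<t}) = {}"
              using KL by simp
          qed
        qed (use that in \<open>simp add: P_def\<close>)
        have "{s<..<t} \<subseteq> U" if "(s, t) \<in> P" for s t
        proof -
          obtain K where "K \<in> \<D>" "s = Inf K" "t = Sup K"
            using \<open>(s, t) \<in> P\<close> \<open>\<F> \<subseteq> \<D>\<close> by (auto simp: P_def)
          then show ?thesis
            using Kcd[of K] KU[of K] by (metis greaterThanLessThan_subseteq_atLeastAtMost_iff order_refl order_trans)
        qed
        then have "ennreal (\<Sum>(s, t)\<in>P. t - s) < ennreal \<delta>"
          using nonoverlapping_length_measure[OF P, of U] U(1) U\<delta> by (auto intro: le_less_trans)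
        then have "(\<Sum>(s, t)\<in>P. t - s) < \<delta>"
          by (smt (verit) ennreal_leI leD)
        then have inc: "increments (\<lambda>x. complex_of_real (F x)) P < \<epsilon>"
          using \<delta>(2)[OF P] by simp
        have "emeasure M (\<Union>K\<in>\<F>. K) \<le> (\<Sum>K\<in>\<F>. emeasure M K)"
        proof (rule emeasure_subadditive_finite)
          show "(\<lambda>K. K) ` \<F> \<subseteq> sets M"
          proof
            fix X assume "X \<in> (\<lambda>K. K) ` \<F>"
            then have "X \<in> \<D>"
              using that by auto
            then have "X = {Inf X..Sup X}"
              using Kcd[of X] by blast
            then show "X \<in> sets M"
              using atLeastAtMost_borel \<open>sets M = sets borel\<close> by metis
          qed
        qed (use that in auto)
        also have "\<dots> = (\<Sum>K\<in>\<F>. ennreal (F (Sup K) - F (Inf K)))"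
        proof (rule sum.cong[OF refl])
          fix K assume "K \<in> \<F>"
          then have "K \<in> \<D>"
            using that by auto
          then have K: "K = {Inf K..Sup K}" "Inf K < Sup K" "a \<le> Inf K" "Sup K \<le> b"
            using Kcd[of K] by blast+
          have "emeasure M {Inf K..Sup K} = ennreal (F (Sup K) - F (Inf K))"
            using K(2-) by (subst Icc) (auto simp: Geq)
          then show "emeasure M K = ennreal (F (Sup K) - F (Inf K))"
            unfolding K(1)[symmetric] .
        qed
        also have "\<dots> = ennreal (\<Sum>K\<in>\<F>. F (Sup K) - F (Inf K))"
        proof (rule sum_ennreal)
          fix K assume "K \<in> \<F>"
          then have "K \<in> \<D>"
            using that by auto
          then have "Inf K < Sup K" "a \<le> Inf K" "Sup K \<le> b"
            using Kcd[of K] by blast+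
          then show "0 \<le> F (Sup K) - F (Inf K)"
            using mono[of "Inf K" "Sup K"] by simp
        qed
        also have "(\<Sum>K\<in>\<F>. F (Sup K) - F (Inf K)) = (\<Sum>(s, t)\<in>P. F t - F s)"
          unfolding P_def using inj by (subst sum.reindex) auto
        finally have "emeasure M (\<Union>K\<in>\<F>. K) \<le> ennreal (\<Sum>(s, t)\<in>P. F t - F s)" .
        moreover have "(\<Sum>(s, t)\<in>P. F t - F s) \<le> increments (\<lambda>x. complex_of_real (F x)) P"
          unfolding increments_def of_real_diff[symmetric] norm_of_real by (intro sum_mono) auto
        ultimately have "emeasure M (\<Union>K\<in>\<F>. K) \<le> ennreal (increments (\<lambda>x. complex_of_real (F x)) P)"
          by (meson ennreal_leI order_trans)
        from order_trans[OF this ennreal_leI[OF less_imp_le[OF inc]]] show ?thesis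
          by simp
      qed
      have "emeasure M (\<Union>\<D>) \<le> ennreal \<epsilon>"
      proof (cases "\<D> = {}")
        case False
        define A where "A n = (\<Union>i<n. from_nat_into \<D> i)" for n :: nat
        have in\<D>: "from_nat_into \<D> i \<in> \<D>" for i
          using False by (rule from_nat_into)
        have "incseq A"
          unfolding A_def by (intro monoI UN_mono) auto
        moreover have "range A \<subseteq> sets M"
        proof -
          have "from_nat_into \<D> i \<in> sets borel" for i
            using conjunct1[OF Kcd[OF in\<D>[of i]]] atLeastAtMost_borel by metis
          then show ?thesis
            by (auto simp: A_def)
        qed
        ultimately have "emeasure M (\<Union>n. A n) = (SUP n. emeasure M (A n))"
          by (intro SUP_emeasure_incseq[symmetric]) auto
        also have "\<dots> \<le> ennreal \<epsilon>"
        proof (rule SUP_least)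
          fix n show "emeasure M (A n) \<le> ennreal \<epsilon>"
            unfolding A_def using in\<D> by (intro fin) auto
        qed
        also have "(\<Union>n. A n) = (\<Union>i. from_nat_into \<D> i)"
          by (auto simp: A_def)
        also have "\<dots> = \<Union>\<D>"
          using \<D>(1) False by (simp add: range_from_nat_into)
        finally show ?thesis .
      qed simp
      moreover have "emeasure M S \<le> emeasure M (\<Union>\<D>)"
      proof (rule emeasure_mono[OF \<D>(6)])
        have "K \<in> sets M" if "K \<in> \<D>" for K
          using conjunct1[OF Kcd[OF that]] atLeastAtMost_borel \<open>sets M = sets borel\<close> by metis
        then show "\<Union>\<D> \<in> sets M"
          using \<D>(1) by (intro sets.countable_Union) auto
      qed
      ultimately show ?thesis
        by simp
    qed
    then have "emeasure M S = 0"
      using ennreal_le_epsilon[of 0 "emeasure M S"] by simp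
    then show "A \<in> null_sets N"
      using A Neq[of A] by (auto simp: S_def null_sets_def N_def)
  qed
  then obtain h where [measurable]: "h \<in> borel_measurable lborel" and h: "density lborel h = N"
    using sigma_finite_measure.Radon_Nikodym[OF sigma_finite_lborel, of N] by (auto simp: N_def)
  have nn: "(\<integral>\<^sup>+y. h y * indicator {a..x} y \<partial>lborel) = ennreal (F x - F a)" if "x \<in> {a..b}" for x
  proof -
    have "(\<integral>\<^sup>+y. h y * indicator {a..x} y \<partial>lborel) = emeasure N {a..x}"
      unfolding h[symmetric] by (subst emeasure_density) auto
    also have "\<dots> = emeasure M {a..x}"
      using that by (subst Neq) (auto intro!: arg_cong[where f = "emeasure M"])
    also have "\<dots> = ennreal (F x - F a)"
      using that by (subst Icc) (auto simp: Geq)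
    finally show ?thesis .
  qed
  define k where "k y = enn2real (h y * indicator {a..b} y)" for y
  have [measurable]: "k \<in> borel_measurable lborel"
    unfolding k_def by measurable
  have "AE y in lborel. h y * indicator {a..b} y \<noteq> \<infinity>"
    using nn[of b] ab by (intro nn_integral_noteq_infinite) auto
  then have ae: "AE y in lborel. ennreal (k y) = h y * indicator {a..b} y"
    by eventually_elim (auto simp: k_def less_top)
  show ?thesis
  proof (rule that)
    have "(\<integral>\<^sup>+y. ennreal (k y) \<partial>lborel) = ennreal (F b - F a)"
      using ae nn[of b] ab by (subst nn_integral_cong_AE[OF ae]) auto
    then show "integrable lborel k"
      by (intro integrableI_nonneg) (auto simp: k_def)
    fix x assume x: "x \<in> {a..b}"
    have "(LINT y:{a..x}|lborel. k y) = enn2real (\<integral>\<^sup>+y. ennreal (indicator {a..x} y *\<^sub>R k y) \<partial>lborel)"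
      unfolding set_lebesgue_integral_def
      by (intro integral_eq_nn_integral) (auto simp: k_def)
    also have "(\<integral>\<^sup>+y. ennreal (indicator {a..x} y *\<^sub>R k y) \<partial>lborel) = (\<integral>\<^sup>+y. h y * indicator {a..x} y \<partial>lborel)"
      using ae
    proof (intro nn_integral_cong_AE, eventually_elim)
      case (elim y)
      then show ?case
        using x by (auto simp: indicator_def)
    qed
    also have "\<dots> = ennreal (F x - F a)"
      by (rule nn[OF x])
    also have "enn2real \<dots> = F x - F a"
      using mono[of a x] x by simp
    finally show "F x - F a = (LINT y:{a..x}|lborel. k y)" ..
  qed
qed

lemma AC_id: "absolutely_continuous_on a b complex_of_real"
  unfolding absolutely_continuous_on_def
proof (intro allI impI)
  fix \<epsilon> :: real assume "\<epsilon> > 0"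
  have "(\<Sum>(s, t)\<in>D. cmod (complex_of_real t - complex_of_real s)) = (\<Sum>(s, t)\<in>D. t - s)"
    if "\<forall>(s, t)\<in>D. a \<le> s \<and> s \<le> t \<and> t \<le> b" for D
    using that by (intro sum.cong) (auto simp: norm_of_real simp flip: of_real_diff)
  then show "\<exists>\<delta>>0. \<forall>D. finite D \<and> (\<forall>(s, t)\<in>D. a \<le> s \<and> s \<le> t \<and> t \<le> b) \<and>
        disjoint_family_on (\<lambda>(s, t). {s<..<t}) D \<and> (\<Sum>(s, t)\<in>D. t - s) < \<delta> \<longrightarrow>
        (\<Sum>(s, t)\<in>D. cmod (complex_of_real t - complex_of_real s)) < \<epsilon>"
    using \<open>\<epsilon> > 0\<close> by (intro exI[of _ \<epsilon>]) simp
qed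

text \<open>
  The common source of the closure properties: a function whose increments are controlled by those of absolutely
  continuous functions is absolutely continuous.
\<close>

lemma AC_dominated:
  assumes f: "absolutely_continuous_on a b f" and g: "absolutely_continuous_on a b g"
    and le: "\<And>s t. a \<le> s \<Longrightarrow> s \<le> t \<Longrightarrow> t \<le> b \<Longrightarrow>
      cmod (F t - F s) \<le> C * (cmod (f t - f s) + cmod (g t - g s))"
  shows "absolutely_continuous_on a b F"
  unfolding absolutely_continuous_on_def
proof (intro allI impI)
  fix \<epsilon> :: real assume "\<epsilon> > 0"
  define \<eta> where "\<eta> = \<epsilon> / (2 * (\<bar>C\<bar> + 1))"
  have "\<eta> > 0"
    using \<open>\<epsilon> > 0\<close> by (simp add: \<eta>_def add_nonneg_pos)
  have \<eta>: "\<bar>C\<bar> * (\<eta> + \<eta>) < \<epsilon>"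
  proof -
    have "\<epsilon> / (2 * X) + \<epsilon> / (2 * X) = \<epsilon> / X" "X * (\<epsilon> / X) = \<epsilon>" if "X > 0" for X
      using that by (auto simp: field_simps)
    from this[of "\<bar>C\<bar> + 1"] have "(\<bar>C\<bar> + 1) * (\<eta> + \<eta>) = \<epsilon>"
      unfolding \<eta>_def by simp
    then show ?thesis
      using \<open>\<eta> > 0\<close> by (simp add: algebra_simps)
  qed
  obtain \<delta>1 where 1: "\<delta>1 > 0" "\<forall>D. finite D \<and> (\<forall>(s, t)\<in>D. a \<le> s \<and> s \<le> t \<and> t \<le> b) \<and>
        disjoint_family_on (\<lambda>(s, t). {s<..<t}) D \<and> (\<Sum>(s, t)\<in>D. t - s) < \<delta>1 \<longrightarrow>
        (\<Sum>(s, t)\<in>D. cmod (f t - f s)) < \<eta>"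
    using f \<open>\<eta> > 0\<close> unfolding absolutely_continuous_on_def by blast
  obtain \<delta>2 where 2: "\<delta>2 > 0" "\<forall>D. finite D \<and> (\<forall>(s, t)\<in>D. a \<le> s \<and> s \<le> t \<and> t \<le> b) \<and>
        disjoint_family_on (\<lambda>(s, t). {s<..<t}) D \<and> (\<Sum>(s, t)\<in>D. t - s) < \<delta>2 \<longrightarrow>
        (\<Sum>(s, t)\<in>D. cmod (g t - g s)) < \<eta>"
    using g \<open>\<eta> > 0\<close> unfolding absolutely_continuous_on_def by blast
  show "\<exists>\<delta>>0. \<forall>D. finite D \<and> (\<forall>(s, t)\<in>D. a \<le> s \<and> s \<le> t \<and> t \<le> b) \<and>
        disjoint_family_on (\<lambda>(s, t). {s<..<t}) D \<and> (\<Sum>(s, t)\<in>D. t - s) < \<delta> \<longrightarrow>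
        (\<Sum>(s, t)\<in>D. cmod (F t - F s)) < \<epsilon>"
  proof (intro exI[of _ "min \<delta>1 \<delta>2"] conjI allI impI)
    fix D assume D: "finite D \<and> (\<forall>(s, t)\<in>D. a \<le> s \<and> s \<le> t \<and> t \<le> b) \<and>
        disjoint_family_on (\<lambda>(s, t). {s<..<t}) D \<and> (\<Sum>(s, t)\<in>D. t - s) < min \<delta>1 \<delta>2"
    have "(\<Sum>(s, t)\<in>D. cmod (F t - F s)) \<le> (\<Sum>(s, t)\<in>D. \<bar>C\<bar> * (cmod (f t - f s) + cmod (g t - g s)))"
    proof (rule sum_mono)
      fix p assume "p \<in> D"
      then have "cmod (F (snd p) - F (fst p)) \<le> C * (cmod (f (snd p) - f (fst p)) + cmod (g (snd p) - g (fst p)))"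
        using D by (intro le) auto
      also have "\<dots> \<le> \<bar>C\<bar> * (cmod (f (snd p) - f (fst p)) + cmod (g (snd p) - g (fst p)))"
        by (intro mult_right_mono) auto
      finally show "(case p of (s, t) \<Rightarrow> cmod (F t - F s))
          \<le> (case p of (s, t) \<Rightarrow> \<bar>C\<bar> * (cmod (f t - f s) + cmod (g t - g s)))"
        by (simp add: case_prod_unfold)
    qed
    also have "\<dots> = \<bar>C\<bar> * ((\<Sum>(s, t)\<in>D. cmod (f t - f s)) + (\<Sum>(s, t)\<in>D. cmod (g t - g s)))"
      by (simp add: case_prod_unfold sum_distrib_left sum.distrib distrib_left)
    also have "\<dots> \<le> \<bar>C\<bar> * (\<eta> + \<eta>)"
    proof -
      have "(\<Sum>(s, t)\<in>D. cmod (f t - f s)) < \<eta>" "(\<Sum>(s, t)\<in>D. cmod (g t - g s)) < \<eta>"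
        using D 1(2) 2(2) by simp_all
      then show ?thesis
        by (intro mult_left_mono) auto
    qed
    finally show "(\<Sum>(s, t)\<in>D. cmod (F t - F s)) < \<epsilon>"
      using \<eta> by simp
  qed (use 1 2 in auto)
qed

lemma AC_linear_combination:
  assumes "absolutely_continuous_on a b f" "absolutely_continuous_on a b g"
  shows "absolutely_continuous_on a b (\<lambda>x. c * f x + d * g x)"
proof (rule AC_dominated[OF assms, of _ "max (cmod c) (cmod d)"])
  fix s t
  have "cmod ((c * f t + d * g t) - (c * f s + d * g s)) = cmod (c * (f t - f s) + d * (g t - g s))"
    by (simp add: algebra_simps)
  also have "\<dots> \<le> cmod c * cmod (f t - f s) + cmod d * cmod (g t - g s)"
    by (metis norm_mult norm_triangle_ineq)
  also have "\<dots> \<le> max (cmod c) (cmod d) * (cmod (f t - f s) + cmod (g t - g s))"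
    unfolding distrib_left by (intro add_mono mult_right_mono) auto
  finally show "cmod ((c * f t + d * g t) - (c * f s + d * g s))
      \<le> max (cmod c) (cmod d) * (cmod (f t - f s) + cmod (g t - g s))" .
qed

lemma AC_times:
  assumes f: "absolutely_continuous_on a b f" and g: "absolutely_continuous_on a b g"
  shows "absolutely_continuous_on a b (\<lambda>x. f x * g x)"
proof -
  have "bounded (f ` {a..b})" "bounded (g ` {a..b})"
    using AC_continuous_on[OF f] AC_continuous_on[OF g]
    by (auto intro!: compact_imp_bounded compact_continuous_image)
  then obtain A B where A: "\<forall>x\<in>{a..b}. cmod (f x) \<le> A" and B: "\<forall>x\<in>{a..b}. cmod (g x) \<le> B"
    unfolding bounded_iff by auto
  show ?thesis
  proof (rule AC_dominated[OF f g, of _ "max A B"])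
    fix s t assume st: "a \<le> s" "s \<le> t" "t \<le> b"
    have "cmod (f t * g t - f s * g s) = cmod ((f t - f s) * g t + f s * (g t - g s))"
      by (simp add: algebra_simps)
    also have "\<dots> \<le> cmod (f t - f s) * cmod (g t) + cmod (f s) * cmod (g t - g s)"
      by (metis norm_mult norm_triangle_ineq)
    also have "\<dots> \<le> cmod (f t - f s) * max A B + max A B * cmod (g t - g s)"
    proof (intro add_mono mult_left_mono mult_right_mono norm_ge_zero)
      show "cmod (g t) \<le> max A B" "cmod (f s) \<le> max A B"
        using st bspec[OF A, of s] bspec[OF B, of t] by auto
    qed
    finally show "cmod (f t * g t - f s * g s) \<le> max A B * (cmod (f t - f s) + cmod (g t - g s))"
      by (simp add: algebra_simps)
  qed
qed

text \<open>
  Lebesgue's differentiation theorem for intervals that extend to the right of \<open>x\<close> gives the right-hand difference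
  quotients. The reflection \<open>x \<mapsto> - x\<close> turns it into the statement on the left-hand ones.
\<close>

lemma indefinite_integral_differentiable:
  fixes f :: "real \<Rightarrow> complex"
  assumes "integrable lborel f"
  obtains N where "negligible N"
    "\<And>x a. x \<notin> N \<Longrightarrow> a < x \<Longrightarrow> ((\<lambda>u. integral {a..u} f) has_vector_derivative f x) (at x)"
proof -
  have int: "f integrable_on {a..b}" for a b
    using integrable_on_lborel[OF assms] integrable_on_subinterval by blast
  have intr: "(\<lambda>x. f (- x)) integrable_on {a..b}" for a b
    using int[of "- b" "- a"] Henstock_Kurzweil_Integration.integrable_reflect_real[where f = f and a = "- b" and b = "- a"] by simp
  obtain N1 where N1: "negligible N1" "\<And>x e. x \<notin> N1 \<Longrightarrow> 0 < e \<Longrightarrow> \<exists>d>0. \<forall>h. 0 < h \<and> h < d \<longrightarrow>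
      norm (integral {x..x + h} f /\<^sub>R h - f x) < e"
    using integrable_ccontinuous_explicit[of f] int by auto
  obtain N2 where N2: "negligible N2" "\<And>x e. x \<notin> N2 \<Longrightarrow> 0 < e \<Longrightarrow> \<exists>d>0. \<forall>h. 0 < h \<and> h < d \<longrightarrow>
      norm (integral {x..x + h} (\<lambda>x. f (- x)) /\<^sub>R h - f (- x)) < e"
    using integrable_ccontinuous_explicit[of "\<lambda>x. f (- x)"] intr by auto
  show ?thesis
  proof (rule that)
    show "negligible (N1 \<union> uminus ` N2)"
      using N1(1) N2(1) by (intro negligible_Un negligible_differentiable_image_negligible differentiable_on_minus
          differentiable_on_ident) auto
    fix x a assume x: "x \<notin> N1 \<union> uminus ` N2" and "a < x"
    have x2: "- x \<notin> N2"
      using x by force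
    show "((\<lambda>u. integral {a..u} f) has_vector_derivative f x) (at x)"
      unfolding has_vector_derivative_def has_derivative_at_alt
    proof (intro conjI allI impI)
      show "bounded_linear (\<lambda>h. h *\<^sub>R f x)"
        by (rule bounded_linear_scaleR_left)
      fix e :: real assume "0 < e"
      obtain d1 where d1: "d1 > 0" "\<And>h. 0 < h \<Longrightarrow> h < d1 \<Longrightarrow> norm (integral {x..x + h} f /\<^sub>R h - f x) < e"
        using N1(2)[of x e] x \<open>0 < e\<close> by auto
      obtain d2 where d2: "d2 > 0" "\<And>h. 0 < h \<Longrightarrow> h < d2 \<Longrightarrow>
          norm (integral {- x..- x + h} (\<lambda>x. f (- x)) /\<^sub>R h - f x) < e"
        using N2(2)[of "- x" e] x2 \<open>0 < e\<close> by auto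
      have scale: "norm (I - h *\<^sub>R f x) \<le> e * h" if "norm (I /\<^sub>R h - f x) < e" "0 < h" for I h
      proof -
        have "I - h *\<^sub>R f x = h *\<^sub>R (I /\<^sub>R h - f x)"
          using that by (simp add: scaleR_diff_right)
        then have "norm (I - h *\<^sub>R f x) = h * norm (I /\<^sub>R h - f x)"
          using that by simp
        then show ?thesis
          using that by (simp add: mult.commute[of e])
      qed
      show "\<exists>d>0. \<forall>y. norm (y - x) < d \<longrightarrow>
          norm (integral {a..y} f - integral {a..x} f - (y - x) *\<^sub>R f x) \<le> e * norm (y - x)"
      proof (intro exI[of _ "min (x - a) (min d1 d2)"] conjI allI impI)
        fix y assume y: "norm (y - x) < min (x - a) (min d1 d2)"
        consider "y = x" | "x < y" | "y < x"
          by linarith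
        then show "norm (integral {a..y} f - integral {a..x} f - (y - x) *\<^sub>R f x) \<le> e * norm (y - x)"
        proof cases
          case 2
          have "integral {a..x} f + integral {x..y} f = integral {a..y} f"
            using 2 \<open>a < x\<close> int by (intro Henstock_Kurzweil_Integration.integral_combine) auto
          then have "integral {a..y} f - integral {a..x} f = integral {x..y} f"
            by (metis add_diff_cancel_left')
          moreover have "norm (integral {x..y} f - (y - x) *\<^sub>R f x) \<le> e * (y - x)"
            using d1(2)[of "y - x"] y 2 by (intro scale) auto
          ultimately show ?thesis
            using 2 by simp
        next
          case 3
          have "integral {a..y} f + integral {y..x} f = integral {a..x} f"
            using 3 y int by (intro Henstock_Kurzweil_Integration.integral_combine) auto
          then have "integral {a..y} f - integral {a..x} f = - integral {y..x} f"
            by (metis add_diff_cancel_left' minus_diff_eq)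
          moreover have "norm (integral {y..x} f - (x - y) *\<^sub>R f x) \<le> e * (x - y)"
            using d2(2)[of "x - y"] y 3 Henstock_Kurzweil_Integration.integral_reflect_real[where f = f and a = y and b = x] by (intro scale) auto
          moreover have "norm (- integral {y..x} f - (y - x) *\<^sub>R f x) = norm (integral {y..x} f - (x - y) *\<^sub>R f x)"
            by (subst norm_minus_cancel[symmetric]) (simp add: algebra_simps)
          ultimately show ?thesis
            using 3 by simp
        qed simp
      qed (use d1 d2 \<open>a < x\<close> in auto)
    qed
  qed
qed

text \<open>
  With \<open>V\<close> the variation of \<open>f\<close>, the functions \<open>V\<close>, \<open>V - Re f\<close> and \<open>V - Im f\<close> are monotone and absolutely
  continuous, and \<open>f\<close> is a linear combination of them. So \<open>f\<close> is an indefinite integral, and Lebesgue's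
  differentiation theorem applies to it.
\<close>

lemma AC_fundamental_theorem:
  assumes ac: "absolutely_continuous_on a b f" and ab: "a \<le> b"
  shows "\<exists>h N. negligible N \<and> (\<forall>x\<in>{a..b}. (h has_integral (f x - f a)) {a..x}) \<and>
    (\<forall>x. a < x \<and> x < b \<and> x \<notin> N \<longrightarrow> (f has_vector_derivative h x) (at x))"
proof -
  let ?V = "variation f a"
  have V: "absolutely_continuous_on a b (\<lambda>x. complex_of_real (?V x))"
    by (rule variation_AC[OF ac ab])
  have sup: "?V s + cmod (f t - f s) \<le> ?V t" if "a \<le> s" "s \<le> t" "t \<le> b" for s t
    using that by (intro variation_superadditive[OF ac]) auto
  \<comment> \<open>To be used with the real and the imaginary part in place of \<open>p\<close>.\<close>
  have diff: "absolutely_continuous_on a b (\<lambda>x. complex_of_real (?V x - p (f x)))"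
    if p: "\<And>u v. p u - p v = p (u - v)" "\<And>u. \<bar>p u\<bar> \<le> cmod u" for p
  proof (rule AC_dominated[OF V ac, of _ 1])
    fix s t
    have "cmod (complex_of_real (?V t - p (f t)) - complex_of_real (?V s - p (f s)))
        = \<bar>(?V t - ?V s) - (p (f t - f s))\<bar>"
      unfolding of_real_diff[symmetric] norm_of_real p(1)[symmetric] by (simp add: algebra_simps)
    also have "\<dots> \<le> \<bar>?V t - ?V s\<bar> + \<bar>p (f t - f s)\<bar>"
      by linarith
    also have "\<dots> \<le> cmod (complex_of_real (?V t) - complex_of_real (?V s)) + cmod (f t - f s)"
      unfolding of_real_diff[symmetric] norm_of_real using p(2) by (intro add_left_mono)
    finally show "cmod (complex_of_real (?V t - p (f t)) - complex_of_real (?V s - p (f s)))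
        \<le> 1 * (cmod (complex_of_real (?V t) - complex_of_real (?V s)) + cmod (f t - f s))"
      by simp
  qed
  obtain v where v: "integrable lborel v" "\<And>x. x \<in> {a..b} \<Longrightarrow> ?V x - ?V a = (LINT y:{a..x}|lborel. v y)"
  proof (rule mono_AC_density[OF ab _ V])
    show "?V s \<le> ?V t" if "a \<le> s" "s \<le> t" "t \<le> b" for s t
      using sup[OF that] by (smt (verit) norm_ge_zero)
  qed blast
  obtain p where p: "integrable lborel p"
    "\<And>x. x \<in> {a..b} \<Longrightarrow> (?V x - Re (f x)) - (?V a - Re (f a)) = (LINT y:{a..x}|lborel. p y)"
  proof (rule mono_AC_density[OF ab _ diff[of Re]])
    show "?V s - Re (f s) \<le> ?V t - Re (f t)" if "a \<le> s" "s \<le> t" "t \<le> b" for s t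
      using sup[OF that] abs_Re_le_cmod[of "f t - f s"] by simp
  qed (auto simp del: of_real_diff intro: abs_Re_le_cmod)
  obtain q where q: "integrable lborel q"
    "\<And>x. x \<in> {a..b} \<Longrightarrow> (?V x - Im (f x)) - (?V a - Im (f a)) = (LINT y:{a..x}|lborel. q y)"
  proof (rule mono_AC_density[OF ab _ diff[of Im]])
    show "?V s - Im (f s) \<le> ?V t - Im (f t)" if "a \<le> s" "s \<le> t" "t \<le> b" for s t
      using sup[OF that] abs_Im_le_cmod[of "f t - f s"] by simp
  qed (auto simp del: of_real_diff intro: abs_Im_le_cmod)
  define h where "h y = complex_of_real (v y - p y) + \<i> * complex_of_real (v y - q y)" for y
  have hint: "integrable lborel h"
    unfolding h_def using v(1) p(1) q(1)
    by (intro Bochner_Integration.integrable_add integrable_of_real integrable_mult_right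
        Bochner_Integration.integrable_diff) auto
  have I: "integral {a..x} h = f x - f a" and ion: "h integrable_on {a..x}" if x: "x \<in> {a..b}" for x
  proof -
    have si: "set_integrable lborel {a..x} k" if "integrable lborel k" for k :: "real \<Rightarrow> 'b::{banach,second_countable_topology}"
      unfolding set_integrable_def using that by (intro integrable_mult_indicator) auto
    have "(k has_integral (LINT y:{a..x}|lborel. k y)) {a..x}" if "integrable lborel k" for k :: "real \<Rightarrow> real"
      using set_borel_integral_eq_integral[OF si[OF that]] by (simp add: has_integral_integral)
    then have vpq: "(v has_integral ?V x - ?V a) {a..x}"
        "(p has_integral (?V x - Re (f x)) - (?V a - Re (f a))) {a..x}"
        "(q has_integral (?V x - Im (f x)) - (?V a - Im (f a))) {a..x}"
      using v p q x by simp_all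
    have "((\<lambda>y. v y - p y) has_integral Re (f x) - Re (f a)) {a..x}"
      using has_integral_diff[OF vpq(1,2)] by simp
    moreover have "((\<lambda>y. v y - q y) has_integral Im (f x) - Im (f a)) {a..x}"
      using has_integral_diff[OF vpq(1,3)] by simp
    ultimately have "(h has_integral complex_of_real (Re (f x) - Re (f a)) + \<i> * complex_of_real (Im (f x) - Im (f a))) {a..x}"
      unfolding h_def
      by (intro has_integral_add has_integral_mult_right has_integral_of_real)
    also have "complex_of_real (Re (f x) - Re (f a)) + \<i> * complex_of_real (Im (f x) - Im (f a)) = f x - f a"
      by (simp add: complex_eq_iff)
    finally have "(h has_integral f x - f a) {a..x}" .
    then show "integral {a..x} h = f x - f a" "h integrable_on {a..x}"
      by (auto simp: has_integral_iff)
  qed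
  obtain N where N: "negligible N"
    "\<And>x a. x \<notin> N \<Longrightarrow> a < x \<Longrightarrow> ((\<lambda>u. integral {a..u} h) has_vector_derivative h x) (at x)"
    using indefinite_integral_differentiable[OF hint] by blast
  show ?thesis
  proof (intro exI[of _ h] exI[of _ N] conjI ballI allI impI N(1))
    show "(h has_integral f x - f a) {a..x}" if "x \<in> {a..b}" for x
      using I[OF that] ion[OF that] by (simp add: has_integral_iff)
    show "(f has_vector_derivative h x) (at x)" if x: "a < x \<and> x < b \<and> x \<notin> N" for x
    proof (rule has_vector_derivative_transform_within_open)
      show "((\<lambda>u. f a + integral {a..u} h) has_vector_derivative h x) (at x)"
        using N(2)[of x a] x by (auto intro!: derivative_eq_intros)
      show "f a + integral {a..u} h = f u" if "u \<in> {a<..<b}" for u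
        using I[of u] that by simp
    qed (use x in auto)
  qed
qed

lemma AC_loc_has_integral:
  assumes "u \<in> AC_loc" "0 < a" "a \<le> b"
  shows "(D1 u has_integral (u b - u a)) {a..b}"
proof -
  have "absolutely_continuous_on a b u"
    using assms unfolding AC_loc_def by blast
  from AC_fundamental_theorem[OF this \<open>a \<le> b\<close>] obtain h N where
    h: "\<forall>x\<in>{a..b}. (h has_integral (u x - u a)) {a..x}" "negligible N"
    "\<forall>x. a < x \<and> x < b \<and> x \<notin> N \<longrightarrow> (u has_vector_derivative h x) (at x)"
    by blast
  show ?thesis
  proof (rule has_integral_spike[of "N \<union> {a, b}"])
    show "(h has_integral u b - u a) {a..b}"
      using h(1) assms by simp
    show "D1 u x = h x" if "x \<in> {a..b} - (N \<union> {a, b})" for x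
      using that h(3) by (intro vector_derivative_at) auto
    show "negligible (N \<union> {a, b})"
      using h(2) by simp
  qed
qed

text \<open>
  The intervals from \<open>1 / (n + 1)\<close> to \<open>n + 1\<close> exhaust the half-line, and each of them contributes a null set.
\<close>

lemma AC_loc_differentiable_AE:
  assumes "u \<in> AC_loc"
  shows "AE x in half_line. (u has_vector_derivative D1 u x) (at x)"
proof -
  have "\<exists>N. negligible N \<and> (\<forall>x\<in>{1 / Suc n<..<Suc n} - N. (u has_vector_derivative D1 u x) (at x))" for n
  proof (cases "n = 0")
    case True
    then show ?thesis
      by auto
  next
    case False
    then have "1 / Suc n \<le> Suc n" "0 < 1 / Suc n"
      by (auto simp: field_simps)
    then have "absolutely_continuous_on (1 / Suc n) (Suc n) u"
      using assms unfolding AC_loc_def by blast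
    from AC_fundamental_theorem[OF this \<open>1 / Suc n \<le> Suc n\<close>] obtain h N where h: "negligible N"
      "\<forall>x::real. 1 / Suc n < x \<and> x < Suc n \<and> x \<notin> N \<longrightarrow> (u has_vector_derivative h x) (at x)"
      by blast
    have "(u has_vector_derivative D1 u x) (at x)" if "x \<in> {1 / Suc n<..<Suc n} - N" for x
    proof -
      have *: "(u has_vector_derivative h x) (at x)"
        using h(2) that by auto
      then show ?thesis
        unfolding vector_derivative_at[OF *] .
    qed
    with h(1) show ?thesis
      by (intro exI[of _ N] conjI ballI)
  qed
  then obtain N where N': "\<And>n. negligible (N n) \<and>
      (\<forall>x\<in>{1 / Suc n<..<Suc n} - N n. (u has_vector_derivative D1 u x) (at x))"
    by metis
  then have N: "\<And>n. negligible (N n)"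
    "\<And>n x. x \<in> {1 / Suc n<..<Suc n} \<Longrightarrow> x \<notin> N n \<Longrightarrow> (u has_vector_derivative D1 u x) (at x)"
    by auto
  have "(\<Union>n. N n) \<in> null_sets lebesgue"
    using N(1) by (intro null_sets_UN) (simp add: negligible_iff_null_sets)
  then have "AE x in lebesgue. x \<notin> (\<Union>n. N n)"
    by (rule AE_not_in)
  then have "AE x in lebesgue. x \<in> {0<..} \<longrightarrow> (u has_vector_derivative D1 u x) (at x)"
  proof eventually_elim
    case (elim x)
    show ?case
    proof
      assume "x \<in> {0<..}"
      obtain n where "max x (1 / x) < real n"
        using reals_Archimedean2 by blast
      then have "max x (1 / x) < real (Suc n)"
        by simp
      then have "x \<in> {1 / Suc n<..<Suc n}"
        using \<open>x \<in> {0<..}\<close> by (auto simp: field_simps)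
      then show "(u has_vector_derivative D1 u x) (at x)"
        using N(2) elim by blast
    qed
  qed
  then show ?thesis
    by (simp add: AE_restrict_space_iff)
qed

lemma AC_loc_add_scale:
  "u \<in> AC_loc \<Longrightarrow> v \<in> AC_loc \<Longrightarrow> (\<lambda>x. u x + c * v x) \<in> AC_loc"
  using AC_linear_combination[of _ _ u v 1 c] by (auto simp: AC_loc_def)

lemma AC_loc_times: "u \<in> AC_loc \<Longrightarrow> v \<in> AC_loc \<Longrightarrow> (\<lambda>x. u x * v x) \<in> AC_loc"
  by (auto simp: AC_loc_def intro: AC_times)

lemma AC_loc_cong:
  assumes "u \<in> AC_loc" "\<And>x. x > 0 \<Longrightarrow> u x = v x"
  shows "v \<in> AC_loc"
  unfolding AC_loc_def
proof (intro CollectI allI impI)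
  fix a b :: real assume ab: "0 < a \<and> a \<le> b"
  then have "absolutely_continuous_on a b u"
    using assms(1) by (auto simp: AC_loc_def)
  then show "absolutely_continuous_on a b v"
    by (rule AC_dominated[OF _ AC_id, of _ _ _ _ 1]) (use assms(2) ab in auto)
qed

text \<open>
  A function with bounded derivative is dominated by the identity.
\<close>

lemma C1_AC_loc:
  assumes d: "\<And>x. x > 0 \<Longrightarrow> (u has_vector_derivative u' x) (at x)" and c: "continuous_on {0<..} u'"
  shows "u \<in> AC_loc"
  unfolding AC_loc_def
proof (intro CollectI allI impI)
  fix a b :: real assume ab: "0 < a \<and> a \<le> b"
  then have "bounded (u' ` {a..b})"
    by (intro compact_imp_bounded compact_continuous_image continuous_on_subset[OF c]) auto
  then obtain C where C': "\<forall>x\<in>{a..b}. cmod (u' x) \<le> C"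
    unfolding bounded_iff by auto
  have C: "cmod (u' x) \<le> C" if "x \<in> {a..b}" for x
    using bspec[OF C' that] .
  show "absolutely_continuous_on a b u"
  proof (rule AC_dominated[where f = complex_of_real and g = complex_of_real and C = C, OF AC_id AC_id])
    fix s t assume st: "a \<le> s" "s \<le> t" "t \<le> b"
    have bound: "norm (u t - u s) \<le> C * norm (t - s)"
    proof (rule differentiable_bound[of "{a..b}" u "\<lambda>x h. h *\<^sub>R u' x"])
      fix x assume x: "x \<in> {a..b}"
      then have "(u has_vector_derivative u' x) (at x)"
        using ab by (intro d) auto
      then show "(u has_derivative (\<lambda>h. h *\<^sub>R u' x)) (at x within {a..b})"
        unfolding has_vector_derivative_def by (rule has_derivative_at_withinI)
      show "onorm (\<lambda>h. h *\<^sub>R u' x) \<le> C"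
      proof (rule onorm_le)
        show "norm (h *\<^sub>R u' x) \<le> C * norm h" for h
          using mult_right_mono[OF C[OF x], of "\<bar>h\<bar>"] by (simp add: mult.commute)
      qed
    qed (use st in auto)
    have "norm (u' a) \<le> C"
      using ab by (intro C) auto
    then have "0 \<le> C * (t - s)"
      using st order_trans[OF norm_ge_zero] by (intro mult_nonneg_nonneg) auto
    moreover have "norm (u t - u s) \<le> C * (t - s)"
      using bound st by simp
    moreover have eq: "cmod (complex_of_real t - complex_of_real s) = t - s"
      unfolding of_real_diff[symmetric] norm_of_real using st by simp
    ultimately show "cmod (u t - u s) \<le> C * (cmod (complex_of_real t - complex_of_real s) + cmod (complex_of_real t - complex_of_real s))"
      unfolding eq distrib_left by linarith
  qed
qed

section \<open>Completeness and the Parseval identity\<close>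

lemma cinner_abs:
  "square_integrable f \<Longrightarrow> square_integrable g \<Longrightarrow>
    cinner (abs_L2 f) (abs_L2 g) = (\<integral>x. cnj (f x) * g x \<partial>half_line)"
  by (intro cinner.abs_eq) auto

lemma plus_abs:
  "square_integrable f \<Longrightarrow> square_integrable g \<Longrightarrow> abs_L2 f + abs_L2 g = abs_L2 (\<lambda>x. f x + g x)"
  by (intro plus_L2.abs_eq) auto

lemma cscale_abs: "square_integrable f \<Longrightarrow> c *\<^sub>C abs_L2 f = abs_L2 (\<lambda>x. c * f x)"
  by (intro cscale.abs_eq) auto

lemma L2_cases:
  obtains u where "square_integrable u" "f = abs_L2 u"
  by (induction f rule: L2.abs_induct) blast

lemma cinner_commute: "cinner f g = cnj (cinner g f)"
  by transfer (simp add: mult.commute flip: Bochner_Integration.integral_cnj)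

lemma cinner_scale_right: "cinner f (c *\<^sub>C g) = c * cinner f g"
proof (cases f rule: L2_cases; cases g rule: L2_cases)
  fix u v assume uv: "square_integrable u" "f = abs_L2 u" "square_integrable v" "g = abs_L2 v"
  then have "cinner f (c *\<^sub>C g) = (\<integral>x. c * (cnj (u x) * v x) \<partial>half_line)"
    by (simp add: cscale_abs cinner_abs square_integrable_scale mult.left_commute)
  then show ?thesis
    using uv by (simp add: cinner_abs)
qed

lemma cinner_add_right: "cinner f (g + h) = cinner f g + cinner f h"
  by transfer (simp add: distrib_left square_integrable_product)

lemma cinner_scale_left: "cinner (c *\<^sub>C f) g = cnj c * cinner f g"
  by (subst cinner_commute) (simp add: cinner_scale_right cinner_commute[of f g])

lemma cinner_add_left: "cinner (f + g) h = cinner f h + cinner g h"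
  by (subst cinner_commute) (simp add: cinner_add_right cinner_commute[of f h] cinner_commute[of g h])

lemma cscale_assoc: "c *\<^sub>C d *\<^sub>C f = (c * d) *\<^sub>C f"
  by transfer (simp only: mult.assoc square_integrable_scale simp_thms AE_I2)

lemma cscale_add_left: "(c + d) *\<^sub>C f = c *\<^sub>C f + d *\<^sub>C f"
  by transfer (simp only: distrib_right square_integrable_add square_integrable_scale simp_thms AE_I2)

lemma cinner_minus_right: "cinner f (g - h) = cinner f g - cinner f h"
  by (simp add: minus_L2_def cinner_add_right cinner_scale_right)

lemma cinner_self: "cinner f f = of_real ((norm f)\<^sup>2)"
proof -
  have "Im (cinner f f) = 0"
    using arg_cong[OF cinner_commute[of f f], of Im] by simp
  moreover have "(norm f)\<^sup>2 = Re (cinner f f)"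
    by (simp add: power2_norm_eq_inner inner_L2_def)
  ultimately show ?thesis
    by (simp add: complex_eq_iff)
qed

lemma norm_cscale: "norm (c *\<^sub>C f) = cmod c * norm f"
proof -
  have "complex_of_real ((norm (c *\<^sub>C f))\<^sup>2) = cnj c * (c * of_real ((norm f)\<^sup>2))"
    by (simp only: cinner_self[symmetric] cinner_scale_left cinner_scale_right mult.left_commute)
  also have "\<dots> = of_real ((cmod c * norm f)\<^sup>2)"
    by (simp add: power_mult_distrib complex_norm_square[symmetric] mult.assoc[symmetric] mult.commute[of "cnj c"])
  finally have "(norm (c *\<^sub>C f))\<^sup>2 = (cmod c * norm f)\<^sup>2"
    by (simp only: of_real_eq_iff)
  then show ?thesis
    by (rule power2_eq_imp_eq) auto
qed

lemma cinner_Cauchy_Schwarz: "cmod (cinner f g) \<le> norm f * norm g"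
proof (cases "cinner f g = 0")
  case False
  define c where "c = cnj (cinner f g) / cmod (cinner f g)"
  have c: "cmod c = 1"
    using False by (simp add: c_def norm_divide)
  have "cinner f (c *\<^sub>C g) = complex_of_real (cmod (cinner f g))"
    using False by (simp add: cinner_scale_right c_def complex_norm_square[symmetric] power2_eq_square
        field_simps flip: complex_norm_square)
  then have "cmod (cinner f g) = inner f (c *\<^sub>C g)"
    by (simp add: inner_L2_def)
  also have "\<dots> \<le> norm f * norm (c *\<^sub>C g)"
    by (rule norm_cauchy_schwarz)
  finally show ?thesis
    by (simp add: norm_cscale c)
qed simp

lemma norm_abs_L2: "square_integrable u \<Longrightarrow> (norm (abs_L2 u))\<^sup>2 = (\<integral>x. (cmod (u x))\<^sup>2 \<partial>half_line)"
proof -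
  assume u: "square_integrable u"
  have "complex_of_real ((norm (abs_L2 u))\<^sup>2) = (\<integral>x. complex_of_real ((cmod (u x))\<^sup>2) \<partial>half_line)"
    using u by (simp add: cinner_self[symmetric] cinner_abs complex_norm_square mult.commute del: of_real_power)
  then show ?thesis
    by (simp only: integral_complex_of_real of_real_eq_iff)
qed

lemma nn_integral_norm_sq:
  assumes "square_integrable u"
  shows "(\<integral>\<^sup>+x. ennreal ((cmod (u x))\<^sup>2) \<partial>half_line) = ennreal ((norm (abs_L2 u))\<^sup>2)"
  unfolding norm_abs_L2[OF assms] using assms
  by (intro nn_integral_eq_integral) (auto simp: square_integrable_def)

text \<open>
  The proof of the Riesz-Fischer theorem. With \<open>v\<close> the differences of consecutive representatives, monotone convergence
  bounds the square integral of the sum of the functions \<open>|v k|\<close>. Hence this sum is finite almost everywhere, the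
  representatives converge pointwise, and the tails of the sum control the distance to the limit.
\<close>

lemma L2_convergent_of_fast_Cauchy:
  fixes f :: "nat \<Rightarrow> L2"
  assumes fast: "\<And>n. norm (f (Suc n) - f n) \<le> (1 / 2) ^ n"
  shows "convergent f"
proof -
  have "\<exists>u. square_integrable u \<and> f n = abs_L2 u" for n
    by (cases "f n" rule: L2_cases) auto
  then obtain u where u: "\<And>n. square_integrable (u n)" "\<And>n. f n = abs_L2 (u n)"
    by metis
  have [measurable]: "u n \<in> borel_measurable half_line" for n
    by (rule square_integrable_measurable[OF u(1)])
  define v where "v n x = u (Suc n) x - u n x" for n x
  have diff: "abs_L2 (\<lambda>x. u m x - u n x) = f m - f n" "square_integrable (\<lambda>x. u m x - u n x)" for m n
  proof -
    have "f m - f n = abs_L2 (\<lambda>x. u m x + (- 1) * u n x)"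
      unfolding minus_L2_def u(2) by (simp only: cscale_abs plus_abs u(1) square_integrable_scale)
    then show "abs_L2 (\<lambda>x. u m x - u n x) = f m - f n"
      by simp
    show "square_integrable (\<lambda>x. u m x - u n x)"
      using square_integrable_add[OF u(1)[of m] square_integrable_scale[OF u(1)[of n], of "- 1"]] by simp
  qed
  have v: "square_integrable (v n)" "abs_L2 (v n) = f (Suc n) - f n" for n
    unfolding v_def using diff by simp_all
  have [measurable]: "v n \<in> borel_measurable half_line" for n
    by (rule square_integrable_measurable[OF v(1)])
  have cmod_v: "square_integrable (\<lambda>x. complex_of_real (\<Sum>k\<in>{m..<n}. cmod (v k x)))" and
    norm_v: "norm (abs_L2 (\<lambda>x. complex_of_real (\<Sum>k\<in>{m..<n}. cmod (v k x)))) \<le> (\<Sum>k\<in>{m..<n}. (1 / 2) ^ k)" for m n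
  proof -
    have s: "square_integrable (\<lambda>x. complex_of_real (cmod (v k x)))" for k
      using v(1)[of k] by (auto simp: square_integrable_def)
    have "square_integrable (\<lambda>x. complex_of_real (\<Sum>k\<in>{m..<n}. cmod (v k x))) \<and>
      norm (abs_L2 (\<lambda>x. complex_of_real (\<Sum>k\<in>{m..<n}. cmod (v k x)))) \<le> (\<Sum>k\<in>{m..<n}. (1 / 2) ^ k)"
    proof (cases "m \<le> n")
      case True
      then show ?thesis
      proof (induction n rule: dec_induct)
        case base
        then show ?case
          by (simp add: square_integrable_zero zero_L2_def[symmetric])
      next
        case (step n)
        let ?S = "\<lambda>x. complex_of_real (\<Sum>k\<in>{m..<n}. cmod (v k x))"
        have eq: "(\<lambda>x. complex_of_real (\<Sum>k\<in>{m..<Suc n}. cmod (v k x))) = (\<lambda>x. ?S x + complex_of_real (cmod (v n x)))"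
          using step by (simp add: fun_eq_iff)
        have "norm (abs_L2 (\<lambda>x. complex_of_real (cmod (v n x)))) = norm (abs_L2 (v n))"
          by (rule power2_eq_imp_eq) (auto simp: norm_abs_L2[OF s] norm_abs_L2[OF v(1)])
        then have "norm (abs_L2 ?S + abs_L2 (\<lambda>x. complex_of_real (cmod (v n x))))
            \<le> (\<Sum>k\<in>{m..<n}. (1 / 2) ^ k) + (1 / 2) ^ n"
          using step fast[of n] v(2) by (intro norm_triangle_mono) auto
        then show ?case
          using step s[of n] unfolding eq by (simp add: plus_abs square_integrable_add)
      qed
    qed (simp add: square_integrable_zero zero_L2_def[symmetric])
    then show "square_integrable (\<lambda>x. complex_of_real (\<Sum>k\<in>{m..<n}. cmod (v k x)))"
      "norm (abs_L2 (\<lambda>x. complex_of_real (\<Sum>k\<in>{m..<n}. cmod (v k x)))) \<le> (\<Sum>k\<in>{m..<n}. (1 / 2) ^ k)"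
      by auto
  qed
  \<comment> \<open>The tail of the geometric series, uniformly in \<open>n\<close>.\<close>
  have geom: "(\<Sum>k\<in>{m..<n}. (1 / 2) ^ k) \<le> 2 * (1 / 2 :: real) ^ m" for m n
  proof (cases "m \<le> n")
    case True
    then have "(\<Sum>k\<in>{m..<n}. (1 / 2 :: real) ^ k) = 2 * (1 / 2) ^ m - 2 * (1 / 2) ^ n"
      by (induction n rule: dec_induct) auto
    then show ?thesis
      by simp
  qed simp
  define V where "V m n x = (\<Sum>k\<in>{m..<n}. cmod (v k x))" for m n x
  have V0: "V m n x \<ge> 0" for m n x
    by (auto simp: V_def intro: sum_nonneg)
  have [measurable]: "V m n \<in> borel_measurable half_line" for m n
    unfolding V_def by measurable
  have Vint: "(\<integral>\<^sup>+x. ennreal ((V m n x)\<^sup>2) \<partial>half_line) \<le> ennreal ((2 * (1 / 2) ^ m)\<^sup>2)" for m n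
  proof -
    have "(\<integral>\<^sup>+x. ennreal ((V m n x)\<^sup>2) \<partial>half_line)
        = ennreal ((norm (abs_L2 (\<lambda>x. complex_of_real (\<Sum>k\<in>{m..<n}. cmod (v k x)))))\<^sup>2)"
      unfolding nn_integral_norm_sq[OF cmod_v, symmetric] by (simp add: V_def del: of_real_sum)
    also have "\<dots> \<le> ennreal ((2 * (1 / 2) ^ m)\<^sup>2)"
      using norm_v[of m n] geom[of m n] by (intro ennreal_leI power_mono) auto
    finally show ?thesis .
  qed
  \<comment> \<open>Monotone convergence passes from the partial sums \<open>V m n\<close> to the full tail.\<close>
  have sup: "(\<integral>\<^sup>+x. (SUP n. ennreal ((V m n x)\<^sup>2)) \<partial>half_line) \<le> ennreal ((2 * (1 / 2) ^ m)\<^sup>2)" for m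
  proof -
    have "incseq (\<lambda>n x. ennreal ((V m n x)\<^sup>2))"
    proof (intro incseq_SucI le_funI ennreal_leI power_mono V0)
      show "V m n x \<le> V m (Suc n) x" for n x
        unfolding V_def by (intro sum_mono2) auto
    qed
    then have "(\<integral>\<^sup>+x. (SUP n. ennreal ((V m n x)\<^sup>2)) \<partial>half_line) = (SUP n. \<integral>\<^sup>+x. ennreal ((V m n x)\<^sup>2) \<partial>half_line)"
      by (intro nn_integral_monotone_convergence_SUP) auto
    also have "\<dots> \<le> ennreal ((2 * (1 / 2) ^ m)\<^sup>2)"
      by (intro SUP_least Vint)
    finally show ?thesis .
  qed
  have "AE x in half_line. (SUP n. ennreal ((V 0 n x)\<^sup>2)) \<noteq> \<infinity>"
    using sup[of 0] by (intro nn_integral_noteq_infinite) (auto simp: top_unique)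
  then have sumv: "AE x in half_line. summable (\<lambda>k. cmod (v k x))"
  proof eventually_elim
    case (elim x)
    then obtain B where B: "B \<ge> 0" "(SUP n. ennreal ((V 0 n x)\<^sup>2)) = ennreal B"
      by (metis ennreal_cases infinity_ennreal_def)
    have "(V 0 n x)\<^sup>2 \<le> B" for n
    proof -
      have "ennreal ((V 0 n x)\<^sup>2) \<le> ennreal B"
        unfolding B(2)[symmetric] by (rule SUP_upper) simp
      then show ?thesis
        using B(1) by (simp add: ennreal_le_iff)
    qed
    then have "V 0 n x \<le> sqrt B" for n
      by (metis V0 real_le_rsqrt)
    then have "(\<Sum>k<n. cmod (v k x)) \<le> sqrt B" for n
      by (simp add: V_def lessThan_atLeast0)
    then show ?case
      by (intro summableI_nonneg_bounded) auto
  qed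
  define w where "w x = lim (\<lambda>n. u n x)" for x
  have [measurable]: "w \<in> borel_measurable half_line"
    unfolding w_def by measurable
  have tel: "u n x - u m x = (\<Sum>k\<in>{m..<n}. v k x)" if "m \<le> n" for m n x
    using sum_Suc_diff'[OF that, of "\<lambda>k. u k x"] unfolding v_def by simp
  have lim: "AE x in half_line. (\<lambda>n. u n x) \<longlonglongrightarrow> w x"
    using sumv
  proof eventually_elim
    case (elim x)
    then have "summable (\<lambda>k. v k x)"
      by (rule summable_norm_cancel)
    then have "convergent (\<lambda>n. \<Sum>k<n. v k x)"
      by (simp add: summable_iff_convergent)
    then have "convergent (\<lambda>n. u 0 x + (\<Sum>k<n. v k x))"
      by (intro convergent_add convergent_const)
    moreover have "(\<lambda>n. u 0 x + (\<Sum>k<n. v k x)) = (\<lambda>n. u n x)"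
      unfolding lessThan_atLeast0 tel[OF le0, symmetric] by simp
    ultimately show ?case
      unfolding w_def convergent_LIMSEQ_iff by (simp only:)
  qed
  have bound: "AE x in half_line. ennreal ((cmod (w x - u m x))\<^sup>2) \<le> (SUP n. ennreal ((V m n x)\<^sup>2))" for m
    using lim
  proof eventually_elim
    case (elim x)
    have "(\<lambda>n. ennreal ((cmod (u n x - u m x))\<^sup>2)) \<longlonglongrightarrow> ennreal ((cmod (w x - u m x))\<^sup>2)"
      by (intro tendsto_intros elim tendsto_ennrealI)
    moreover have "\<forall>\<^sub>F n in sequentially. ennreal ((cmod (u n x - u m x))\<^sup>2) \<le> (SUP n. ennreal ((V m n x)\<^sup>2))"
      using eventually_ge_at_top[of m]
    proof eventually_elim
      case (elim n)
      have "cmod (u n x - u m x) \<le> V m n x"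
        unfolding tel[OF elim] V_def by (rule norm_sum)
      then have "ennreal ((cmod (u n x - u m x))\<^sup>2) \<le> ennreal ((V m n x)\<^sup>2)"
        by (intro ennreal_leI power_mono) auto
      also have "\<dots> \<le> (SUP n. ennreal ((V m n x)\<^sup>2))"
        by (rule SUP_upper) simp
      finally show ?case .
    qed
    ultimately show ?case
      by (rule tendsto_upperbound) simp
  qed
  have diff_sum: "U - W = - X" if "X + U = W" for X U W :: L2
    using that by auto
  have wu: "(\<integral>\<^sup>+x. ennreal ((cmod (w x - u m x))\<^sup>2) \<partial>half_line) \<le> ennreal ((2 * (1 / 2) ^ m)\<^sup>2)" for m
    using nn_integral_mono_AE[OF bound[of m]] sup[of m] by (rule order_trans)
  have wum: "square_integrable (\<lambda>x. w x - u m x)" for m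
    unfolding square_integrable_def using wu[of m]
    by (intro conjI integrableI_bounded) (auto intro: le_less_trans)
  have w: "square_integrable w"
    using square_integrable_add[OF wum[of 0] u(1)[of 0]] by simp
  have close: "norm (f m - abs_L2 w) \<le> 2 * (1 / 2) ^ m" for m
  proof -
    have "abs_L2 (\<lambda>x. w x - u m x) + abs_L2 (u m) = abs_L2 w"
      using plus_abs[OF wum[of m] u(1)[of m]] by simp
    then have "f m - abs_L2 w = - abs_L2 (\<lambda>x. w x - u m x)"
      unfolding u(2) by (rule diff_sum)
    then have eq: "norm (f m - abs_L2 w) = norm (abs_L2 (\<lambda>x. w x - u m x))"
      by (simp only: norm_minus_cancel)
    have "(norm (abs_L2 (\<lambda>x. w x - u m x)))\<^sup>2 \<le> (2 * (1 / 2) ^ m)\<^sup>2"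
      using wu[of m] unfolding nn_integral_norm_sq[OF wum] by (subst (asm) ennreal_le_iff) auto
    then show ?thesis
      unfolding eq by (rule power2_le_imp_le) simp
  qed
  have "(\<lambda>m. f m - abs_L2 w) \<longlonglongrightarrow> 0"
  proof (rule Lim_null_comparison)
    show "\<forall>\<^sub>F m in sequentially. norm (f m - abs_L2 w) \<le> 2 * (1 / 2) ^ m"
      using close by (rule always_eventually[OF allI])
    show "(\<lambda>m. 2 * (1 / 2 :: real) ^ m) \<longlonglongrightarrow> 0"
      by (auto intro!: tendsto_mult_right_zero LIMSEQ_power_zero)
  qed
  then have "f \<longlonglongrightarrow> abs_L2 w"
    by (rule LIM_zero_cancel)
  then show ?thesis
    by (rule convergentI)
qed

instance L2 :: banach
proof
  fix X :: "nat \<Rightarrow> L2" assume "Cauchy X"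
  then have "\<exists>M. \<forall>m\<ge>M. \<forall>n\<ge>M. norm (X m - X n) < (1 / 2) ^ k" for k :: nat
    by (intro CauchyD) auto
  then obtain M where M: "\<And>k m n. M k \<le> m \<Longrightarrow> M k \<le> n \<Longrightarrow> norm (X m - X n) < (1 / 2) ^ k"
    by metis
  define r where "r k = (\<Sum>j\<le>k. M j + 1)" for k
  have "strict_mono r"
    by (rule strict_monoI_Suc) (simp add: r_def)
  have rM: "M k \<le> r k" for k
    unfolding r_def by (rule order_trans[OF _ member_le_sum[of k]]) auto
  have "norm (X (r (Suc k)) - X (r k)) \<le> (1 / 2) ^ k" for k
    using M[of k "r (Suc k)" "r k"] rM[of k] strict_monoD[OF \<open>strict_mono r\<close>, of k "Suc k"] by simp
  then have "convergent (X \<circ> r)"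
    by (intro L2_convergent_of_fast_Cauchy) simp
  then obtain l where "(X \<circ> r) \<longlonglongrightarrow> l"
    unfolding convergent_def by (rule exE)
  then have "X \<longlonglongrightarrow> l"
    by (rule Cauchy_converges_subseq[OF \<open>Cauchy X\<close> \<open>strict_mono r\<close>])
  then show "convergent X"
    by (rule convergentI)
qed

lemma cinner_zero_left [simp]: "cinner 0 f = 0" and cinner_zero_right [simp]: "cinner f 0 = 0"
  using cinner_add_left[of 0 0 f] cinner_add_right[of f 0 0] by simp_all

lemma cinner_sum_right: "cinner f (\<Sum>i\<in>A. g i) = (\<Sum>i\<in>A. cinner f (g i))"
  by (induction A rule: infinite_finite_induct) (simp_all add: cinner_add_right)

lemma bounded_linear_cinner_right: "bounded_linear (cinner a)"
proof (rule bounded_linear_intro)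
  show "cinner a (f + g) = cinner a f + cinner a g" for f g
    by (rule cinner_add_right)
  show "cinner a (r *\<^sub>R f) = r *\<^sub>R cinner a f" for r f
    by (simp add: scaleR_L2_def cinner_scale_right scaleR_conv_of_real)
  show "norm (cinner a f) \<le> norm f * norm a" for f
    using cinner_Cauchy_Schwarz[of a f] by (simp add: mult.commute)
qed

lemma orthonormal_coefficient:
  assumes "orthonormal E" "finite F" "F \<subseteq> E" "e \<in> E"
  shows "cinner e (\<Sum>e'\<in>F. c e' *\<^sub>C e') = (if e \<in> F then c e else 0)"
proof -
  have "cinner e (\<Sum>e'\<in>F. c e' *\<^sub>C e') = (\<Sum>e'\<in>F. if e = e' then c e' else 0)"
    unfolding cinner_sum_right cinner_scale_right
    using assms by (intro sum.cong) (auto simp: orthonormal_def)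
  then show ?thesis
    using assms(2) by (simp add: sum.delta)
qed

lemma orthonormal_Pythagoras:
  assumes E: "orthonormal E" "finite F" "F \<subseteq> E"
  shows "(norm (\<Sum>e\<in>F. c e *\<^sub>C e))\<^sup>2 = (\<Sum>e\<in>F. (cmod (c e))\<^sup>2)"
proof -
  let ?s = "\<Sum>e\<in>F. c e *\<^sub>C e"
  have "cinner ?s ?s = (\<Sum>e\<in>F. c e * cinner ?s e)"
    unfolding cinner_sum_right[of ?s] cinner_scale_right ..
  also have "\<dots> = (\<Sum>e\<in>F. c e * cnj (c e))"
  proof (rule sum.cong[OF refl])
    fix e assume "e \<in> F"
    then have "cinner e ?s = c e"
      using orthonormal_coefficient[OF E, of e c] E by auto
    then show "c e * cinner ?s e = c e * cnj (c e)"
      by (subst cinner_commute) simp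
  qed
  also have "\<dots> = of_real (\<Sum>e\<in>F. (cmod (c e))\<^sup>2)"
    unfolding of_real_sum by (intro sum.cong refl) (simp only: complex_norm_square)
  finally show ?thesis
    unfolding cinner_self of_real_eq_iff .
qed

lemma Bessel_inequality:
  assumes E: "orthonormal E" "finite F" "F \<subseteq> E"
  shows "(\<Sum>e\<in>F. (cmod (cinner e f))\<^sup>2) \<le> (norm f)\<^sup>2"
proof -
  let ?s = "\<Sum>e\<in>F. cinner e f *\<^sub>C e"
  let ?S = "\<Sum>e\<in>F. (cmod (cinner e f))\<^sup>2"
  have "cinner f ?s = (\<Sum>e\<in>F. cinner e f * cnj (cinner e f))"
    unfolding cinner_sum_right cinner_scale_right by (subst (2) cinner_commute) simp
  also have "\<dots> = of_real ?S"
    unfolding of_real_sum by (intro sum.cong refl) (simp only: complex_norm_square)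
  finally have eq: "cinner f ?s = complex_of_real ?S" .
  have "?S \<le> cmod (cinner f ?s)"
    unfolding eq norm_of_real by (rule abs_ge_self)
  also have "\<dots> \<le> norm f * norm ?s"
    by (rule cinner_Cauchy_Schwarz)
  also have "norm ?s = sqrt ?S"
    unfolding orthonormal_Pythagoras[OF E, symmetric] by simp
  finally have le: "?S \<le> norm f * sqrt ?S" .
  have S: "?S \<ge> 0"
    by (intro sum_nonneg) auto
  show ?thesis
  proof (cases "?S = 0")
    case False
    have "sqrt ?S * sqrt ?S \<le> norm f * sqrt ?S"
      using le S by simp
    then have "sqrt ?S \<le> norm f"
      by (rule mult_right_le_imp_le) (use False S in \<open>simp add: less_le\<close>)
    then show ?thesis
      using real_sqrt_le_iff[of ?S "(norm f)\<^sup>2"] by simp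
  qed simp
qed

lemma coefficients_summable:
  assumes "orthonormal E"
  shows "(\<lambda>e. (cmod (cinner e f))\<^sup>2) summable_on E"
  using Bessel_inequality[OF assms]
  by (intro nonneg_bdd_above_summable_on bdd_aboveI2[where M = "(norm f)\<^sup>2"]) auto

text \<open>
  By the Bessel inequality the squared coefficients are summable, so by Pythagoras the finite partial sums of the
  expansion form a Cauchy net. The limit exists by completeness. It has the same coefficients as \<open>f\<close>, and totality of
  the basis identifies it with \<open>f\<close>.
\<close>

lemma orthonormal_expansion:
  assumes E: "orthonormal_basis E"
  shows "((\<lambda>e. cinner e f *\<^sub>C e) has_sum f) E"
proof -
  have on: "orthonormal E"
    using E by (simp add: orthonormal_basis_def)
  let ?g = "\<lambda>e. cinner e f *\<^sub>C e" and ?r = "\<lambda>e. (cmod (cinner e f))\<^sup>2"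
  obtain L where L: "(?r has_sum L) E"
    using coefficients_summable[OF on] by (auto simp: summable_on_def)
  have "\<exists>P. eventually P (finite_subsets_at_top E) \<and> (\<forall>F1 F2. P F1 \<and> P F2 \<longrightarrow> dist (sum ?g F1) (sum ?g F2) < \<epsilon>)"
    if "\<epsilon> > 0" for \<epsilon>
  proof -
    \<comment> \<open>Both sums of squares are within \<open>d\<close> of the limit, so they differ by less than \<open>2 d = (\<epsilon> / 2)\<^sup>2\<close>.\<close>
    define d where "d = \<epsilon>\<^sup>2 / 8"
    have "d > 0"
      using that by (simp add: d_def)
    then have "\<forall>\<^sub>F F in finite_subsets_at_top E. dist (sum ?r F) L < d"
      by (rule tendstoD[OF L[unfolded has_sum_def]])
    then obtain F0 where F0': "finite F0 \<and> F0 \<subseteq> E \<and>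
      (\<forall>F. finite F \<and> F0 \<subseteq> F \<and> F \<subseteq> E \<longrightarrow> dist (sum ?r F) L < d)"
      unfolding eventually_finite_subsets_at_top by (rule exE)
    have F0: "dist (sum ?r F) L < d" if "finite F" "F0 \<subseteq> F" "F \<subseteq> E" for F
      using F0' that by blast
    define P where "P F \<longleftrightarrow> finite F \<and> F0 \<subseteq> F \<and> F \<subseteq> E" for F
    have "eventually P (finite_subsets_at_top E)"
      unfolding eventually_finite_subsets_at_top P_def using F0' by (intro exI[of _ F0]) blast
    moreover have "dist (sum ?g F1) (sum ?g F2) < \<epsilon>" if P: "P F1" "P F2" for F1 F2
    proof -
      let ?F = "F1 \<union> F2"
      have sub: "norm (sum ?g ?F - sum ?g F') < \<epsilon> / 2" if F': "F' \<subseteq> ?F" "P F'" for F'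
      proof -
        have fin: "finite ?F" "?F \<subseteq> E" "F0 \<subseteq> ?F"
          using P by (auto simp: P_def)
        have "(norm (sum ?g ?F - sum ?g F'))\<^sup>2 = (norm (sum ?g (?F - F')))\<^sup>2"
          using fin F' by (subst sum_diff) auto
        also have "\<dots> = sum ?r (?F - F')"
          using fin by (intro orthonormal_Pythagoras[OF on]) auto
        also have "\<dots> = sum ?r ?F - sum ?r F'"
          using fin F' by (subst sum_diff) auto
        also have "\<dots> < 2 * d"
          using F0[of ?F] F0[of F'] fin F'(2) by (auto simp: P_def dist_real_def)
        also have "\<dots> = (\<epsilon> / 2)\<^sup>2"
          by (simp add: d_def power2_eq_square)
        finally show ?thesis
          by (rule power2_less_imp_less) (use \<open>\<epsilon> > 0\<close> in simp)
      qed
      have "dist (sum ?g F1) (sum ?g F2) \<le> dist (sum ?g ?F) (sum ?g F1) + dist (sum ?g ?F) (sum ?g F2)"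
        by (rule dist_triangle3)
      also have "\<dots> < \<epsilon> / 2 + \<epsilon> / 2"
        unfolding dist_norm using P by (intro add_strict_mono sub) auto
      finally show ?thesis
        by simp
    qed
    ultimately show ?thesis
      by blast
  qed
  then have "cauchy_filter (filtermap (sum ?g) (finite_subsets_at_top E))"
    by (simp add: cauchy_filter_metric_filtermap)
  moreover have "complete (UNIV :: L2 set)"
    by (meson Cauchy_convergent UNIV_I complete_def convergent_def)
  ultimately obtain h where h: "(sum ?g \<longlongrightarrow> h) (finite_subsets_at_top E)"
    using complete_uniform[where S = UNIV] by (force simp: filterlim_def)
  have "cinner e (f - h) = 0" if e: "e \<in> E" for e
  proof -
    have "((\<lambda>F. cinner e (sum ?g F)) \<longlongrightarrow> cinner e h) (finite_subsets_at_top E)"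
      by (rule bounded_linear.tendsto[OF bounded_linear_cinner_right h])
    moreover have "\<forall>\<^sub>F F in finite_subsets_at_top E. cinner e (sum ?g F) = cinner e f"
      unfolding eventually_finite_subsets_at_top
      using e orthonormal_coefficient[OF on _ _ e] by (intro exI[of _ "{e}"]) auto
    then have "((\<lambda>F. cinner e (sum ?g F)) \<longlongrightarrow> cinner e f) (finite_subsets_at_top E)"
      by (rule tendsto_eventually)
    ultimately have "cinner e h = cinner e f"
      by (intro tendsto_unique) auto
    then show ?thesis
      by (simp add: cinner_minus_right)
  qed
  then have "f - h = 0"
    using E unfolding orthonormal_basis_def by blast
  then show ?thesis
    using h by (simp add: has_sum_def)
qed

text \<open>
  Apply the continuous functional \<open>cinner a\<close> to the expansion of \<open>b\<close>.
\<close>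

lemma Parseval:
  assumes E: "orthonormal_basis E"
  shows "((\<lambda>e. cinner a e * cinner e b) has_sum cinner a b) E"
proof -
  interpret bounded_linear "cinner a"
    by (rule bounded_linear_cinner_right)
  have "(cinner a \<circ> (\<lambda>e. cinner e b *\<^sub>C e) has_sum cinner a b) E"
    by (rule has_sum_comm_additive[OF _ _ orthonormal_expansion[OF E]])
       (auto intro!: additive.intro add tendsto simp: add)
  then show ?thesis
    by (simp add: comp_def cinner_scale_right mult.commute)
qed

section \<open>Rank-one operators\<close>

lemma bounded_clinear_rank_one: "bounded_clinear (\<lambda>f. (c * cinner a f) *\<^sub>C b)"
  unfolding bounded_clinear_def
proof (intro conjI allI)
  show "bounded_linear (\<lambda>f. (c * cinner a f) *\<^sub>C b)"
  proof (rule bounded_linear_intro)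
    show "(c * cinner a (f + g)) *\<^sub>C b = (c * cinner a f) *\<^sub>C b + (c * cinner a g) *\<^sub>C b" for f g
      by (simp add: cinner_add_right distrib_left cscale_add_left)
    show "(c * cinner a (r *\<^sub>R f)) *\<^sub>C b = r *\<^sub>R ((c * cinner a f) *\<^sub>C b)" for r f
      by (simp add: scaleR_L2_def cinner_scale_right cscale_assoc mult.left_commute)
    show "norm ((c * cinner a f) *\<^sub>C b) \<le> norm f * (cmod c * norm a * norm b)" for f
    proof -
      have "cmod c * cmod (cinner a f) * norm b \<le> cmod c * (norm a * norm f) * norm b"
        by (intro mult_right_mono mult_left_mono cinner_Cauchy_Schwarz) auto
      then show ?thesis
        by (simp add: norm_cscale norm_mult mult_ac)
    qed
  qed
  show "(c * cinner a (d *\<^sub>C f)) *\<^sub>C b = d *\<^sub>C (c * cinner a f) *\<^sub>C b" for d f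
    by (simp add: cinner_scale_right cscale_assoc mult.left_commute)
qed

text \<open>
  The absolute value of \<open>f \<mapsto> c \<langle>a,f\<rangle> b\<close> is again of rank one, namely \<open>f \<mapsto> r \<langle>a,f\<rangle> a\<close> with
  \<open>r = |c| \<parallel>b\<parallel> / \<parallel>a\<parallel>\<close>. Its diagonal is summable by the Parseval identity.
\<close>

lemma trace_class_rank_one: "trace_class (\<lambda>f. (c * cinner a f) *\<^sub>C b)"
  unfolding trace_class_def
proof (intro conjI exI allI impI)
  let ?A = "\<lambda>f. (c * cinner a f) *\<^sub>C b"
  define r where "r = cmod c * norm b / norm a"
  define P where "P f = (of_real r * cinner a f) *\<^sub>C a" for f
  \<comment> \<open>For \<open>a = 0\<close> both operators are zero, whatever value the division by 0 gives to \<open>r\<close>.\<close>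
  have r: "r \<ge> 0" "r\<^sup>2 * (norm a)\<^sup>2 = (cmod c)\<^sup>2 * (norm b)\<^sup>2 \<or> a = 0"
    by (auto simp: r_def power_mult_distrib power_divide)
  have diag: "cinner f (P f) = of_real (r * (cmod (cinner a f))\<^sup>2)" for f
    unfolding P_def cinner_scale_right cinner_commute[of f a] of_real_mult
    by (simp only: complex_norm_square mult.assoc)
  show "bounded_clinear ?A"
    by (rule bounded_clinear_rank_one)
  show "is_operator_abs ?A P"
    unfolding is_operator_abs_def positive_operator_def
  proof (intro conjI allI)
    show "bounded_clinear P"
      unfolding P_def by (rule bounded_clinear_rank_one)
    show "cinner f (P f) \<in> \<real>\<^sub>\<ge>\<^sub>0" for f
      unfolding diag using r by (simp add: complex_nonneg_Reals_iff)
    show "cinner f (P (P g)) = cinner (?A f) (?A g)" for f g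
    proof -
      have "cinner f (P (P g)) = cinner f a * cinner a g * of_real (r\<^sup>2 * (norm a)\<^sup>2)"
        unfolding P_def cinner_scale_right cinner_self by (simp add: power2_eq_square mult_ac)
      also have "\<dots> = cinner f a * cinner a g * of_real ((cmod c)\<^sup>2 * (norm b)\<^sup>2)"
        using r(2)
      proof
        assume "r\<^sup>2 * (norm a)\<^sup>2 = (cmod c)\<^sup>2 * (norm b)\<^sup>2"
        then show ?thesis
          by (simp only:)
      qed simp
      also have "\<dots> = cinner f a * cinner a g * ((c * cnj c) * cinner b b)"
        unfolding cinner_self of_real_mult by (simp only: complex_norm_square)
      also have "\<dots> = cinner (?A f) (?A g)"
        unfolding cinner_scale_right cinner_scale_left by (simp add: mult_ac cinner_commute[of f a])
      finally show ?thesis .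
    qed
  qed
  fix E assume "orthonormal_basis E"
  then have "((\<lambda>e. cinner a e * cinner e a) has_sum cinner a a) E"
    by (rule Parseval)
  then have "((\<lambda>e. of_real r * (cinner a e * cinner e a)) has_sum (of_real r * cinner a a)) E"
    by (rule has_sum_cmult_right)
  moreover have "of_real r * (cinner a e * cinner e a) = cinner e (P e)" for e
    unfolding P_def cinner_scale_right by simp
  ultimately show "(\<lambda>e. cinner e (P e)) summable_on E"
    by (auto simp: summable_on_def)
qed

lemma op_trace_rank_one: "op_trace (\<lambda>f. (c * cinner a f) *\<^sub>C b) = c * cinner a b"
  unfolding op_trace_def
proof (rule the_equality)
  show sum: "\<forall>E. orthonormal_basis E \<longrightarrow> ((\<lambda>e. cinner e ((c * cinner a e) *\<^sub>C b)) has_sum c * cinner a b) E"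
  proof (intro allI impI)
    fix E assume "orthonormal_basis E"
    from has_sum_cmult_right[OF Parseval[OF this, of a b], of c]
    show "((\<lambda>e. cinner e ((c * cinner a e) *\<^sub>C b)) has_sum c * cinner a b) E"
      by (simp add: cinner_scale_right mult.assoc)
  qed
  fix t assume "\<forall>E. orthonormal_basis E \<longrightarrow> ((\<lambda>e. cinner e ((c * cinner a e) *\<^sub>C b)) has_sum t) E"
  then show "t = c * cinner a b"
    using sum orthonormal_basis_exists has_sum_unique by blast
qed

section \<open>Integrals over the half-line\<close>

lemma absolutely_integrable_lebesgue_on:
  fixes f :: "real \<Rightarrow> 'b::euclidean_space"
  assumes "S \<in> sets lebesgue"
  shows "f absolutely_integrable_on S \<longleftrightarrow> integrable (lebesgue_on S) f"
  using assms by (simp add: set_integrable_def integrable_restrict_space)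

text \<open>
  Links the Lebesgue integral over the half-line to gauge integrals over compact intervals, to which the fundamental
  theorem applies.
\<close>

lemma tendsto_integral_half_line:
  fixes g :: "real \<Rightarrow> complex"
  assumes "integrable half_line g"
  shows "(\<lambda>n. integral {1 / real (Suc n)..real (Suc n)} g) \<longlonglongrightarrow> (\<integral>x. g x \<partial>half_line)"
proof -
  define A where "A n = {1 / real (Suc n)..real (Suc n)}" for n
  have A: "A n \<subseteq> {0<..}" for n
    by (auto simp: A_def intro: less_le_trans[rotated])
  have g: "g absolutely_integrable_on {0<..}"
    using assms by (simp add: absolutely_integrable_lebesgue_on)
  have "(\<lambda>n. set_lebesgue_integral lebesgue (A n) g) \<longlonglongrightarrow> set_lebesgue_integral lebesgue (\<Union>n. A n) g"
  proof (rule set_integral_cont_up)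
    show "A n \<in> sets lebesgue" for n
      by (simp add: A_def)
    show "incseq A"
      unfolding A_def by (intro incseq_SucI) (auto simp: field_simps intro: order_trans)
    show "set_integrable lebesgue (\<Union>n. A n) g"
      using A by (intro set_integrable_subset[OF g]) (auto simp: A_def)
  qed
  also have "(\<Union>n. A n) = {0<..}"
  proof
    show "{0<..} \<subseteq> (\<Union>n. A n)"
    proof
      fix x :: real assume x: "x \<in> {0<..}"
      obtain n where "max x (1 / x) < real n"
        using reals_Archimedean2 by blast
      then have "x \<le> real (Suc n)" "1 / x \<le> real (Suc n)"
        by auto
      then have "x \<in> A n"
        using x by (auto simp: A_def field_simps)
      then show "x \<in> (\<Union>n. A n)"
        by blast
    qed
  qed (use A in blast)
  also have "set_lebesgue_integral lebesgue {0<..} g = (\<integral>x. g x \<partial>half_line)"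
    by (simp add: set_lebesgue_integral_def integral_restrict_space)
  also have "(\<lambda>n. set_lebesgue_integral lebesgue (A n) g) = (\<lambda>n. integral (A n) g)"
    using A by (intro ext set_lebesgue_integral_eq_integral(2) set_integrable_subset[OF g]) (auto simp: A_def)
  finally show ?thesis
    by (simp add: A_def)
qed

lemma seq_at_right_0: "filterlim (\<lambda>n. 1 / real (Suc n)) (at_right 0) sequentially"
proof -
  have "(\<lambda>n. 1 / real n) \<longlonglongrightarrow> 0"
    by (rule lim_1_over_n)
  from LIMSEQ_Suc[OF this] show ?thesis
    by (simp add: filterlim_at)
qed

lemma seq_at_top: "filterlim (\<lambda>n. real (Suc n)) at_top sequentially"
  using filterlim_real_sequentially by (rule filterlim_compose[OF _ filterlim_Suc])

lemma integral_half_line_FTC: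
  fixes G :: "real \<Rightarrow> complex"
  assumes g: "integrable half_line g"
    and d: "\<And>x. 0 < x \<Longrightarrow> (G has_vector_derivative g x) (at x)"
    and l0: "(G \<longlongrightarrow> l0) (at_right 0)" and l1: "(G \<longlongrightarrow> l1) at_top"
  shows "(\<integral>x. g x \<partial>half_line) = l1 - l0"
proof (rule LIMSEQ_unique[OF tendsto_integral_half_line[OF g]])
  have "integral {1 / real (Suc n)..real (Suc n)} g = G (real (Suc n)) - G (1 / real (Suc n))" for n
  proof (rule integral_unique, rule fundamental_theorem_of_calculus)
    show "1 / real (Suc n) \<le> real (Suc n)"
      by (simp add: field_simps)
    fix x assume "x \<in> {1 / real (Suc n)..real (Suc n)}"
    then have "0 < x"
      by (auto intro: less_le_trans[rotated])
    then show "(G has_vector_derivative g x) (at x within {1 / real (Suc n)..real (Suc n)})"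
      by (rule has_vector_derivative_at_within[OF d])
  qed
  then show "(\<lambda>n. integral {1 / real (Suc n)..real (Suc n)} g) \<longlonglongrightarrow> l1 - l0"
    using tendsto_diff[OF filterlim_compose[OF l1 seq_at_top] filterlim_compose[OF l0 seq_at_right_0]]
    by simp
qed

lemma integrable_half_line_bound:
  fixes f :: "real \<Rightarrow> 'b::euclidean_space"
  assumes "continuous_on {0<..} f" "g integrable_on {0<..}" "\<And>x. 0 < x \<Longrightarrow> norm (f x) \<le> g x"
  shows "integrable half_line f"
proof -
  have "f absolutely_integrable_on {0<..}"
    by (rule measurable_bounded_by_integrable_imp_absolutely_integrable[OF _ _ assms(2)])
       (use assms in \<open>auto intro: continuous_imp_measurable_on_sets_lebesgue\<close>)
  then show ?thesis
    by (simp add: absolutely_integrable_lebesgue_on)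
qed

section \<open>Laplace integrals and the Euler constant\<close>

lemma exp_neg_integrable: "0 < a \<Longrightarrow> (\<lambda>t::real. C * exp (- a * t)) integrable_on {0<..}"
proof -
  assume "0 < a"
  then have "(\<lambda>t. C * exp (- a * t)) integrable_on {0..}"
    using integrable_on_exp_minus_to_infinity[of a 0] by (intro integrable_on_mult_right) simp
  then show ?thesis
    by (rule integrable_spike_set) (auto intro: negligible_subset[of "{0}"])
qed

lemma power_le_exp:
  fixes x :: real
  assumes "0 \<le> x"
  shows "x ^ n \<le> fact n * exp x"
proof -
  have "x ^ n /\<^sub>R fact n \<le> (\<Sum>k. x ^ k /\<^sub>R fact k)"
    using sum_le_suminf[OF summable_exp_generic, of "{n}" x] assms by simp
  then show ?thesis
    by (simp add: exp_def field_simps)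
qed

text \<open>
  The \<open>n\<close>-th moment integral of the phase \<open>c\<close>: up to the sign \<open>(-1)\<^sup>n\<close>, the \<open>n\<close>-th derivative of the integral of
  \<open>exp (- s c(t))\<close>. The phase \<open>cosh\<close> gives the Macdonald function, the phase \<open>exp\<close> the exponential integral \<open>E\<^sub>1\<close>.
\<close>

definition laplace :: "(real \<Rightarrow> real) \<Rightarrow> nat \<Rightarrow> complex \<Rightarrow> complex" where
  "laplace c n s = (\<integral>t. of_real (c t) ^ n * exp (- s * of_real (c t)) \<partial>half_line)"

text \<open>
  Linear growth of the phase is what makes all the moment integrals converge for \<open>Re s > 0\<close>. The constants are chosen
  so that both \<open>cosh\<close> and \<open>exp\<close> qualify.
\<close>

definition phase :: "(real \<Rightarrow> real) \<Rightarrow> bool" where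
  "phase c \<longleftrightarrow> continuous_on {0<..} c \<and> (\<forall>t>0. c t \<ge> (1 + t) / 2)"

lemma phase_cosh: "phase cosh" and phase_exp: "phase exp"
proof -
  have "(1 + t) / 2 \<le> cosh t" if "t > 0" for t :: real
  proof -
    have "1 + t \<le> exp t + exp (- t)"
      using exp_ge_add_one_self[of t] exp_gt_zero[of "- t"] by linarith
    then show ?thesis
      by (simp add: cosh_field_def)
  qed
  then show "phase cosh"
    by (auto simp: phase_def intro!: continuous_intros)
  have "(1 + t) / 2 \<le> exp t" if "t > 0" for t :: real
  proof -
    have "(1 + t) / 2 \<le> 1 + t"
      using that by simp
    then show ?thesis
      using exp_ge_add_one_self[of t] by (rule order_trans)
  qed
  then show "phase exp"
    by (auto simp: phase_def intro!: continuous_intros)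
qed

text \<open>
  Half of the exponential factor absorbs the power of the phase, and the other half decays exponentially in \<open>t\<close>.
\<close>

lemma laplace_integrable:
  assumes c: "phase c" and s: "Re s > 0"
  shows "integrable half_line (\<lambda>t. of_real (c t) ^ n * exp (- s * of_real (c t)))"
proof (rule integrable_half_line_bound)
  show "continuous_on {0<..} (\<lambda>t. of_real (c t) ^ n * exp (- s * of_real (c t)))"
    using c by (auto simp: phase_def intro!: continuous_intros)
  let ?a = "Re s"
  let ?C = "fact n * (2 / ?a) ^ n"
  show "(\<lambda>t. ?C * exp (- (?a / 4) * t)) integrable_on {0<..}"
    using s by (intro exp_neg_integrable) simp
  fix t :: real assume "0 < t"
  then have ct: "c t \<ge> (1 + t) / 2"
    using c by (auto simp: phase_def)
  then have ct0: "c t \<ge> 0"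
    using \<open>0 < t\<close> by simp
  have "(?a / 2 * c t) ^ n \<le> fact n * exp (?a / 2 * c t)"
    using s ct0 by (intro power_le_exp) simp
  then have "(2 / ?a) ^ n * (?a / 2 * c t) ^ n \<le> (2 / ?a) ^ n * (fact n * exp (?a / 2 * c t))"
    using s by (intro mult_left_mono) auto
  moreover have "(2 / ?a) ^ n * (?a / 2 * c t) ^ n = c t ^ n"
    using s unfolding power_mult_distrib[symmetric] by simp
  ultimately have "c t ^ n \<le> ?C * exp (?a / 2 * c t)"
    by (simp add: mult_ac)
  then have "c t ^ n * exp (- ?a * c t) \<le> ?C * exp (?a / 2 * c t) * exp (- ?a * c t)"
    by (intro mult_right_mono) auto
  also have "\<dots> = ?C * exp (- (?a / 2) * c t)"
    by (simp add: exp_add[symmetric] algebra_simps)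
  also have "\<dots> \<le> ?C * exp (- (?a / 4) * t)"
  proof -
    have "?a * t \<le> ?a * (2 * c t)"
      using s ct \<open>0 < t\<close> by (intro mult_left_mono) auto
    then show ?thesis
      using s by (intro mult_left_mono) auto
  qed
  finally show "norm (of_real (c t) ^ n * exp (- s * of_real (c t))) \<le> ?C * exp (- (?a / 4) * t)"
    using ct0 by (simp add: norm_mult norm_power)
qed

lemma integral_norm_le:
  fixes f :: "real \<Rightarrow> complex"
  assumes "integrable half_line g" "integrable half_line f" "\<And>t. 0 < t \<Longrightarrow> norm (f t) \<le> g t"
  shows "norm (\<integral>t. f t \<partial>half_line) \<le> (\<integral>t. g t \<partial>half_line)"
proof -
  have "norm (\<integral>t. f t \<partial>half_line) \<le> (\<integral>t. norm (f t) \<partial>half_line)"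
    by (rule integral_norm_bound)
  also have "\<dots> \<le> (\<integral>t. g t \<partial>half_line)"
    using assms by (intro integral_mono) auto
  finally show ?thesis .
qed

text \<open>
  Differentiation under the integral sign: the second-order Taylor estimate of the exponential bounds the error of the
  difference quotient by a multiple of \<open>|h|\<close>, with a factor that is the integral of the function \<open>g\<close>.
\<close>

lemma laplace_has_field_derivative:
  assumes c: "phase c" and s: "Re s > 0"
  shows "(laplace c n has_field_derivative (- laplace c (Suc n) s)) (at s)"
proof -
  \<comment> \<open>Increments with \<open>|h| < a\<close> stay in the half-plane, and \<open>exp (- a c)\<close> dominates the perturbed exponentials.\<close>
  define a where "a = Re s / 2"
  have a: "a > 0"
    using s by (simp add: a_def)
  define g where "g t = c t ^ (n + 2) * exp (- a * c t)" for t
  have c0: "c t \<ge> 0" if "t > 0" for t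
    using c that by (force simp: phase_def)
  have gi: "integrable half_line g"
  proof -
    have "integrable half_line (\<lambda>t. norm (of_real (c t) ^ (n + 2) * exp (- complex_of_real a * of_real (c t))))"
      using a by (intro integrable_norm laplace_integrable[OF c]) simp
    moreover have "norm (of_real (c t) ^ (n + 2) * exp (- complex_of_real a * of_real (c t))) = g t" if "t > 0" for t
      using c0[OF that] by (simp add: g_def norm_mult norm_power)
    then have "integrable half_line (\<lambda>t. norm (of_real (c t) ^ (n + 2) * exp (- complex_of_real a * of_real (c t))))
        \<longleftrightarrow> integrable half_line g"
      by (intro Bochner_Integration.integrable_cong refl) simp
    ultimately show ?thesis
      by blast
  qed
  define M where "M = (\<integral>t. g t \<partial>half_line)"
  have est: "norm ((laplace c n (s + h) - laplace c n s) / h + laplace c (Suc n) s) \<le> M * norm h"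
    if h: "h \<noteq> 0" "norm h < a" for h
  proof -
    have sh: "Re (s + h) > 0"
      using h(2) abs_Re_le_cmod[of h] s by (simp add: a_def)
    let ?f = "\<lambda>t. (of_real (c t) ^ n * exp (- (s + h) * of_real (c t)) - of_real (c t) ^ n * exp (- s * of_real (c t))) / h
        + of_real (c t) ^ Suc n * exp (- s * of_real (c t))"
    note int = laplace_integrable[OF c sh, of n] laplace_integrable[OF c s, of n] laplace_integrable[OF c s, of "Suc n"]
    have "(laplace c n (s + h) - laplace c n s) / h + laplace c (Suc n) s = (\<integral>t. ?f t \<partial>half_line)"
      unfolding laplace_def using int by simp
    also have "norm \<dots> \<le> (\<integral>t. norm h * g t \<partial>half_line)"
    proof (rule integral_norm_le)
      show "integrable half_line (\<lambda>t. norm h * g t)"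
        using gi by simp
      show "integrable half_line ?f"
        using int by (intro Bochner_Integration.integrable_add Bochner_Integration.integrable_diff integrable_divide_zero) auto
      fix t :: real assume "0 < t"
      let ?w = "- h * of_real (c t)"
      have "?f t = of_real (c t) ^ n * exp (- s * of_real (c t)) * (exp ?w - 1 - ?w) / h"
        using h by (simp add: field_simps exp_add[symmetric] distrib_right)
      then have "norm (?f t) = c t ^ n * exp (- Re s * c t) * norm (exp ?w - 1 - ?w) / norm h"
        using c0[OF \<open>0 < t\<close>] by (simp add: norm_mult norm_divide norm_power)
      also have "\<dots> \<le> c t ^ n * exp (- Re s * c t) * (exp (a * c t) * (norm h * c t)\<^sup>2) / norm h"
      proof (intro divide_right_mono mult_left_mono)
        have "norm (exp ?w - (\<Sum>k\<le>1. ?w ^ k / fact k)) \<le> exp \<bar>Re ?w\<bar> * norm ?w ^ Suc 1 / fact 1"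
          by (rule Taylor_exp)
        moreover have "(\<Sum>k\<le>1. ?w ^ k / fact k) = 1 + ?w"
          by (simp add: numeral_eq_Suc atMost_Suc)
        moreover have "exp \<bar>Re ?w\<bar> \<le> exp (a * c t)"
        proof -
          have "\<bar>Re h\<bar> \<le> a"
            using h(2) abs_Re_le_cmod[of h] by simp
          then show ?thesis
            using c0[OF \<open>0 < t\<close>] by (simp add: abs_mult mult_right_mono)
        qed
        ultimately show "norm (exp ?w - 1 - ?w) \<le> exp (a * c t) * (norm h * c t)\<^sup>2"
          using c0[OF \<open>0 < t\<close>] mult_right_mono[of "exp \<bar>Re ?w\<bar>" "exp (a * c t)" "(norm h * c t)\<^sup>2"]
          by (simp add: norm_mult power2_eq_square algebra_simps)
      qed (use c0[OF \<open>0 < t\<close>] in auto)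
      also have "\<dots> = norm h * (c t ^ (n + 2) * (exp (- Re s * c t) * exp (a * c t)))"
        using h(1) by (simp add: power2_eq_square power_add)
      also have "exp (- Re s * c t) * exp (a * c t) = exp (- a * c t)"
        by (simp add: exp_add[symmetric] a_def field_simps)
      finally show "norm (?f t) \<le> norm h * g t"
        by (simp add: g_def)
    qed
    also have "\<dots> = M * norm h"
      by (simp add: M_def)
    finally show ?thesis .
  qed
  have "((\<lambda>h. (laplace c n (s + h) - laplace c n s) / h + laplace c (Suc n) s) \<longlongrightarrow> 0) (at 0)"
  proof (rule Lim_null_comparison)
    show "\<forall>\<^sub>F h in at 0. norm ((laplace c n (s + h) - laplace c n s) / h + laplace c (Suc n) s) \<le> M * norm h"
      unfolding eventually_at using a est by (intro exI[of _ a]) auto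
    show "((\<lambda>h. M * norm h) \<longlongrightarrow> 0) (at (0::complex))"
      by (auto intro!: tendsto_eq_intros)
  qed
  then have "((\<lambda>h. (laplace c n (s + h) - laplace c n s) / h) \<longlongrightarrow> - laplace c (Suc n) s) (at 0)"
    using Lim_null[of "\<lambda>h. (laplace c n (s + h) - laplace c n s) / h" "- laplace c (Suc n) s"] by simp
  then show ?thesis
    by (simp add: DERIV_def)
qed

lemma of_real_has_vector_derivative:
  "(c has_real_derivative c') (at t) \<Longrightarrow>
    ((\<lambda>t. complex_of_real (c t)) has_vector_derivative of_real c') (at t)"
  unfolding has_real_derivative_iff_has_vector_derivative
  by (rule bounded_linear.has_vector_derivative[OF bounded_linear_of_real])

lemma exp_phase_has_vector_derivative:
  assumes "(c has_real_derivative c') (at t)"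
  shows "((\<lambda>t. exp (- s * complex_of_real (c t))) has_vector_derivative
    of_real c' * (- s * exp (- s * complex_of_real (c t)))) (at t)"
proof -
  have "((\<lambda>w. exp (- s * w)) has_field_derivative - s * exp (- s * complex_of_real (c t))) (at (complex_of_real (c t)))"
    by (auto intro!: derivative_eq_intros)
  from field_vector_diff_chain_at[OF of_real_has_vector_derivative[OF assms] this] show ?thesis
    by (simp add: comp_def)
qed

lemma phase_kernel_tendsto_0:
  assumes c: "phase c" and s: "Re s > 0"
  shows "((\<lambda>t. of_real (c t) ^ n * exp (- s * complex_of_real (c t))) \<longlongrightarrow> 0) at_top"
proof (rule Lim_null_comparison)
  have lim: "filterlim c at_top at_top"
  proof (rule filterlim_at_top_mono)
    show "filterlim (\<lambda>t::real. (1 + t) / 2) at_top at_top"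
      by real_asymp
    show "\<forall>\<^sub>F t in at_top. (1 + t) / 2 \<le> c t"
      using eventually_gt_at_top[of 0] by eventually_elim (use c in \<open>auto simp: phase_def\<close>)
  qed
  have "((\<lambda>x::real. x ^ n * exp (- Re s * x)) \<longlongrightarrow> 0) at_top"
    using s by real_asymp
  then show "((\<lambda>t. c t ^ n * exp (- Re s * c t)) \<longlongrightarrow> 0) at_top"
    by (rule filterlim_compose[OF _ lim])
  show "\<forall>\<^sub>F t in at_top. norm (of_real (c t) ^ n * exp (- s * complex_of_real (c t))) \<le> c t ^ n * exp (- Re s * c t)"
    using eventually_gt_at_top[of 0]
  proof eventually_elim
    case (elim t)
    then have "c t \<ge> 0"
      using c by (force simp: phase_def)
    then show ?case
      by (simp add: norm_mult norm_power)
  qed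
qed

text \<open>
  Since \<open>c \<ge> 1\<close>, the exponent satisfies \<open>x c \<ge> (x - 1) + c\<close> for \<open>x \<ge> 1\<close>, so a factor \<open>exp (- Re \<kappa> (x - 1))\<close> can be
  taken out of the integral.
\<close>

lemma laplace_decay:
  assumes c: "phase c" "\<And>t. t > 0 \<Longrightarrow> c t \<ge> 1" and \<kappa>: "Re \<kappa> > 0"
  obtains M where "\<And>x. x \<ge> 1 \<Longrightarrow> norm (laplace c n (\<kappa> * of_real x)) \<le> M * exp (- Re \<kappa> * x)"
proof -
  have int: "integrable half_line (\<lambda>t. c t ^ n * exp (- Re \<kappa> * c t))"
  proof -
    have "integrable half_line (\<lambda>t. norm (of_real (c t) ^ n * exp (- \<kappa> * of_real (c t))))"
      by (intro integrable_norm laplace_integrable c \<kappa>)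
    moreover have "norm (of_real (c t) ^ n * exp (- \<kappa> * of_real (c t))) = c t ^ n * exp (- Re \<kappa> * c t)" if "t > 0" for t
      using c(2)[OF that] by (simp add: norm_mult norm_power)
    then have "integrable half_line (\<lambda>t. norm (of_real (c t) ^ n * exp (- \<kappa> * of_real (c t))))
        \<longleftrightarrow> integrable half_line (\<lambda>t. c t ^ n * exp (- Re \<kappa> * c t))"
      by (intro Bochner_Integration.integrable_cong refl) simp
    ultimately show ?thesis
      by blast
  qed
  show ?thesis
  proof (rule that)
    fix x :: real assume "x \<ge> 1"
    have "norm (laplace c n (\<kappa> * of_real x))
        \<le> (\<integral>t. exp (- Re \<kappa> * (x - 1)) * (c t ^ n * exp (- Re \<kappa> * c t)) \<partial>half_line)"
      unfolding laplace_def
    proof (rule integral_norm_le)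
      show "integrable half_line (\<lambda>t. exp (- Re \<kappa> * (x - 1)) * (c t ^ n * exp (- Re \<kappa> * c t)))"
        using int by simp
      show "integrable half_line (\<lambda>t. of_real (c t) ^ n * exp (- (\<kappa> * of_real x) * of_real (c t)))"
        using \<kappa> \<open>x \<ge> 1\<close> by (intro laplace_integrable c) auto
      fix t :: real assume "0 < t"
      have ct: "c t \<ge> 1"
        by (rule c(2)[OF \<open>0 < t\<close>])
      have "0 \<le> Re \<kappa> * ((x - 1) * (c t - 1))"
        using ct \<open>x \<ge> 1\<close> \<kappa> by simp
      then have "- (Re \<kappa> * x * c t) \<le> - Re \<kappa> * (x - 1) + - Re \<kappa> * c t"
        by (simp add: algebra_simps)
      then have "exp (- (Re \<kappa> * x * c t)) \<le> exp (- Re \<kappa> * (x - 1)) * exp (- Re \<kappa> * c t)"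
        by (simp add: exp_add[symmetric])
      then have "c t ^ n * exp (- (Re \<kappa> * x * c t)) \<le> c t ^ n * (exp (- Re \<kappa> * (x - 1)) * exp (- Re \<kappa> * c t))"
        using ct by (intro mult_left_mono) auto
      then show "norm (of_real (c t) ^ n * exp (- (\<kappa> * of_real x) * of_real (c t)))
          \<le> exp (- Re \<kappa> * (x - 1)) * (c t ^ n * exp (- Re \<kappa> * c t))"
        using ct by (simp add: norm_mult norm_power mult_ac)
    qed
    also have "\<dots> = exp (- Re \<kappa> * (x - 1)) * (\<integral>t. c t ^ n * exp (- Re \<kappa> * c t) \<partial>half_line)"
      by (rule integral_mult_right_zero)
    also have "exp (- Re \<kappa> * (x - 1)) = exp (Re \<kappa>) * exp (- Re \<kappa> * x)"
      by (simp add: exp_add[symmetric] algebra_simps)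
    also have "exp (Re \<kappa>) * exp (- Re \<kappa> * x) * (\<integral>t. c t ^ n * exp (- Re \<kappa> * c t) \<partial>half_line)
        = (exp (Re \<kappa>) * (\<integral>t. c t ^ n * exp (- Re \<kappa> * c t) \<partial>half_line)) * exp (- Re \<kappa> * x)"
      by (simp only: mult_ac)
    finally show "norm (laplace c n (\<kappa> * of_real x))
        \<le> (exp (Re \<kappa>) * (\<integral>t. c t ^ n * exp (- Re \<kappa> * c t) \<partial>half_line)) * exp (- Re \<kappa> * x)" .
  qed
qed

text \<open>
  The integrand of the left-hand side is the derivative of \<open>- sinh t exp (- s cosh t)\<close>, which vanishes at both ends of
  the half-line.
\<close>

lemma laplace_cosh_ODE:
  assumes s: "Re s > 0"
  shows "s * laplace cosh 2 s - laplace cosh 1 s - s * laplace cosh 0 s = 0"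
proof -
  note int = laplace_integrable[OF phase_cosh s]
  let ?e = "\<lambda>t. exp (- s * complex_of_real (cosh t))"
  let ?g = "\<lambda>t. s * (complex_of_real (cosh t) ^ 2 * ?e t) - complex_of_real (cosh t) ^ 1 * ?e t
      - s * (complex_of_real (cosh t) ^ 0 * ?e t)"
  let ?G = "\<lambda>t. - (complex_of_real (sinh t) * ?e t)"
  have "s * laplace cosh 2 s - laplace cosh 1 s - s * laplace cosh 0 s = (\<integral>t. ?g t \<partial>half_line)"
    unfolding laplace_def using int[of 0] int[of 1] int[of 2] by simp
  also have "\<dots> = 0 - 0"
  proof (rule integral_half_line_FTC)
    show "integrable half_line ?g"
      using int[of 0] int[of 1] int[of 2]
      by (intro Bochner_Integration.integrable_diff integrable_mult_right) auto
    show "(?G has_vector_derivative ?g t) (at t)" for t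
    proof -
      have d: "(?G has_vector_derivative - (complex_of_real (sinh t) * (of_real (sinh t) * (- s * ?e t))
          + complex_of_real (cosh t) * ?e t)) (at t)"
        by (intro has_vector_derivative_minus has_vector_derivative_mult of_real_has_vector_derivative
            exp_phase_has_vector_derivative) (auto intro!: derivative_eq_intros)
      have "- (complex_of_real (sinh t) * (of_real (sinh t) * (- s * ?e t))
          + complex_of_real (cosh t) * ?e t) = s * (of_real ((sinh t)\<^sup>2) * ?e t) - complex_of_real (cosh t) * ?e t"
        by (simp add: power2_eq_square)
      also have "\<dots> = ?g t"
        unfolding sinh_square_eq by (simp add: algebra_simps)
      finally show ?thesis
        using d by (simp only:)
    qed
    have "isCont (\<lambda>t. - (complex_of_real (sinh t) * ?e t)) 0"
      by (intro continuous_intros)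
    then have "(?G \<longlongrightarrow> ?G 0) (at 0)"
      by (simp add: isCont_def)
    then show "(?G \<longlongrightarrow> 0) (at_right 0)"
      by (simp add: filterlim_at_split)
    show "(?G \<longlongrightarrow> 0) at_top"
    proof (rule Lim_null_comparison)
      show "((\<lambda>t. norm (complex_of_real (cosh t) ^ 1 * ?e t)) \<longlongrightarrow> 0) at_top"
        by (rule tendsto_norm_zero[OF phase_kernel_tendsto_0[OF phase_cosh s]])
      have "\<bar>sinh t\<bar> \<le> \<bar>cosh t\<bar>" for t :: real
        unfolding abs_le_square_iff using sinh_square_eq[of t] by simp
      then show "\<forall>\<^sub>F t in at_top. norm (?G t) \<le> norm (complex_of_real (cosh t) ^ 1 * ?e t)"
        by (intro always_eventually allI) (simp add: norm_mult mult_right_mono)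
    qed
  qed
  finally show ?thesis
    by simp
qed

lemma integral_exp_neg: "integrable half_line (\<lambda>t::real. exp (- t))" "(\<integral>t. exp (- t) \<partial>half_line) = 1"
proof -
  show i: "integrable half_line (\<lambda>t::real. exp (- t))"
    by (rule integrable_half_line_bound[OF _ exp_neg_integrable[of 1 1]]) (auto intro!: continuous_intros)
  have "(\<integral>t. complex_of_real (exp (- t)) \<partial>half_line) = 0 - - 1"
  proof (rule integral_half_line_FTC)
    show "complex_integrable half_line (\<lambda>t. complex_of_real (exp (- t)))"
      using i by (rule integrable_of_real)
    show "((\<lambda>t. complex_of_real (- exp (- t))) has_vector_derivative complex_of_real (exp (- x))) (at x)" for x
      by (rule of_real_has_vector_derivative) (auto intro!: derivative_eq_intros)
    have "((\<lambda>t::real. - exp (- t)) \<longlongrightarrow> - 1) (at_right 0)" "((\<lambda>t::real. - exp (- t)) \<longlongrightarrow> 0) at_top"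
      by real_asymp+
    from this[THEN tendsto_of_real]
    show "((\<lambda>t. complex_of_real (- exp (- t))) \<longlongrightarrow> - 1) (at_right 0)"
      "((\<lambda>t. complex_of_real (- exp (- t))) \<longlongrightarrow> 0) at_top"
      by simp_all
  qed
  then have "complex_of_real (\<integral>t. exp (- t) \<partial>half_line) = of_real 1"
    unfolding integral_complex_of_real by simp
  then show "(\<integral>t. exp (- t) \<partial>half_line) = 1"
    by (simp only: of_real_eq_iff)
qed

text \<open>
  The function \<open>x sinh t exp (- x cosh t)\<close> integrates to \<open>exp (- x)\<close>, and \<open>cosh t\<close> differs from \<open>sinh t\<close> only by
  \<open>exp (- t)\<close>, which has integral 1.
\<close>

lemma laplace_cosh_1_near_0:
  assumes "0 < x"
  shows "norm (of_real x * laplace cosh 1 (of_real x) - exp (- of_real x)) \<le> x"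
proof -
  let ?s = "complex_of_real x"
  have s: "Re ?s > 0"
    using assms by simp
  let ?e = "\<lambda>t. exp (- ?s * complex_of_real (cosh t))"
  let ?r = "\<lambda>t. complex_of_real (exp (- t)) * ?e t"
  have le: "norm (?r t) \<le> exp (- t)" for t
  proof -
    have "norm (?e t) \<le> 1"
      using assms cosh_real_ge_1[of t] by simp
    then show ?thesis
      by (simp add: norm_mult mult_left_le)
  qed
  have r: "integrable half_line ?r"
    by (rule integrable_half_line_bound[OF _ exp_neg_integrable[of 1 1]])
       (use le in \<open>auto intro!: continuous_intros\<close>)
  note i1 = laplace_integrable[OF phase_cosh s, of 1]
  have "(\<integral>t. ?s * (complex_of_real (cosh t) ^ 1 * ?e t - ?r t) \<partial>half_line) = 0 - - exp (- ?s)"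
  proof (rule integral_half_line_FTC)
    show "complex_integrable half_line (\<lambda>t. ?s * (complex_of_real (cosh t) ^ 1 * ?e t - ?r t))"
      using i1 r by (intro integrable_mult_right Bochner_Integration.integrable_diff) auto
    show "((\<lambda>t. - ?e t) has_vector_derivative ?s * (complex_of_real (cosh t) ^ 1 * ?e t - ?r t)) (at t)" for t
    proof -
      have "((\<lambda>t. - ?e t) has_vector_derivative - (of_real (sinh t) * (- ?s * ?e t))) (at t)"
        by (intro has_vector_derivative_minus exp_phase_has_vector_derivative) (auto intro!: derivative_eq_intros)
      moreover have "complex_of_real (sinh t) = of_real (cosh t) - of_real (exp (- t))"
        unfolding of_real_diff[symmetric] by (simp add: cosh_minus_sinh[symmetric])
      ultimately show ?thesis
        by (simp add: algebra_simps)
    qed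
    have "isCont (\<lambda>t. - ?e t) 0"
      by (intro continuous_intros)
    then show "((\<lambda>t. - ?e t) \<longlongrightarrow> - exp (- ?s)) (at_right 0)"
      by (simp add: isCont_def filterlim_at_split)
    show "((\<lambda>t. - ?e t) \<longlongrightarrow> 0) at_top"
      using tendsto_minus[OF phase_kernel_tendsto_0[OF phase_cosh s, of 0]] by simp
  qed
  then have "?s * laplace cosh 1 ?s - ?s * (\<integral>t. ?r t \<partial>half_line) = exp (- ?s)"
    unfolding laplace_def using i1 r by (simp add: right_diff_distrib)
  then have "?s * laplace cosh 1 ?s - exp (- ?s) = ?s * (\<integral>t. ?r t \<partial>half_line)"
    by (simp only: diff_eq_eq eq_diff_eq add.commute)
  also have "norm \<dots> \<le> x * 1"
    unfolding norm_mult using assms integral_norm_le[OF integral_exp_neg(1) r le] integral_exp_neg(2)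
    by (intro mult_mono) auto
  finally show ?thesis
    by simp
qed

lemma laplace_exp_1:
  assumes "0 < x"
  shows "laplace exp 1 (of_real x) = of_real (exp (- x) / x)"
proof -
  let ?s = "complex_of_real x"
  have s: "Re ?s > 0"
    using assms by simp
  let ?e = "\<lambda>t. exp (- ?s * complex_of_real (exp t))"
  have "laplace exp 1 ?s = 0 - - (exp (- ?s) / ?s)"
    unfolding laplace_def
  proof (rule integral_half_line_FTC[OF laplace_integrable[OF phase_exp s, of 1]])
    show "((\<lambda>t. - (?e t / ?s)) has_vector_derivative complex_of_real (exp t) ^ 1 * ?e t) (at t)" for t
    proof -
      have "((\<lambda>t. - (?e t / ?s)) has_vector_derivative - (of_real (exp t) * (- ?s * ?e t) / ?s)) (at t)"
        by (intro has_vector_derivative_minus has_vector_derivative_divide exp_phase_has_vector_derivative)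
          (auto intro!: derivative_eq_intros)
      then show ?thesis
        using assms by simp
    qed
    have "isCont (\<lambda>t. - (?e t / ?s)) 0"
      using assms by (intro continuous_intros) auto
    then show "((\<lambda>t. - (?e t / ?s)) \<longlongrightarrow> - (exp (- ?s) / ?s)) (at_right 0)"
      by (simp add: isCont_def filterlim_at_split)
    show "((\<lambda>t. - (?e t / ?s)) \<longlongrightarrow> 0) at_top"
      using tendsto_minus[OF tendsto_divide_zero[OF phase_kernel_tendsto_0[OF phase_exp s, of 0], of ?s]] by simp
  qed
  then show ?thesis
    by (simp add: exp_of_real[symmetric] del: exp_of_real)
qed

text \<open>
  As \<open>x cosh t = (x / 2) exp t + (x / 2) exp (- t)\<close>, the two exponentials differ by at most \<open>(x / 2) exp (- t)\<close>. This
  transfers the logarithmic singularity of the exponential integral to the Macdonald function.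
\<close>

lemma laplace_exp_minus_cosh:
  assumes "0 < x"
  shows "norm (laplace exp 0 (of_real (x / 2)) - laplace cosh 0 (of_real x)) \<le> x / 2"
proof -
  have s: "Re (of_real x) > 0" "Re (of_real (x / 2)) > 0"
    using assms by auto
  note i = laplace_integrable[OF phase_exp s(2), of 0] laplace_integrable[OF phase_cosh s(1), of 0]
  let ?f = "\<lambda>t. exp (- of_real (x / 2) * complex_of_real (exp t)) - exp (- of_real x * complex_of_real (cosh t))"
  have "laplace exp 0 (of_real (x / 2)) - laplace cosh 0 (of_real x) = (\<integral>t. ?f t \<partial>half_line)"
    unfolding laplace_def using i by simp
  also have "norm \<dots> \<le> (\<integral>t. x / 2 * exp (- t) \<partial>half_line)"
  proof (rule integral_norm_le)
    show "integrable half_line (\<lambda>t. x / 2 * exp (- t))"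
      using integral_exp_neg(1) by (rule integrable_mult_right)
    show "integrable half_line ?f"
      using Bochner_Integration.integrable_diff[OF i] by simp
    fix t :: real
    have "?f t = of_real (exp (- (x / 2) * exp t) - exp (- x * cosh t))"
      by (simp add: exp_of_real[symmetric] del: exp_of_real)
    also have "norm \<dots> = \<bar>exp (- (x / 2) * exp t) - exp (- x * cosh t)\<bar>"
      by (rule norm_of_real)
    also have "exp (- x * cosh t) = exp (- (x / 2) * exp t) * exp (- (x / 2 * exp (- t)))"
      unfolding exp_add[symmetric] by (simp add: cosh_field_def field_simps)
    also have "\<bar>exp (- (x / 2) * exp t) - exp (- (x / 2) * exp t) * exp (- (x / 2 * exp (- t)))\<bar>
        = exp (- (x / 2) * exp t) * \<bar>1 - exp (- (x / 2 * exp (- t)))\<bar>"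
    proof -
      have "\<bar>A - A * B\<bar> = A * \<bar>1 - B\<bar>" if "A > 0" for A B :: real
      proof -
        have "A - A * B = A * (1 - B)"
          by (simp add: right_diff_distrib)
        then show ?thesis
          using that by (simp add: abs_mult)
      qed
      then show ?thesis
        by simp
    qed
    also have "\<dots> \<le> 1 * (x / 2 * exp (- t))"
    proof (rule mult_mono)
      show "\<bar>1 - exp (- (x / 2 * exp (- t)))\<bar> \<le> x / 2 * exp (- t)"
        using exp_ge_add_one_self[of "- (x / 2 * exp (- t))"] assms by simp
    qed (use assms in auto)
    finally show "norm (?f t) \<le> x / 2 * exp (- t)"
      by simp
  qed
  also have "\<dots> = x / 2"
    using integral_exp_neg(2) by simp
  finally show ?thesis .
qed

lemma Gamma_integral_half_line:
  assumes "0 < x"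
  shows "integrable half_line (\<lambda>t. t powr (x - 1) * exp (- t))"
    "(\<integral>t. t powr (x - 1) * exp (- t) \<partial>half_line) = Gamma x"
proof -
  have "((\<lambda>t. t powr (x - 1) / exp t) has_integral Gamma x) {0<..}"
    using Gamma_integral_real[OF assms]
    by (subst (asm) has_integral_spike_set_eq[where T = "{0<..}"]) (auto intro: negligible_subset[of "{0}"])
  then have h: "((\<lambda>t. t powr (x - 1) * exp (- t)) has_integral Gamma x) {0<..}"
    by (simp add: exp_minus field_simps)
  then have "(\<lambda>t. t powr (x - 1) * exp (- t)) absolutely_integrable_on {0<..}"
    by (intro nonnegative_absolutely_integrable_1) (auto simp: has_integral_iff)
  then show i: "integrable half_line (\<lambda>t. t powr (x - 1) * exp (- t))"
    by (simp add: absolutely_integrable_lebesgue_on)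
  have "((\<lambda>t. t powr (x - 1) * exp (- t)) has_integral (\<integral>t. t powr (x - 1) * exp (- t) \<partial>half_line)) {0<..}"
    by (rule has_integral_integral_lebesgue_on[OF i]) simp
  then show "(\<integral>t. t powr (x - 1) * exp (- t) \<partial>half_line) = Gamma x"
    using h by (rule has_integral_unique)
qed

lemma ln_exp_integrable: "integrable half_line (\<lambda>t. ln t * exp (- t))"
proof (rule integrable_half_line_bound)
  show "continuous_on {0<..} (\<lambda>t::real. ln t * exp (- t))"
    by (intro continuous_intros) auto
  let ?g = "\<lambda>t::real. t powr (2 - 1) * exp (- t) + 2 * (t powr (1 / 2 - 1) * exp (- t))"
  have "integrable half_line ?g"
    by (intro Bochner_Integration.integrable_add integrable_mult_right Gamma_integral_half_line) auto
  then have "?g absolutely_integrable_on {0<..}"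
    by (simp add: absolutely_integrable_lebesgue_on)
  then show "?g integrable_on {0<..}"
    by (rule absolutely_integrable_on_def[THEN iffD1, THEN conjunct1])
  fix t :: real assume t: "0 < t"
  have "ln t \<le> t"
    using ln_le_minus_one[OF t] by simp
  moreover have "- ln t \<le> 2 * t powr (- 1 / 2)"
  proof -
    have "ln (t powr (- 1 / 2)) \<le> t powr (- 1 / 2)"
      using ln_le_minus_one[of "t powr (- 1 / 2)"] t by simp
    then show ?thesis
      using t by (simp add: ln_powr)
  qed
  moreover have "t powr (- 1 / 2) \<ge> 0"
    by simp
  ultimately have "\<bar>ln t\<bar> \<le> t + 2 * t powr (- 1 / 2)"
    using t by linarith
  then have "\<bar>ln t\<bar> * exp (- t) \<le> (t + 2 * t powr (- 1 / 2)) * exp (- t)"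
    by (intro mult_right_mono) auto
  then show "norm (ln t * exp (- t)) \<le> ?g t"
    using t by (simp add: abs_mult distrib_right)
qed

text \<open>
  The integral is \<open>\<Gamma>'(1)\<close>. Instead of differentiating under the integral sign, integrate the convexity inequality
  \<open>t\<^sup>\<nu> \<ge> 1 + \<nu> ln t\<close>: the affine function with slope \<open>c\<close> lies below \<open>\<Gamma>\<close> and touches it at 1, so
  \<open>c = \<Gamma>'(1) = - \<gamma>\<close>.
\<close>

lemma euler_mascheroni_integral: "(\<integral>t. ln t * exp (- t) \<partial>half_line) = - euler_mascheroni"
proof -
  define c where "c = (\<integral>t. ln t * exp (- t) \<partial>half_line)"
  have "Gamma 1 + \<nu> * c \<le> Gamma (1 + \<nu>)" if "\<bar>\<nu>\<bar> < 1" for \<nu> :: real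
  proof -
    have pos: "1 + \<nu> > 0"
      using that by simp
    have "Gamma 1 + \<nu> * c = (\<integral>t. t powr (1 - 1) * exp (- t) \<partial>half_line) + (\<integral>t. \<nu> * (ln t * exp (- t)) \<partial>half_line)"
      unfolding c_def Gamma_integral_half_line(2)[OF zero_less_one] by simp
    also have "\<dots> = (\<integral>t. t powr (1 - 1) * exp (- t) + \<nu> * (ln t * exp (- t)) \<partial>half_line)"
      by (intro Bochner_Integration.integral_add[symmetric] integrable_mult_right ln_exp_integrable
          Gamma_integral_half_line) simp
    also have "\<dots> \<le> (\<integral>t. t powr (1 + \<nu> - 1) * exp (- t) \<partial>half_line)"
    proof (rule integral_mono)
      show "integrable half_line (\<lambda>t. t powr (1 - 1) * exp (- t) + \<nu> * (ln t * exp (- t)))"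
        by (intro Bochner_Integration.integrable_add integrable_mult_right ln_exp_integrable
          Gamma_integral_half_line) simp
      show "integrable half_line (\<lambda>t. t powr (1 + \<nu> - 1) * exp (- t))"
        by (rule Gamma_integral_half_line[OF pos])
      fix t :: real assume "t \<in> space half_line"
      then have t: "0 < t"
        by simp
      have "1 + \<nu> * ln t \<le> exp (\<nu> * ln t)"
        by (rule exp_ge_add_one_self)
      also have "\<dots> = t powr \<nu>"
        using t by (simp add: powr_def)
      finally have "(1 + \<nu> * ln t) * exp (- t) \<le> t powr \<nu> * exp (- t)"
        by (intro mult_right_mono) auto
      then show "t powr (1 - 1) * exp (- t) + \<nu> * (ln t * exp (- t)) \<le> t powr (1 + \<nu> - 1) * exp (- t)"
        using t by (simp add: distrib_right mult.assoc)
    qed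
    also have "\<dots> = Gamma (1 + \<nu>)"
      by (rule Gamma_integral_half_line[OF pos])
    finally show ?thesis .
  qed
  moreover have "((\<lambda>\<nu>. Gamma (1 + \<nu>) - (Gamma 1 + \<nu> * c)) has_real_derivative - euler_mascheroni - c) (at 0)"
    by (auto intro!: derivative_eq_intros)
  ultimately have "- euler_mascheroni - c = 0"
    by (intro DERIV_local_min[of "\<lambda>\<nu>. Gamma (1 + \<nu>) - (Gamma 1 + \<nu> * c)" _ 0 1]) auto
  then show ?thesis
    by (simp add: c_def)
qed

text \<open>
  Since \<open>laplace exp 1 x = exp (- x) / x\<close>, the function \<open>exp (- x) ln x + laplace exp 0 x\<close> has derivative
  \<open>- ln x exp (- x)\<close>. Its limit at infinity is 0, so its limit at 0 is the integral of \<open>ln x exp (- x)\<close>.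
\<close>

lemma laplace_exp_near_0:
  "(\<lambda>n. laplace exp 0 (of_real (1 / real (Suc n))) + of_real (ln (1 / real (Suc n)))) \<longlonglongrightarrow> - euler_mascheroni"
proof -
  let ?E = "\<lambda>x. laplace exp 0 (of_real x)"
  let ?g = "\<lambda>x. - complex_of_real (ln x * exp (- x))"
  define H where "H x = complex_of_real (exp (- x) * ln x) + ?E x" for x
  have d: "(H has_vector_derivative ?g x) (at x)" if x: "0 < x" for x
  proof -
    have "(?E has_vector_derivative - laplace exp (Suc 0) (of_real x)) (at x)"
      using x by (intro has_vector_derivative_real_field laplace_has_field_derivative phase_exp) simp
    moreover have "((\<lambda>x. complex_of_real (exp (- x) * ln x)) has_vector_derivative
        of_real (- exp (- x) * ln x + exp (- x) / x)) (at x)"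
      using x by (intro of_real_has_vector_derivative) (auto intro!: derivative_eq_intros simp: field_simps)
    ultimately have "(H has_vector_derivative of_real (- exp (- x) * ln x + exp (- x) / x) + - laplace exp (Suc 0) (of_real x)) (at x)"
      unfolding H_def[abs_def] by (intro has_vector_derivative_add)
    then show ?thesis
      using laplace_exp_1[OF x] x by (simp add: mult.commute)
  qed
  have "integral {1 / real (Suc n)..real (Suc n)} ?g = H (real (Suc n)) - H (1 / real (Suc n))" for n
  proof (rule integral_unique, rule fundamental_theorem_of_calculus)
    show "1 / real (Suc n) \<le> real (Suc n)"
      by (simp add: field_simps)
    fix x assume "x \<in> {1 / real (Suc n)..real (Suc n)}"
    then have "0 < x"
      by (auto intro: less_le_trans[rotated])
    then show "(H has_vector_derivative ?g x) (at x within {1 / real (Suc n)..real (Suc n)})"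
      by (rule has_vector_derivative_at_within[OF d])
  qed
  moreover have "(\<lambda>n. integral {1 / real (Suc n)..real (Suc n)} ?g) \<longlonglongrightarrow> (\<integral>x. ?g x \<partial>half_line)"
    by (intro tendsto_integral_half_line Bochner_Integration.integrable_minus integrable_of_real ln_exp_integrable)
  moreover have "(\<integral>x. ?g x \<partial>half_line) = euler_mascheroni"
    by (simp add: integral_complex_of_real euler_mascheroni_integral del: of_real_mult)
  ultimately have "(\<lambda>n. H (real (Suc n)) - H (1 / real (Suc n))) \<longlonglongrightarrow> euler_mascheroni"
    by simp
  moreover have "(\<lambda>n. H (real (Suc n))) \<longlonglongrightarrow> 0"
  proof (rule filterlim_compose[OF _ seq_at_top])
    obtain M where M: "\<And>x. x \<ge> 1 \<Longrightarrow> norm (laplace exp 0 (1 * of_real x)) \<le> M * exp (- Re 1 * x)"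
      using laplace_decay[OF phase_exp, of 1 0] by auto
    have "(?E \<longlongrightarrow> 0) at_top"
    proof (rule Lim_null_comparison)
      show "\<forall>\<^sub>F x in at_top. norm (?E x) \<le> M * exp (- x)"
        using eventually_ge_at_top[of 1] by eventually_elim (use M in simp)
      show "((\<lambda>x. M * exp (- x)) \<longlongrightarrow> 0) at_top"
        by real_asymp
    qed
    moreover have "((\<lambda>x::real. exp (- x) * ln x) \<longlongrightarrow> 0) at_top"
      by real_asymp
    from tendsto_of_real[OF this] have "((\<lambda>x. complex_of_real (exp (- x) * ln x)) \<longlongrightarrow> 0) at_top"
      by simp
    ultimately show "(H \<longlongrightarrow> 0) at_top"
      unfolding H_def[abs_def] by (auto intro: tendsto_add_zero)
  qed
  ultimately have "(\<lambda>n. H (real (Suc n)) - (H (real (Suc n)) - H (1 / real (Suc n)))) \<longlonglongrightarrow> 0 - euler_mascheroni"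
    by (intro tendsto_diff)
  moreover have "(\<lambda>n. complex_of_real ((1 - exp (- (1 / real (Suc n)))) * ln (1 / real (Suc n)))) \<longlonglongrightarrow> 0"
  proof -
    have "((\<lambda>x::real. (1 - exp (- x)) * ln x) \<longlongrightarrow> 0) (at_right 0)"
      by real_asymp
    from tendsto_of_real[OF filterlim_compose[OF this seq_at_right_0]] show ?thesis
      by simp
  qed
  ultimately have "(\<lambda>n. H (1 / real (Suc n)) + complex_of_real ((1 - exp (- (1 / real (Suc n)))) * ln (1 / real (Suc n)))) \<longlonglongrightarrow> - euler_mascheroni + 0"
    by (intro tendsto_add) simp_all
  moreover have "H x + complex_of_real ((1 - exp (- x)) * ln x) = ?E x + of_real (ln x)" for x
    by (simp add: H_def algebra_simps)
  ultimately show ?thesis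
    by simp
qed

lemma laplace_cosh_near_0:
  "(\<lambda>n. laplace cosh 0 (of_real (2 / real (Suc n))) + of_real (ln (1 / real (Suc n)))) \<longlonglongrightarrow> - euler_mascheroni"
proof -
  let ?d = "\<lambda>n. laplace exp 0 (of_real (1 / real (Suc n))) - laplace cosh 0 (of_real (2 / real (Suc n)))"
  have "?d \<longlonglongrightarrow> 0"
  proof (rule Lim_null_comparison)
    show "\<forall>\<^sub>F n in sequentially. norm (?d n) \<le> 1 / real (Suc n)"
    proof (intro always_eventually allI)
      fix n
      have "0 < 2 / real (Suc n)" and eq: "2 / real (Suc n) / 2 = 1 / real (Suc n)"
        by (simp_all del: of_nat_Suc)
      from laplace_exp_minus_cosh[OF this(1)] show "norm (?d n) \<le> 1 / real (Suc n)"
        unfolding eq .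
    qed
    show "(\<lambda>n. 1 / real (Suc n)) \<longlonglongrightarrow> 0"
      using seq_at_right_0 by (simp add: filterlim_at)
  qed
  from tendsto_diff[OF laplace_exp_near_0 this] show ?thesis
    by (simp add: add.commute)
qed

section \<open>The modified Bessel functions of order zero\<close>

definition pow_series :: "(nat \<Rightarrow> complex) \<Rightarrow> complex \<Rightarrow> complex" where
  "pow_series c u = (\<Sum>n. c n * u ^ n)"

definition entire_coeffs :: "(nat \<Rightarrow> complex) \<Rightarrow> bool" where
  "entire_coeffs c \<longleftrightarrow> (\<forall>u. summable (\<lambda>n. c n * u ^ n))"

lemma pow_series_has_field_derivative:
  "entire_coeffs c \<Longrightarrow> (pow_series c has_field_derivative pow_series (diffs c) u) (at u)"
  unfolding entire_coeffs_def pow_series_def[abs_def]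
  by (intro termdiffs_strong_converges_everywhere) auto

lemma entire_coeffs_diffs: "entire_coeffs c \<Longrightarrow> entire_coeffs (diffs c)"
  unfolding entire_coeffs_def by (intro allI termdiff_converges_all) auto

lemma pow_series_0: "pow_series c 0 = c 0"
  unfolding pow_series_def using powser_zero[of c] by simp

lemma pow_series_isCont: "entire_coeffs c \<Longrightarrow> isCont (pow_series c) u"
  by (rule DERIV_isCont[OF pow_series_has_field_derivative])

text \<open>
  The operator \<open>u d\<^sup>2/du\<^sup>2 + d/du\<close> multiplies \<open>u\<^sup>n\<close> by \<open>n\<^sup>2\<close> and lowers the exponent by one. It is the
  modified Bessel operator \<open>d\<^sup>2/ds\<^sup>2 + (1/s) d/ds\<close> in the variable \<open>u = s\<^sup>2 / 4\<close>.
\<close>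

lemma pow_series_euler:
  assumes "entire_coeffs c"
  shows "u * pow_series (diffs (diffs c)) u + pow_series (diffs c) u
    = pow_series (\<lambda>n. (of_nat (Suc n))\<^sup>2 * c (Suc n)) u"
proof -
  let ?f = "\<lambda>n. of_nat n * diffs c n"
  have f: "summable (\<lambda>n. ?f n * u ^ n)"
  proof -
    have "summable (\<lambda>n. diffs (diffs c) n * u ^ n)"
      using entire_coeffs_diffs[OF entire_coeffs_diffs[OF assms]] by (simp add: entire_coeffs_def)
    then have "summable (\<lambda>n. (diffs (diffs c) n * u ^ n) * u)"
      by (rule summable_mult2)
    moreover have "(\<lambda>n. (diffs (diffs c) n * u ^ n) * u) = (\<lambda>n. ?f (Suc n) * u ^ Suc n)"
      by (simp add: diffs_def[of "diffs c"] mult_ac)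
    ultimately have "summable (\<lambda>n. ?f (Suc n) * u ^ Suc n)"
      by (simp only:)
    then show ?thesis
      by (rule summable_Suc_iff[THEN iffD1])
  qed
  have d: "summable (\<lambda>n. diffs c n * u ^ n)"
    using entire_coeffs_diffs[OF assms] by (simp add: entire_coeffs_def)
  have "u * pow_series (diffs (diffs c)) u = (\<Sum>n. ?f (Suc n) * u ^ n) * u"
    by (simp add: pow_series_def diffs_def[of "diffs c"])
  also have "\<dots> = (\<Sum>n. ?f n * u ^ n)"
    using powser_split_head(2)[OF f] by simp
  finally have "u * pow_series (diffs (diffs c)) u + pow_series (diffs c) u
      = (\<Sum>n. ?f n * u ^ n + diffs c n * u ^ n)"
    using suminf_add[OF f d] by (simp add: pow_series_def)
  also have "\<dots> = pow_series (\<lambda>n. (of_nat (Suc n))\<^sup>2 * c (Suc n)) u"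
    unfolding pow_series_def
    by (intro arg_cong[where f = suminf] ext) (simp add: diffs_def power2_eq_square algebra_simps)
  finally show ?thesis .
qed

text \<open>
  In the variable \<open>u = s\<^sup>2 / 4\<close>, these are the coefficients of \<open>I\<^sub>0\<close> and of the logarithm-free part of \<open>K\<^sub>0\<close>.
\<close>

definition I0_coeff :: "nat \<Rightarrow> complex" where
  "I0_coeff n = 1 / (fact n)\<^sup>2"

definition K0_coeff :: "nat \<Rightarrow> complex" where
  "K0_coeff n = harm n / (fact n)\<^sup>2"

lemma entire_coeffs_I:
  assumes "\<And>n. norm (c n) \<le> 1 / fact n"
  shows "entire_coeffs c"
  unfolding entire_coeffs_def
proof
  fix u :: complex
  have "summable (\<lambda>n. inverse (fact n) * norm u ^ n)"
    by (rule summable_exp)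
  then show "summable (\<lambda>n. c n * u ^ n)"
  proof (rule summable_comparison_test'[where N = 0])
    fix n
    have "norm (c n) * norm u ^ n \<le> 1 / fact n * norm u ^ n"
      by (intro mult_right_mono assms) auto
    then show "norm (c n * u ^ n) \<le> inverse (fact n) * norm u ^ n"
      by (simp add: norm_mult norm_power field_simps)
  qed
qed

lemma entire_I0: "entire_coeffs I0_coeff"
proof (rule entire_coeffs_I)
  fix n
  have "1 / (fact n)\<^sup>2 \<le> 1 / (fact n :: real)"
    by (intro divide_left_mono) (auto simp: power2_eq_square fact_ge_1)
  then show "norm (I0_coeff n) \<le> 1 / fact n"
    by (simp add: I0_coeff_def norm_divide norm_power)
qed

lemma harm_le_fact: "harm n \<le> (fact n :: real)"
proof (induction n)
  case (Suc n)
  show ?case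
  proof (cases "n = 0")
    case False
    then have "1 \<le> real n * fact n"
      using mult_mono[of 1 "real n" 1 "fact n"] fact_ge_1[of n] by simp
    moreover have "inverse (real (Suc n)) \<le> 1"
      by (simp add: field_simps)
    ultimately show ?thesis
      using Suc by (simp add: harm_Suc algebra_simps)
  qed (simp add: harm_def)
qed (simp add: harm_def)

lemma entire_K0: "entire_coeffs K0_coeff"
proof (rule entire_coeffs_I)
  fix n
  have "harm n / (fact n)\<^sup>2 \<le> (fact n :: real) / (fact n)\<^sup>2"
    by (intro divide_right_mono harm_le_fact) auto
  also have "\<dots> = 1 / fact n"
    by (simp add: power2_eq_square)
  finally have "harm n / (fact n)\<^sup>2 \<le> 1 / (fact n :: real)" .
  moreover have "norm (K0_coeff n) = harm n / (fact n)\<^sup>2"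
    unfolding K0_coeff_def norm_divide norm_power of_real_harm[symmetric, where 'a = complex] norm_of_real
    by (simp add: harm_nonneg)
  ultimately show "norm (K0_coeff n) \<le> 1 / fact n"
    by simp
qed

lemma I0_euler:
  "u * pow_series (diffs (diffs I0_coeff)) u + pow_series (diffs I0_coeff) u = pow_series I0_coeff u"
proof -
  have "(of_nat (Suc n))\<^sup>2 * I0_coeff (Suc n) = I0_coeff n" for n
    by (simp add: I0_coeff_def power_mult_distrib del: of_nat_Suc)
  then show ?thesis
    unfolding pow_series_euler[OF entire_I0] by simp
qed

text \<open>
  The recursion \<open>harm (n + 1) = harm n + 1 / (n + 1)\<close> leaves the derivative of the series of \<open>I\<^sub>0\<close> as an inhomogeneous
  term. In \<open>K\<^sub>0\<close> it cancels against the term in which the logarithm is differentiated once.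
\<close>

lemma K0_euler:
  "u * pow_series (diffs (diffs K0_coeff)) u + pow_series (diffs K0_coeff) u
    = pow_series K0_coeff u + pow_series (diffs I0_coeff) u"
proof -
  have "(of_nat (Suc n))\<^sup>2 * K0_coeff (Suc n) = K0_coeff n + diffs I0_coeff n" for n
  proof -
    have "(of_nat (Suc n))\<^sup>2 * K0_coeff (Suc n) = (harm n + inverse (of_nat (Suc n))) / (fact n)\<^sup>2"
      by (simp add: K0_coeff_def power_mult_distrib harm_Suc del: of_nat_Suc)
    moreover have "diffs I0_coeff n = inverse (of_nat (Suc n)) / (fact n)\<^sup>2"
      by (simp add: diffs_def I0_coeff_def power_mult_distrib power2_eq_square[of "of_nat (Suc n) :: complex"]
          divide_inverse del: of_nat_Suc)
    ultimately show ?thesis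
      by (simp add: K0_coeff_def add_divide_distrib)
  qed
  then have "pow_series (\<lambda>n. (of_nat (Suc n))\<^sup>2 * K0_coeff (Suc n)) u
      = (\<Sum>n. K0_coeff n * u ^ n + diffs I0_coeff n * u ^ n)"
    by (simp add: pow_series_def distrib_right)
  also have "\<dots> = pow_series K0_coeff u + pow_series (diffs I0_coeff) u"
    unfolding pow_series_def using entire_K0 entire_coeffs_diffs[OF entire_I0]
    by (intro suminf_add[symmetric]) (auto simp: entire_coeffs_def)
  finally show ?thesis
    unfolding pow_series_euler[OF entire_K0] .
qed

text \<open>
  The equation \<open>f'' + f' / s = f\<close> as a first-order system for \<open>f\<close> and its derivative.
\<close>

definition modified_bessel :: "(complex \<Rightarrow> complex) \<Rightarrow> (complex \<Rightarrow> complex) \<Rightarrow> bool" where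
  "modified_bessel f f' \<longleftrightarrow> (\<forall>s. 0 < Re s \<longrightarrow> (f has_field_derivative f' s) (at s) \<and>
     (f' has_field_derivative (f s - f' s / s)) (at s))"

definition bessel_I :: "complex \<Rightarrow> complex" where
  "bessel_I s = pow_series I0_coeff (s\<^sup>2 / 4)"

definition bessel_I' :: "complex \<Rightarrow> complex" where
  "bessel_I' s = s / 2 * pow_series (diffs I0_coeff) (s\<^sup>2 / 4)"

definition bessel_K :: "complex \<Rightarrow> complex" where
  "bessel_K s = pow_series K0_coeff (s\<^sup>2 / 4) - (Ln (s / 2) + euler_mascheroni) * pow_series I0_coeff (s\<^sup>2 / 4)"

definition bessel_K' :: "complex \<Rightarrow> complex" where
  "bessel_K' s = s / 2 * pow_series (diffs K0_coeff) (s\<^sup>2 / 4)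
     - (Ln (s / 2) + euler_mascheroni) * (s / 2 * pow_series (diffs I0_coeff) (s\<^sup>2 / 4))
     - pow_series I0_coeff (s\<^sup>2 / 4) / s"

lemma pow_series_square_derivative:
  assumes "entire_coeffs c"
  shows "((\<lambda>s. pow_series c (s\<^sup>2 / 4)) has_field_derivative s / 2 * pow_series (diffs c) (s\<^sup>2 / 4)) (at s)"
proof -
  have "((\<lambda>s. s\<^sup>2 / 4) has_field_derivative s / 2) (at s)"
    by (auto intro!: derivative_eq_intros)
  from DERIV_chain2[OF pow_series_has_field_derivative[OF assms] this] show ?thesis
    by (simp add: mult.commute)
qed

lemma modified_bessel_I: "modified_bessel bessel_I bessel_I'"
  unfolding modified_bessel_def
proof (intro allI impI conjI)
  fix s :: complex assume "0 < Re s"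
  then have "s \<noteq> 0"
    by auto
  let ?P = "\<lambda>s. pow_series I0_coeff (s\<^sup>2 / 4)" and ?P1 = "\<lambda>s. pow_series (diffs I0_coeff) (s\<^sup>2 / 4)"
    and ?P2 = "\<lambda>s. pow_series (diffs (diffs I0_coeff)) (s\<^sup>2 / 4)"
  note d = pow_series_square_derivative[OF entire_I0] pow_series_square_derivative[OF entire_coeffs_diffs[OF entire_I0]]
  show "(bessel_I has_field_derivative bessel_I' s) (at s)"
    unfolding bessel_I_def[abs_def] bessel_I'_def by (rule d)
  have "(bessel_I' has_field_derivative s / 2 * (s / 2 * ?P2 s) + 1 / 2 * ?P1 s) (at s)"
    unfolding bessel_I'_def[abs_def] by (rule derivative_eq_intros d refl | simp)+
  moreover have "s / 2 * (s / 2 * ?P2 s) + 1 / 2 * ?P1 s = bessel_I s - bessel_I' s / s"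
    using I0_euler[of "s\<^sup>2 / 4"] \<open>s \<noteq> 0\<close>
    by (simp add: bessel_I_def bessel_I'_def power2_eq_square algebra_simps)
  ultimately show "(bessel_I' has_field_derivative bessel_I s - bessel_I' s / s) (at s)"
    by simp
qed

lemma modified_bessel_K: "modified_bessel bessel_K bessel_K'"
  unfolding modified_bessel_def
proof (intro allI impI conjI)
  fix s :: complex assume "0 < Re s"
  then have s: "s \<noteq> 0" "s \<notin> \<real>\<^sub>\<le>\<^sub>0" "s / 2 \<notin> \<real>\<^sub>\<le>\<^sub>0"
    by (auto simp: complex_nonpos_Reals_iff)
  define A where "A j = pow_series ((diffs ^^ j) I0_coeff)" for j
  define B where "B j = pow_series ((diffs ^^ j) K0_coeff)" for j
  have ent: "entire_coeffs ((diffs ^^ j) I0_coeff)" "entire_coeffs ((diffs ^^ j) K0_coeff)" for j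
    by (induction j) (auto intro: entire_I0 entire_K0 entire_coeffs_diffs)
  have dA: "((\<lambda>s. A j (s\<^sup>2 / 4)) has_field_derivative s / 2 * A (Suc j) (s\<^sup>2 / 4)) (at s)" for j
    using pow_series_square_derivative[OF ent(1)] by (simp add: A_def)
  have dB: "((\<lambda>s. B j (s\<^sup>2 / 4)) has_field_derivative s / 2 * B (Suc j) (s\<^sup>2 / 4)) (at s)" for j
    using pow_series_square_derivative[OF ent(2)] by (simp add: B_def)
  have K: "bessel_K = (\<lambda>s. B 0 (s\<^sup>2 / 4) - (Ln (s / 2) + euler_mascheroni) * A 0 (s\<^sup>2 / 4))"
    by (simp add: bessel_K_def[abs_def] A_def B_def)
  have K': "bessel_K' = (\<lambda>s. s / 2 * B 1 (s\<^sup>2 / 4) - (Ln (s / 2) + euler_mascheroni) * (s / 2 * A 1 (s\<^sup>2 / 4))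
      - A 0 (s\<^sup>2 / 4) / s)"
    by (simp add: bessel_K'_def[abs_def] A_def B_def)
  have dL: "((\<lambda>s. Ln (s / 2)) has_field_derivative 1 / s) (at s)"
    using s by (auto intro!: derivative_eq_intros simp: field_simps)
  define l a0 a1 a2 b0 b1 b2 where "l = Ln (s / 2) + euler_mascheroni"
    and "a0 = A 0 (s\<^sup>2 / 4)" and "a1 = A 1 (s\<^sup>2 / 4)" and "a2 = A 2 (s\<^sup>2 / 4)"
    and "b0 = B 0 (s\<^sup>2 / 4)" and "b1 = B 1 (s\<^sup>2 / 4)" and "b2 = B 2 (s\<^sup>2 / 4)"
  have eA: "s\<^sup>2 / 4 * a2 + a1 = a0"
    using I0_euler[of "s\<^sup>2 / 4"] by (simp add: a0_def a1_def a2_def A_def numeral_2_eq_2)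
  have eB: "s\<^sup>2 / 4 * b2 + b1 = b0 + a1"
    using K0_euler[of "s\<^sup>2 / 4"] by (simp add: b0_def b1_def b2_def a1_def A_def B_def numeral_2_eq_2)
  have "(bessel_K has_field_derivative s / 2 * b1 - (l * (s / 2 * a1) + 1 / s * a0)) (at s)"
    unfolding K l_def a0_def a1_def b1_def
    by (rule derivative_eq_intros dA dB dL refl | simp)+
  moreover have "s / 2 * b1 - (l * (s / 2 * a1) + 1 / s * a0) = bessel_K' s"
    unfolding K' l_def a0_def a1_def b1_def by simp
  ultimately show "(bessel_K has_field_derivative bessel_K' s) (at s)"
    by simp
  have d: "(bessel_K' has_field_derivative (s / 2 * (s / 2 * b2) + 1 / 2 * b1)
      - (l * (s / 2 * (s / 2 * a2) + 1 / 2 * a1) + 1 / s * (s / 2 * a1)) - (s / 2 * a1 * s - a0 * 1) / (s * s)) (at s)"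
    unfolding K' l_def a0_def a1_def a2_def b1_def b2_def
    using s dA[of 0] dA[of 1] dB[of 1] dL
    by (intro DERIV_diff DERIV_divide DERIV_mult' DERIV_add DERIV_ident)
       (auto simp: numeral_2_eq_2 intro!: derivative_eq_intros)
  have "(s / 2 * (s / 2 * b2) + 1 / 2 * b1)
      - (l * (s / 2 * (s / 2 * a2) + 1 / 2 * a1) + 1 / s * (s / 2 * a1)) - (s / 2 * a1 * s - a0 * 1) / (s * s)
      = (s\<^sup>2 / 4 * b2 + b1) - b1 / 2 - l * ((s\<^sup>2 / 4 * a2 + a1) - a1 / 2) - a1 + a0 / s\<^sup>2"
    using s by (simp add: field_simps power2_eq_square)
  also have "\<dots> = bessel_K s - bessel_K' s / s"
    unfolding eA eB K K' l_def[symmetric] a0_def[symmetric] a1_def[symmetric] b0_def[symmetric] b1_def[symmetric]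
    using s by (simp add: field_simps power2_eq_square)
  finally show "(bessel_K' has_field_derivative bessel_K s - bessel_K' s / s) (at s)"
    using d by (simp only:)
qed

lemma modified_bessel_laplace: "modified_bessel (laplace cosh 0) (\<lambda>s. - laplace cosh 1 s)"
  unfolding modified_bessel_def
proof (intro allI impI conjI)
  fix s assume s: "0 < Re s"
  then have "s \<noteq> 0"
    by auto
  show "(laplace cosh 0 has_field_derivative - laplace cosh 1 s) (at s)"
    using laplace_has_field_derivative[OF phase_cosh s, of 0] by simp
  have "((\<lambda>s. - laplace cosh 1 s) has_field_derivative laplace cosh 2 s) (at s)"
    using DERIV_minus[OF laplace_has_field_derivative[OF phase_cosh s, of 1]] by (simp add: numeral_2_eq_2)
  moreover have "laplace cosh 2 s = laplace cosh 0 s - - laplace cosh 1 s / s"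
  proof -
    have "s * laplace cosh 2 s = s * (laplace cosh 0 s - - laplace cosh 1 s / s)"
      using laplace_cosh_ODE[OF s] \<open>s \<noteq> 0\<close> by (simp add: distrib_left algebra_simps)
    then show ?thesis
      using \<open>s \<noteq> 0\<close> by simp
  qed
  ultimately show "((\<lambda>s. - laplace cosh 1 s) has_field_derivative laplace cosh 0 s - - laplace cosh 1 s / s) (at s)"
    by simp
qed

text \<open>
  The factor \<open>s\<close> compensates the first-order term of the equation, by Abel's identity.
\<close>

lemma modified_bessel_Wronskian:
  assumes f: "modified_bessel f f'" and g: "modified_bessel g g'"
  shows "\<exists>C. \<forall>s. 0 < Re s \<longrightarrow> s * (f s * g' s - f' s * g s) = C"
proof -
  have "\<exists>C. \<forall>s\<in>{s. 0 < Re s}. s * (f s * g' s - f' s * g s) = C"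
  proof (rule has_field_derivative_zero_constant)
    show "convex {s. 0 < Re s}"
      by (rule convex_halfspace_Re_gt)
    fix s :: complex assume "s \<in> {s. 0 < Re s}"
    then have s: "0 < Re s" "s \<noteq> 0"
      by auto
    have d: "(f has_field_derivative f' s) (at s)" "(f' has_field_derivative f s - f' s / s) (at s)"
      "(g has_field_derivative g' s) (at s)" "(g' has_field_derivative g s - g' s / s) (at s)"
      using f g s by (auto simp: modified_bessel_def)
    have "((\<lambda>s. s * (f s * g' s - f' s * g s)) has_field_derivative
        s * ((f s * (g s - g' s / s) + f' s * g' s) - (f' s * g' s + (f s - f' s / s) * g s))
        + 1 * (f s * g' s - f' s * g s)) (at s)"
      by (intro DERIV_mult' DERIV_diff DERIV_ident d)
    moreover have "s * ((f s * (g s - g' s / s) + f' s * g' s) - (f' s * g' s + (f s - f' s / s) * g s))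
        + 1 * (f s * g' s - f' s * g s) = 0"
      using s(2) by (simp add: field_simps)
    ultimately show "((\<lambda>s. s * (f s * g' s - f' s * g s)) has_field_derivative 0) (at s within {s. 0 < Re s})"
      by (simp add: has_field_derivative_at_within)
  qed
  then show ?thesis
    by simp
qed

lemma pow_series_near_0:
  assumes "entire_coeffs c"
  shows "((\<lambda>x. pow_series c ((\<kappa> * complex_of_real x)\<^sup>2 / 4)) \<longlongrightarrow> c 0) (at_right 0)"
proof -
  have "isCont (\<lambda>x. pow_series c ((\<kappa> * complex_of_real x)\<^sup>2 / 4)) 0"
    by (intro isCont_o2[OF _ pow_series_isCont[OF assms]] continuous_intros) simp
  then show ?thesis
    by (simp add: isCont_def filterlim_at_split pow_series_0)
qed

lemma pow_series_shift:
  assumes "entire_coeffs c"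
  shows "entire_coeffs (\<lambda>n. c (Suc n))" "pow_series c u - c 0 = pow_series (\<lambda>n. c (Suc n)) u * u"
proof -
  have s: "summable (\<lambda>n. c n * u ^ n)" for u
    using assms by (simp add: entire_coeffs_def)
  show "entire_coeffs (\<lambda>n. c (Suc n))"
    unfolding entire_coeffs_def using powser_split_head(3)[OF s] by simp
  show "pow_series c u - c 0 = pow_series (\<lambda>n. c (Suc n)) u * u"
    unfolding pow_series_def using powser_split_head(2)[OF s] by simp
qed

lemma x2_ln_tendsto: "((\<lambda>x. complex_of_real (x\<^sup>2 * ln x ^ k)) \<longlongrightarrow> 0) (at_right 0)" if "k \<in> {0, 1, 2}"
proof -
  have "((\<lambda>x::real. x\<^sup>2 * ln x ^ k) \<longlongrightarrow> 0) (at_right 0)"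
    using that by (elim insertE) (simp_all, real_asymp+)
  from tendsto_of_real[OF this] show ?thesis
    by simp
qed

text \<open>
  The remainder terms at 0 contain at most the second power of the logarithm; the factor \<open>x\<^sup>2\<close> suppresses them.
\<close>

lemma ln_pow_series_near_0:
  assumes "entire_coeffs c" and "k \<in> {0, 1, 2}"
  shows "((\<lambda>x. of_real (ln x) ^ k * ((\<kappa> * complex_of_real x)\<^sup>2 * pow_series c ((\<kappa> * complex_of_real x)\<^sup>2 / 4))) \<longlongrightarrow> 0) (at_right 0)"
proof -
  have "((\<lambda>x. complex_of_real (x\<^sup>2 * ln x ^ k) * (\<kappa>\<^sup>2 * pow_series c ((\<kappa> * complex_of_real x)\<^sup>2 / 4))) \<longlongrightarrow> 0 * (\<kappa>\<^sup>2 * c 0)) (at_right 0)"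
    by (intro tendsto_intros x2_ln_tendsto pow_series_near_0 assms)
  then show ?thesis
    by (simp add: power_mult_distrib mult_ac)
qed

lemma bessel_I_ray:
  "((\<lambda>x. bessel_I (\<kappa> * of_real x)) \<longlongrightarrow> 1) (at_right 0)"
  "((\<lambda>x. \<kappa> * of_real x * bessel_I' (\<kappa> * of_real x)) \<longlongrightarrow> 0) (at_right 0)"
  "((\<lambda>x. of_real (ln x) * (\<kappa> * of_real x * bessel_I' (\<kappa> * of_real x)) - bessel_I (\<kappa> * of_real x))
     \<longlongrightarrow> - 1) (at_right 0)"
proof -
  show 1: "((\<lambda>x. bessel_I (\<kappa> * of_real x)) \<longlongrightarrow> 1) (at_right 0)"
    unfolding bessel_I_def using pow_series_near_0[OF entire_I0] by (simp add: I0_coeff_def)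
  have small: "((\<lambda>x. 1 / 2 * (of_real (ln x) ^ k * ((\<kappa> * of_real x)\<^sup>2 * pow_series (diffs I0_coeff) ((\<kappa> * of_real x)\<^sup>2 / 4)))) \<longlongrightarrow> 1 / 2 * 0) (at_right 0)"
    if "k \<in> {0, 1, 2}" for k
    by (intro tendsto_intros ln_pow_series_near_0 entire_coeffs_diffs entire_I0 that)
  have eq: "1 / 2 * (of_real (ln x) ^ k * ((\<kappa> * of_real x)\<^sup>2 * pow_series (diffs I0_coeff) ((\<kappa> * of_real x)\<^sup>2 / 4)))
      = of_real (ln x) ^ k * (\<kappa> * of_real x * bessel_I' (\<kappa> * of_real x))" for x k
    by (simp add: bessel_I'_def power2_eq_square)
  show "((\<lambda>x. \<kappa> * of_real x * bessel_I' (\<kappa> * of_real x)) \<longlongrightarrow> 0) (at_right 0)"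
    using small[of 0] unfolding eq by simp
  show "((\<lambda>x. of_real (ln x) * (\<kappa> * of_real x * bessel_I' (\<kappa> * of_real x)) - bessel_I (\<kappa> * of_real x))
     \<longlongrightarrow> - 1) (at_right 0)"
    using tendsto_diff[OF small[of 1] 1] unfolding eq by simp
qed

context
  fixes \<kappa> :: complex
  assumes \<kappa>: "Re \<kappa> > 0"
begin

lemma Ln_ray: "0 < x \<Longrightarrow> Ln (\<kappa> * of_real x / 2) = of_real (ln x) + Ln (\<kappa> / 2)"
  using Ln_times_of_real[of x "\<kappa> / 2"] Ln_of_real[of x] \<kappa> by (cases "\<kappa> = 0") (auto simp: mult_ac)

text \<open>
  The three limits are those that enter the boundary values at 0 of \<open>\<surd>x K(\<kappa> x)\<close>. In the third one the leading
  logarithms of the two terms cancel.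
\<close>

lemma bessel_K_near_0:
  "((\<lambda>x. bessel_K (\<kappa> * of_real x) + of_real (ln x)) \<longlongrightarrow> - (Ln (\<kappa> / 2) + euler_mascheroni)) (at_right 0)"
  "((\<lambda>x. \<kappa> * of_real x * bessel_K' (\<kappa> * of_real x)) \<longlongrightarrow> - 1) (at_right 0)"
  "((\<lambda>x. of_real (ln x) * (\<kappa> * of_real x * bessel_K' (\<kappa> * of_real x)) - bessel_K (\<kappa> * of_real x))
     \<longlongrightarrow> Ln (\<kappa> / 2) + euler_mascheroni) (at_right 0)"
proof -
  define L where "L = Ln (\<kappa> / 2) + euler_mascheroni"
  define u where "u x = (\<kappa> * complex_of_real x)\<^sup>2" for x
  define l where "l x = complex_of_real (ln x)" for x
  let ?P = "\<lambda>x. pow_series I0_coeff (u x / 4)" and ?P1 = "\<lambda>x. pow_series (diffs I0_coeff) (u x / 4)"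
  let ?Q = "\<lambda>x. pow_series K0_coeff (u x / 4)" and ?Q1 = "\<lambda>x. pow_series (diffs K0_coeff) (u x / 4)"
  let ?R = "\<lambda>x. pow_series (\<lambda>n. I0_coeff (Suc n)) (u x / 4)"
  have K: "bessel_K (\<kappa> * of_real x) = ?Q x - (L + l x) * ?P x" if "x > 0" for x
    using Ln_ray[OF that] by (simp add: bessel_K_def L_def l_def u_def algebra_simps)
  have K': "\<kappa> * of_real x * bessel_K' (\<kappa> * of_real x)
      = 1 / 2 * (u x * ?Q1 x) - (L + l x) * (1 / 2 * (u x * ?P1 x)) - ?P x" if "x > 0" for x
  proof -
    have "\<kappa> * of_real x \<noteq> 0"
      using that \<kappa> by auto
    then have "s * (s / 2 * q - la * (s / 2 * p1) - p / s) = 1 / 2 * (s\<^sup>2 * q) - la * (1 / 2 * (s\<^sup>2 * p1)) - p"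
      if "s = \<kappa> * of_real x" for s q la p1 p
      using that by (simp add: field_simps power2_eq_square)
    from this[OF refl] show ?thesis
      unfolding bessel_K'_def u_def Ln_ray[OF that] L_def l_def
      by (simp only: add.assoc add.commute add.left_commute)
  qed
  have P: "(?P \<longlongrightarrow> 1) (at_right 0)" and Q: "(?Q \<longlongrightarrow> 0) (at_right 0)"
    using pow_series_near_0[OF entire_I0] pow_series_near_0[OF entire_K0]
    by (simp_all add: u_def I0_coeff_def K0_coeff_def harm_def)
  have small: "((\<lambda>x. l x ^ k * (u x * pow_series c (u x / 4))) \<longlongrightarrow> 0) (at_right 0)"
    if "entire_coeffs c" "k \<in> {0, 1, 2}" for c k
    unfolding l_def u_def by (rule ln_pow_series_near_0[OF that])
  note ent = entire_I0 entire_K0 entire_coeffs_diffs[OF entire_I0] entire_coeffs_diffs[OF entire_K0]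
    pow_series_shift(1)[OF entire_I0]
  \<comment> \<open>\<open>I\<^sub>0 - 1\<close> is of order \<open>x\<^sup>2\<close> and therefore absorbs the logarithm.\<close>
  have PR: "?P x - 1 = ?R x * (u x / 4)" for x
    using pow_series_shift(2)[OF entire_I0, of "u x / 4"] by (simp add: I0_coeff_def)
  have l1: "((\<lambda>x. ?Q x - L * ?P x - 1 / 4 * (l x ^ 1 * (u x * ?R x))) \<longlongrightarrow> 0 - L * 1 - 1 / 4 * 0) (at_right 0)"
    by (intro tendsto_intros P Q small ent) auto
  have e1: "?Q x - L * ?P x - 1 / 4 * (l x ^ 1 * (u x * ?R x)) = ?Q x - (L + l x) * ?P x + l x" for x
  proof -
    have "1 / 4 * (l x ^ 1 * (u x * ?R x)) = l x * (?P x - 1)"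
      unfolding PR by simp
    then show ?thesis
      by (simp add: algebra_simps)
  qed
  have "((\<lambda>x. ?Q x - (L + l x) * ?P x + l x) \<longlongrightarrow> - L) (at_right 0)"
    using l1 unfolding e1 by simp
  then show "((\<lambda>x. bessel_K (\<kappa> * of_real x) + of_real (ln x)) \<longlongrightarrow> - (Ln (\<kappa> / 2) + euler_mascheroni)) (at_right 0)"
    unfolding L_def[symmetric] l_def[symmetric]
    by (rule filterlim_mono_eventually[OF _ order_refl order_refl]) (auto simp: eventually_at_filter K)
  have "((\<lambda>x. 1 / 2 * (l x ^ 0 * (u x * ?Q1 x)) - (L * (1 / 2 * (l x ^ 0 * (u x * ?P1 x))) + 1 / 2 * (l x ^ 1 * (u x * ?P1 x))) - ?P x)
      \<longlongrightarrow> 1 / 2 * 0 - (L * (1 / 2 * 0) + 1 / 2 * 0) - 1) (at_right 0)"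
    by (intro tendsto_intros P Q small ent) auto
  then have "((\<lambda>x. 1 / 2 * (u x * ?Q1 x) - (L + l x) * (1 / 2 * (u x * ?P1 x)) - ?P x) \<longlongrightarrow> - 1) (at_right 0)"
    by (simp add: algebra_simps add_divide_distrib)
  then show "((\<lambda>x. \<kappa> * of_real x * bessel_K' (\<kappa> * of_real x)) \<longlongrightarrow> - 1) (at_right 0)"
    by (rule filterlim_mono_eventually[OF _ order_refl order_refl]) (auto simp: eventually_at_filter K')
  have l2: "((\<lambda>x. 1 / 2 * (l x ^ 1 * (u x * ?Q1 x)) - L * (1 / 2 * (l x ^ 1 * (u x * ?P1 x)))
      - 1 / 2 * (l x ^ 2 * (u x * ?P1 x)) - ?Q x + L * ?P x)
      \<longlongrightarrow> 1 / 2 * 0 - L * (1 / 2 * 0) - 1 / 2 * 0 - 0 + L * 1) (at_right 0)"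
    by (intro tendsto_intros P Q small ent) auto
  have e2: "1 / 2 * (l x ^ 1 * (u x * ?Q1 x)) - L * (1 / 2 * (l x ^ 1 * (u x * ?P1 x)))
      - 1 / 2 * (l x ^ 2 * (u x * ?P1 x)) - ?Q x + L * ?P x
      = l x * (1 / 2 * (u x * ?Q1 x) - (L + l x) * (1 / 2 * (u x * ?P1 x)) - ?P x) - (?Q x - (L + l x) * ?P x)" for x
    by (simp add: algebra_simps power2_eq_square)
  have "((\<lambda>x. l x * (1 / 2 * (u x * ?Q1 x) - (L + l x) * (1 / 2 * (u x * ?P1 x)) - ?P x) - (?Q x - (L + l x) * ?P x)) \<longlongrightarrow> L) (at_right 0)"
    using l2 unfolding e2 by simp
  then show "((\<lambda>x. of_real (ln x) * (\<kappa> * of_real x * bessel_K' (\<kappa> * of_real x)) - bessel_K (\<kappa> * of_real x))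
     \<longlongrightarrow> Ln (\<kappa> / 2) + euler_mascheroni) (at_right 0)"
    unfolding L_def[symmetric] l_def[symmetric]
    by (rule filterlim_mono_eventually[OF _ order_refl order_refl]) (auto simp: eventually_at_filter K K')
qed

end

section \<open>The integral representation of the Macdonald function\<close>

lemma modified_bessel_diff:
  "modified_bessel f f' \<Longrightarrow> modified_bessel g g' \<Longrightarrow> modified_bessel (\<lambda>s. f s - g s) (\<lambda>s. f' s - g' s)"
  unfolding modified_bessel_def
  by (intro allI impI conjI) (auto intro!: derivative_eq_intros simp: diff_divide_distrib)

text \<open>
  Let \<open>D\<close> be the difference of the two solutions. Its Wronskians with \<open>I\<close> and with \<open>K\<close> are constant, and their values
  are found along the sequence \<open>\<sigma> n = 2 / (n + 1)\<close>, on which the behaviour of both functions at 0 is known: the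
  singular parts, including the Euler constant, agree, so that \<open>D\<close> and \<open>s D'\<close> tend to 0 and both Wronskians vanish.
  As \<open>I\<close> and \<open>K\<close> are independent, \<open>D = 0\<close>.
\<close>

lemma bessel_K_eq_laplace:
  assumes "0 < Re s"
  shows "laplace cosh 0 s = bessel_K s" "- laplace cosh 1 s = bessel_K' s"
proof -
  define D where "D s = laplace cosh 0 s - bessel_K s" for s
  define D' where "D' s = - laplace cosh 1 s - bessel_K' s" for s
  have D: "modified_bessel D D'"
    unfolding D_def[abs_def] D'_def[abs_def]
    by (intro modified_bessel_diff modified_bessel_laplace modified_bessel_K)
  define \<sigma> where "\<sigma> n = 2 * complex_of_real (1 / real (Suc n))" for n
  have \<sigma>: "0 < Re (\<sigma> n)" for n
    by (simp add: \<sigma>_def)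
  have two: "0 < Re 2"
    by simp
  let ?l = "\<lambda>n. complex_of_real (ln (1 / real (Suc n)))"
  note seq = filterlim_compose[OF _ seq_at_right_0]
  have I: "(\<lambda>n. bessel_I (\<sigma> n)) \<longlonglongrightarrow> 1" and I': "(\<lambda>n. \<sigma> n * bessel_I' (\<sigma> n)) \<longlonglongrightarrow> 0"
    and K: "(\<lambda>n. bessel_K (\<sigma> n) + ?l n) \<longlonglongrightarrow> - euler_mascheroni"
    and K': "(\<lambda>n. \<sigma> n * bessel_K' (\<sigma> n)) \<longlonglongrightarrow> - 1"
    using seq[OF bessel_I_ray(1)[of 2]] seq[OF bessel_I_ray(2)[of 2]]
      seq[OF bessel_K_near_0(1)[OF two]] seq[OF bessel_K_near_0(2)[OF two]]
    unfolding \<sigma>_def by simp_all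
  have KI': "(\<lambda>n. \<sigma> n * bessel_I' (\<sigma> n) * bessel_K (\<sigma> n)) \<longlonglongrightarrow> 0"
  proof -
    have "((\<lambda>x. 1 / 2 * (of_real (ln x) ^ 1 * ((2 * complex_of_real x)\<^sup>2 * pow_series (diffs I0_coeff) ((2 * complex_of_real x)\<^sup>2 / 4))))
      \<longlongrightarrow> 1 / 2 * 0) (at_right 0)"
      by (intro tendsto_intros ln_pow_series_near_0 entire_coeffs_diffs entire_I0) auto
    from seq[OF this] have "(\<lambda>n. \<sigma> n * bessel_I' (\<sigma> n) * ?l n) \<longlonglongrightarrow> 0"
      unfolding \<sigma>_def[symmetric] bessel_I'_def by (simp add: power2_eq_square mult_ac)
    from tendsto_diff[OF tendsto_mult[OF I' K] this] show ?thesis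
      by (simp add: distrib_left)
  qed
  have D0: "(\<lambda>n. D (\<sigma> n)) \<longlonglongrightarrow> 0"
  proof -
    have "\<sigma> n = of_real (2 / real (Suc n))" for n
      by (simp add: \<sigma>_def)
    then have "(\<lambda>n. laplace cosh 0 (\<sigma> n) + ?l n) \<longlonglongrightarrow> - euler_mascheroni"
      using laplace_cosh_near_0 by simp
    from tendsto_diff[OF this K] show ?thesis
      by (simp add: D_def)
  qed
  have D1: "(\<lambda>n. \<sigma> n * D' (\<sigma> n)) \<longlonglongrightarrow> 0"
  proof -
    have \<sigma>x: "\<sigma> n = of_real (2 / real (Suc n))" for n
      by (simp add: \<sigma>_def)
    have lim: "(\<lambda>n. 2 / real (Suc n)) \<longlonglongrightarrow> 0"
      using tendsto_mult_left[OF LIMSEQ_Suc[OF lim_1_over_n], of 2] by simp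
    have "(\<lambda>n. \<sigma> n * laplace cosh 1 (\<sigma> n) - exp (- \<sigma> n)) \<longlonglongrightarrow> 0"
    proof (rule Lim_null_comparison[OF _ lim])
      show "\<forall>\<^sub>F n in sequentially. norm (\<sigma> n * laplace cosh 1 (\<sigma> n) - exp (- \<sigma> n)) \<le> 2 / real (Suc n)"
      proof (intro always_eventually allI)
        fix n
        have "0 < 2 / real (Suc n)"
          by simp
        from laplace_cosh_1_near_0[OF this] show "norm (\<sigma> n * laplace cosh 1 (\<sigma> n) - exp (- \<sigma> n)) \<le> 2 / real (Suc n)"
          unfolding \<sigma>x .
      qed
    qed
    moreover have "(\<lambda>n. exp (- \<sigma> n)) \<longlonglongrightarrow> exp (- of_real 0)"
      unfolding \<sigma>x by (intro tendsto_intros lim)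
    ultimately have "(\<lambda>n. \<sigma> n * laplace cosh 1 (\<sigma> n) - exp (- \<sigma> n) + exp (- \<sigma> n)) \<longlonglongrightarrow> 0 + exp (- of_real 0)"
      by (intro tendsto_add)
    then have "(\<lambda>n. - (\<sigma> n * laplace cosh 1 (\<sigma> n)) - \<sigma> n * bessel_K' (\<sigma> n)) \<longlonglongrightarrow> - 1 - - 1"
      by (intro tendsto_diff tendsto_minus K') simp
    then show ?thesis
      by (simp add: D'_def right_diff_distrib)
  qed
  have W_DI: "s * (D s * bessel_I' s - D' s * bessel_I s) = 0" if "0 < Re s" for s
  proof -
    obtain C where "\<forall>s. 0 < Re s \<longrightarrow> s * (D s * bessel_I' s - D' s * bessel_I s) = C"
      using modified_bessel_Wronskian[OF D modified_bessel_I] by (rule exE)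
    then have C: "s * (D s * bessel_I' s - D' s * bessel_I s) = C" if "0 < Re s" for s
      using that by blast
    have "(\<lambda>n. D (\<sigma> n) * (\<sigma> n * bessel_I' (\<sigma> n)) - \<sigma> n * D' (\<sigma> n) * bessel_I (\<sigma> n)) \<longlonglongrightarrow> 0 * 0 - 0 * 1"
      by (intro tendsto_intros D0 D1 I I')
    moreover have "D (\<sigma> n) * (\<sigma> n * bessel_I' (\<sigma> n)) - \<sigma> n * D' (\<sigma> n) * bessel_I (\<sigma> n) = C" for n
      using C[OF \<sigma>, of n] by (simp add: algebra_simps)
    ultimately have "C = 0"
      by (simp add: LIMSEQ_const_iff)
    then show ?thesis
      using C[OF that] by simp
  qed
  have W_DK: "s * (D s * bessel_K' s - D' s * bessel_K s) = 0" if "0 < Re s" for s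
  proof -
    obtain C where "\<forall>s. 0 < Re s \<longrightarrow> s * (D s * bessel_K' s - D' s * bessel_K s) = C"
      using modified_bessel_Wronskian[OF D modified_bessel_K] by (rule exE)
    then have C: "s * (D s * bessel_K' s - D' s * bessel_K s) = C" if "0 < Re s" for s
      using that by blast
    have "(\<lambda>n. bessel_I (\<sigma> n) * C) \<longlonglongrightarrow> 1 * C"
      by (intro tendsto_intros I)
    \<comment> \<open>The product \<open>\<sigma> D'(\<sigma>) K(\<sigma>)\<close> is not controlled directly, since \<open>K\<close> is unbounded. Multiply by \<open>I(\<sigma>)\<close>, which tends
      to 1, and use the vanishing Wronskian with \<open>I\<close> to replace \<open>\<sigma> D'(\<sigma>) I(\<sigma>)\<close> by \<open>\<sigma> D(\<sigma>) I'(\<sigma>)\<close>.\<close>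
    moreover have "(\<lambda>n. bessel_I (\<sigma> n) * C) \<longlonglongrightarrow> 0"
    proof -
      have "(\<lambda>n. bessel_I (\<sigma> n) * (D (\<sigma> n) * (\<sigma> n * bessel_K' (\<sigma> n)))
          - D (\<sigma> n) * (\<sigma> n * bessel_I' (\<sigma> n) * bessel_K (\<sigma> n))) \<longlonglongrightarrow> 1 * (0 * - 1) - 0 * 0"
        by (intro tendsto_intros I D0 K' KI')
      moreover have "bessel_I (\<sigma> n) * (D (\<sigma> n) * (\<sigma> n * bessel_K' (\<sigma> n)))
          - D (\<sigma> n) * (\<sigma> n * bessel_I' (\<sigma> n) * bessel_K (\<sigma> n)) = bessel_I (\<sigma> n) * C" for n
      proof -
        have "bessel_I (\<sigma> n) * C = bessel_I (\<sigma> n) * (\<sigma> n * (D (\<sigma> n) * bessel_K' (\<sigma> n) - D' (\<sigma> n) * bessel_K (\<sigma> n)))"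
          using C[OF \<sigma>, of n] by simp
        also have "\<dots> = bessel_I (\<sigma> n) * (D (\<sigma> n) * (\<sigma> n * bessel_K' (\<sigma> n)))
            - (\<sigma> n * D' (\<sigma> n) * bessel_I (\<sigma> n)) * bessel_K (\<sigma> n)"
          by (simp add: algebra_simps)
        also have "\<sigma> n * D' (\<sigma> n) * bessel_I (\<sigma> n) = D (\<sigma> n) * (\<sigma> n * bessel_I' (\<sigma> n))"
          using W_DI[OF \<sigma>, of n] by (auto simp: algebra_simps)
        finally show ?thesis
          by (simp add: mult_ac)
      qed
      ultimately show ?thesis
        by simp
    qed
    ultimately have "C = 0"
      using LIMSEQ_unique by force
    then show ?thesis
      using C[OF that] by simp
  qed
  have W_KI: "s * (bessel_K s * bessel_I' s - bessel_K' s * bessel_I s) = 1" if "0 < Re s" for s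
  proof -
    obtain C where "\<forall>s. 0 < Re s \<longrightarrow> s * (bessel_K s * bessel_I' s - bessel_K' s * bessel_I s) = C"
      using modified_bessel_Wronskian[OF modified_bessel_K modified_bessel_I] by (rule exE)
    then have C: "s * (bessel_K s * bessel_I' s - bessel_K' s * bessel_I s) = C" if "0 < Re s" for s
      using that by blast
    have "(\<lambda>n. \<sigma> n * bessel_I' (\<sigma> n) * bessel_K (\<sigma> n) - \<sigma> n * bessel_K' (\<sigma> n) * bessel_I (\<sigma> n)) \<longlonglongrightarrow> 0 - - 1 * 1"
      by (intro tendsto_intros KI' I K')
    moreover have "\<sigma> n * bessel_I' (\<sigma> n) * bessel_K (\<sigma> n) - \<sigma> n * bessel_K' (\<sigma> n) * bessel_I (\<sigma> n) = C" for n
      using C[OF \<sigma>, of n] by (simp add: algebra_simps)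
    ultimately have "C = 1"
      by (simp add: LIMSEQ_const_iff)
    then show ?thesis
      using C[OF that] by simp
  qed
  have s0: "s \<noteq> 0"
    using assms by auto
  have eqs: "D s * bessel_I' s = D' s * bessel_I s" "D s * bessel_K' s = D' s * bessel_K s"
    using W_DI[OF assms] W_DK[OF assms] s0 by simp_all
  have "D s = D s * (s * (bessel_K s * bessel_I' s - bessel_K' s * bessel_I s))"
    using W_KI[OF assms] by simp
  also have "\<dots> = s * (bessel_K s * (D s * bessel_I' s) - bessel_I s * (D s * bessel_K' s))"
    by (simp add: algebra_simps)
  also have "\<dots> = 0"
    unfolding eqs by (simp add: algebra_simps)
  finally have Ds: "D s = 0" .
  have "D' s = s * (bessel_I' s * (D' s * bessel_K s) - bessel_K' s * (D' s * bessel_I s))"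
    using arg_cong[OF W_KI[OF assms], of "\<lambda>y. D' s * y"] by (simp add: algebra_simps)
  also have "\<dots> = 0"
    unfolding eqs[symmetric] Ds by simp
  finally have "D' s = 0" .
  with Ds show "laplace cosh 0 s = bessel_K s" "- laplace cosh 1 s = bessel_K' s"
    by (simp_all add: D_def D'_def)
qed

lemma bessel_K_decay:
  assumes "Re \<kappa> > 0"
  obtains M where "\<And>x. x \<ge> 1 \<Longrightarrow> norm (bessel_K (\<kappa> * of_real x)) \<le> M * exp (- Re \<kappa> * x)"
    "\<And>x. x \<ge> 1 \<Longrightarrow> norm (bessel_K' (\<kappa> * of_real x)) \<le> M * exp (- Re \<kappa> * x)"
proof -
  obtain M0 where M0: "\<And>x. x \<ge> 1 \<Longrightarrow> norm (laplace cosh 0 (\<kappa> * of_real x)) \<le> M0 * exp (- Re \<kappa> * x)"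
    using laplace_decay[OF phase_cosh cosh_real_ge_1 assms] by blast
  obtain M1 where M1: "\<And>x. x \<ge> 1 \<Longrightarrow> norm (laplace cosh 1 (\<kappa> * of_real x)) \<le> M1 * exp (- Re \<kappa> * x)"
    using laplace_decay[OF phase_cosh cosh_real_ge_1 assms] by blast
  show ?thesis
  proof (rule that[of "max M0 M1"])
    fix x :: real assume x: "x \<ge> 1"
    then have re: "0 < Re (\<kappa> * of_real x)"
      using assms by simp
    have "M0 * exp (- Re \<kappa> * x) \<le> max M0 M1 * exp (- Re \<kappa> * x)" "M1 * exp (- Re \<kappa> * x) \<le> max M0 M1 * exp (- Re \<kappa> * x)"
      by (intro mult_right_mono; simp)+
    then show "norm (bessel_K (\<kappa> * of_real x)) \<le> max M0 M1 * exp (- Re \<kappa> * x)"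
      "norm (bessel_K' (\<kappa> * of_real x)) \<le> max M0 M1 * exp (- Re \<kappa> * x)"
      unfolding bessel_K_eq_laplace[OF re, symmetric] norm_minus_cancel
      using M0[OF x] M1[OF x] by linarith+
  qed
qed

text \<open>
  Immediate from the integral representation, whose kernel is real for real \<open>s\<close>.
\<close>

lemma bessel_K_cnj:
  assumes "Re s > 0"
  shows "bessel_K (cnj s) = cnj (bessel_K s)"
proof -
  have "laplace cosh 0 (cnj s) = cnj (laplace cosh 0 s)"
    unfolding laplace_def by (subst Bochner_Integration.integral_cnj[symmetric]) (simp add: exp_cnj)
  then show ?thesis
    using bessel_K_eq_laplace(1) assms by simp
qed

section \<open>The Hankel function and the Macdonald function\<close>

text \<open>
  For \<open>z\<close> outside \<open>[0,\<infinity>)\<close> this is the square root of \<open>- z\<close> with positive real part.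
\<close>

definition decay_rate :: "complex \<Rightarrow> complex" where
  "decay_rate z = - \<i> * branch_sqrt z"

lemma branch_sqrt_square: "(branch_sqrt z)\<^sup>2 = z"
proof -
  have "(branch_sqrt z)\<^sup>2 = of_real (cmod z) * cis (Arg2pi z)"
    by (simp add: branch_sqrt_def power_mult_distrib Complex.DeMoivre flip: of_real_power)
  also have "\<dots> = z"
    using Arg2pi_eq[of z] by (simp add: cis_conv_exp)
  finally show ?thesis .
qed

lemma decay_rate_square: "(decay_rate z)\<^sup>2 = - z"
  by (simp add: decay_rate_def power_mult_distrib branch_sqrt_square)

lemma Im_branch_sqrt:
  assumes "z \<notin> \<real>\<^sub>\<ge>\<^sub>0"
  shows "Im (branch_sqrt z) > 0"
proof -
  have "z \<noteq> 0" "Arg2pi z \<noteq> 0"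
    using assms by (auto simp: Arg2pi_eq_0 complex_nonneg_Reals_iff complex_is_Real_iff)
  then have "0 < Arg2pi z" "Arg2pi z < 2 * pi"
    using Arg2pi[of z] by auto
  then have "sin (Arg2pi z / 2) > 0"
    by (intro sin_gt_zero) auto
  then show ?thesis
    using \<open>z \<noteq> 0\<close> by (simp add: branch_sqrt_def)
qed

lemma Re_decay_rate: "z \<notin> \<real>\<^sub>\<ge>\<^sub>0 \<Longrightarrow> Re (decay_rate z) > 0"
  using Im_branch_sqrt by (simp add: decay_rate_def)

lemma decay_rate_cnj:
  assumes "z \<notin> \<real>\<^sub>\<ge>\<^sub>0"
  shows "decay_rate (cnj z) = cnj (decay_rate z)"
proof -
  have "(decay_rate (cnj z))\<^sup>2 = (cnj (decay_rate z))\<^sup>2"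
    by (simp add: decay_rate_square flip: complex_cnj_power)
  then have "decay_rate (cnj z) = cnj (decay_rate z) \<or> decay_rate (cnj z) = - cnj (decay_rate z)"
    by (simp add: power2_eq_iff)
  moreover have "Re (decay_rate (cnj z)) > 0" "Re (decay_rate z) > 0"
    using assms by (intro Re_decay_rate; auto simp: complex_nonneg_Reals_iff)+
  ultimately show ?thesis
    by auto
qed

text \<open>
  In the upper half-plane the branch with argument in \<open>[0,2\<pi>)\<close> agrees with the principal one, and the rotation by
  \<open>- \<i>\<close> leads to the right half-plane without meeting the cut.
\<close>

lemma branch_ln_eq_Ln:
  assumes "Im w > 0"
  shows "branch_ln w - \<i> * of_real pi / 2 = Ln (- \<i> * w)"
proof -
  have w: "w \<noteq> 0"
    using assms by auto
  have A: "0 < Arg2pi w" "Arg2pi w < pi"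
    using assms Arg2pi_lt_pi[of w] by auto
  have "exp (branch_ln w - \<i> * of_real pi / 2) = exp (branch_ln w) * exp (- (\<i> * of_real pi / 2))"
    by (simp only: diff_conv_add_uminus exp_add)
  also have "exp (branch_ln w) = w"
    using w Arg2pi_eq[of w] by (simp add: branch_ln_def exp_add exp_of_real)
  also have "exp (- (\<i> * of_real pi / 2)) = - \<i>"
    using cis_conv_exp[of "- pi / 2"] by (simp add: cis.ctr complex_eq_iff)
  finally have "exp (branch_ln w - \<i> * of_real pi / 2) = - \<i> * w"
    by (simp add: mult.commute)
  then show ?thesis
    using A by (intro Ln_unique[symmetric]) (auto simp: branch_ln_def)
qed

text \<open>
  At \<open>s = - \<i> \<zeta>\<close> the alternating series of \<open>J\<^sub>0\<close> and \<open>Y\<^sub>0\<close> at \<open>\<zeta>\<close> become the series of \<open>I\<^sub>0\<close> and of the regular part of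
  \<open>K\<^sub>0\<close>, and the term \<open>J\<^sub>0\<close> of the Hankel function shifts the logarithm by \<open>- \<i> \<pi> / 2\<close>.
\<close>

lemma w_sol_eq_bessel_K:
  assumes z: "z \<notin> \<real>\<^sub>\<ge>\<^sub>0" and x: "0 < x"
  shows "w_sol z x = of_real (sqrt x) * bessel_K (decay_rate z * of_real x)"
proof -
  define \<zeta> where "\<zeta> = branch_sqrt z * of_real x"
  have Im: "Im (\<zeta> / 2) > 0"
    using Im_branch_sqrt[OF z] x by (simp add: \<zeta>_def)
  define s where "s = decay_rate z * of_real x"
  have s: "s = - \<i> * \<zeta>"
    by (simp add: s_def \<zeta>_def decay_rate_def)
  have s2: "s\<^sup>2 / 4 = - 1 * (\<zeta> / 2)\<^sup>2"
    by (simp add: s power_mult_distrib power_divide)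
  have series: "(- 1) ^ k * (\<zeta> / 2) ^ (2 * k) = (s\<^sup>2 / 4) ^ k" for k
    by (simp only: s2 power_mult_distrib power_mult)
  have J: "bessel_J0 \<zeta> = pow_series I0_coeff (s\<^sup>2 / 4)"
    unfolding bessel_J0_def pow_series_def series I0_coeff_def by simp
  have "(\<lambda>k. (- 1) ^ k * harm k * (\<zeta> / 2) ^ (2 * k) / (fact k)\<^sup>2) = (\<lambda>k. K0_coeff k * (s\<^sup>2 / 4) ^ k)"
    unfolding K0_coeff_def series[symmetric] by (simp add: fun_eq_iff mult_ac)
  then have Y: "bessel_Y0 \<zeta> = of_real (2 / pi) * ((branch_ln (\<zeta> / 2) + euler_mascheroni) * bessel_J0 \<zeta>
      - pow_series K0_coeff (s\<^sup>2 / 4))"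
    unfolding bessel_Y0_def pow_series_def by (simp add: right_diff_distrib mult.assoc)
  have ln: "branch_ln (\<zeta> / 2) = Ln (s / 2) + \<i> * of_real pi / 2"
    using branch_ln_eq_Ln[OF Im] by (simp add: s algebra_simps)
  have "\<i> * of_real (pi / 2) * hankel_H0 \<zeta> = \<i> * of_real pi / 2 * bessel_J0 \<zeta>
      - ((branch_ln (\<zeta> / 2) + euler_mascheroni) * bessel_J0 \<zeta> - pow_series K0_coeff (s\<^sup>2 / 4))"
    unfolding hankel_H0_def Y by (simp add: field_simps)
  also have "\<dots> = bessel_K s"
    unfolding ln J bessel_K_def by (simp add: algebra_simps)
  finally have K: "\<i> * of_real (pi / 2) * hankel_H0 \<zeta> = bessel_K s" .
  show ?thesis
    unfolding w_sol_def \<zeta>_def[symmetric] s_def[symmetric] K[symmetric] by (simp only: mult_ac)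
qed

lemma w_sol_cnj:
  assumes z: "z \<notin> \<real>\<^sub>\<ge>\<^sub>0" and x: "0 < x"
  shows "w_sol (cnj z) x = cnj (w_sol z x)"
proof -
  have "cnj z \<notin> \<real>\<^sub>\<ge>\<^sub>0"
    using z by (simp add: complex_nonneg_Reals_iff)
  moreover have "Re (decay_rate z * of_real x) > 0"
    using Re_decay_rate[OF z] x by simp
  ultimately show ?thesis
    using z x bessel_K_cnj[of "decay_rate z * of_real x"]
    by (simp add: w_sol_eq_bessel_K decay_rate_cnj)
qed

lemma denominator_eq:
  assumes z: "z \<notin> \<real>\<^sub>\<ge>\<^sub>0"
  shows "c + branch_ln (branch_sqrt z / 2) + euler_mascheroni - \<i> * of_real pi / 2
    = c + (Ln (decay_rate z / 2) + euler_mascheroni)"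
proof -
  have "Im (branch_sqrt z / 2) > 0"
    using Im_branch_sqrt[OF z] by simp
  from branch_ln_eq_Ln[OF this] show ?thesis
    by (simp add: decay_rate_def algebra_simps)
qed

section \<open>Solutions of the differential equation and the Lagrange identity\<close>

text \<open>
  Solutions of \<open>\<tau> u = z u\<close> that are twice differentiable everywhere. The derivative \<open>u'\<close> is part of the data, so that
  Wronskians can be written without the operator \<open>D1\<close>.
\<close>

definition classical_solution :: "complex \<Rightarrow> (real \<Rightarrow> complex) \<Rightarrow> (real \<Rightarrow> complex) \<Rightarrow> bool" where
  "classical_solution z u u' \<longleftrightarrow> (\<forall>x>0. (u has_vector_derivative u' x) (at x) \<and>
     (u' has_vector_derivative - (z + of_real (1 / (4 * x\<^sup>2))) * u x) (at x))"

lemma has_vector_derivative_pos_cong: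
  assumes "(f has_vector_derivative d) (at x)" "\<And>x. 0 < x \<Longrightarrow> f x = g x" "(0::real) < x"
  shows "(g has_vector_derivative d) (at x)"
  by (rule has_vector_derivative_transform_within_open[OF assms(1), of "{0<..}"]) (use assms in auto)

lemma classical_solution_D1:
  assumes "classical_solution z u u'" "0 < x"
  shows "D1 u x = u' x" "D1 (D1 u) x = - (z + of_real (1 / (4 * x\<^sup>2))) * u x" "tau0 u x = z * u x"
    "(D1 u has_vector_derivative - (z + of_real (1 / (4 * x\<^sup>2))) * u x) (at x)"
proof -
  have u: "\<And>x. 0 < x \<Longrightarrow> D1 u x = u' x"
    using assms(1) by (auto simp: classical_solution_def intro: vector_derivative_at)
  then show "D1 u x = u' x"
    using assms(2) .
  show d: "(D1 u has_vector_derivative - (z + of_real (1 / (4 * x\<^sup>2))) * u x) (at x)"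
    by (rule has_vector_derivative_pos_cong[of u']) (use assms u in \<open>auto simp: classical_solution_def\<close>)
  show D2: "D1 (D1 u) x = - (z + of_real (1 / (4 * x\<^sup>2))) * u x"
    by (rule vector_derivative_at[OF d])
  show "tau0 u x = z * u x"
    unfolding tau0_def D2 by (simp add: algebra_simps)
qed

lemma classical_solution_continuous:
  assumes "classical_solution z u u'"
  shows "continuous_on {0<..} u" "continuous_on {0<..} u'"
proof -
  have "isCont u x" "isCont u' x" if "0 < x" for x
    using assms that has_vector_derivative_continuous unfolding classical_solution_def by blast+
  then show "continuous_on {0<..} u" "continuous_on {0<..} u'"
    by (auto intro!: continuous_at_imp_continuous_on)
qed

lemma classical_solution_regular:
  assumes u: "classical_solution z u u'"
  shows "u \<in> AC_loc" "u' \<in> AC_loc" "u \<in> regular_functions"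
proof -
  note c = classical_solution_continuous[OF u]
  show 1: "u \<in> AC_loc"
    by (rule C1_AC_loc[OF _ c(2)]) (use u in \<open>auto simp: classical_solution_def\<close>)
  show 2: "u' \<in> AC_loc"
  proof (rule C1_AC_loc)
    show "(u' has_vector_derivative - (z + of_real (1 / (4 * x\<^sup>2))) * u x) (at x)" if "0 < x" for x
      using u that by (simp add: classical_solution_def)
    show "continuous_on {0<..} (\<lambda>x. - (z + of_real (1 / (4 * x\<^sup>2))) * u x)"
      by (intro continuous_intros c) auto
  qed
  have "D1 u \<in> AC_loc"
    by (rule AC_loc_cong[OF 2]) (use classical_solution_D1(1)[OF u] in simp)
  moreover have "u differentiable at x" if "0 < x" for x
    using u that by (auto simp: classical_solution_def intro: differentiableI_vector)
  ultimately show "u \<in> regular_functions"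
    using 1 by (simp add: regular_functions_def)
qed

text \<open>
  The substitution \<open>u = \<surd>x k\<close> removes the potential: it turns the equation into \<open>k'' + k' / x + z k = 0\<close>.
\<close>

lemma classical_solution_sqrt_times:
  assumes k: "\<And>x. 0 < x \<Longrightarrow> (k has_vector_derivative k' x) (at x)"
    and k': "\<And>x. 0 < x \<Longrightarrow> (k' has_vector_derivative - z * k x - k' x / of_real x) (at x)"
  shows "classical_solution z (\<lambda>x. of_real (sqrt x) * k x)
    (\<lambda>x. of_real (1 / (2 * sqrt x)) * k x + of_real (sqrt x) * k' x)"
  unfolding classical_solution_def
proof (intro allI impI conjI)
  fix x :: real assume x: "0 < x"
  define r where "r = complex_of_real (sqrt x)"
  have r: "r \<noteq> 0" "complex_of_real x = r * r"
    using x by (simp_all add: r_def flip: of_real_mult)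
  have s: "((\<lambda>x. complex_of_real (sqrt x)) has_vector_derivative of_real (1 / (2 * sqrt x))) (at x)"
    using x by (intro of_real_has_vector_derivative) (auto intro!: derivative_eq_intros simp: field_simps)
  have "((\<lambda>x. 1 / (2 * sqrt x)) has_real_derivative - 1 / (4 * x * sqrt x)) (at x)"
    using x by (auto intro!: derivative_eq_intros simp: field_simps)
  then have i: "((\<lambda>x. complex_of_real (1 / (2 * sqrt x))) has_vector_derivative of_real (- 1 / (4 * x * sqrt x))) (at x)"
    by (rule of_real_has_vector_derivative)
  have "((\<lambda>x. of_real (sqrt x) * k x) has_vector_derivative
      of_real (sqrt x) * k' x + of_real (1 / (2 * sqrt x)) * k x) (at x)"
    by (intro has_vector_derivative_mult s k x)
  then show "((\<lambda>x. of_real (sqrt x) * k x) has_vector_derivative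
      of_real (1 / (2 * sqrt x)) * k x + of_real (sqrt x) * k' x) (at x)"
    by (simp only: add.commute)
  have d: "((\<lambda>x. of_real (1 / (2 * sqrt x)) * k x + of_real (sqrt x) * k' x) has_vector_derivative
      (of_real (1 / (2 * sqrt x)) * k' x + of_real (- 1 / (4 * x * sqrt x)) * k x)
      + (of_real (sqrt x) * (- z * k x - k' x / of_real x) + of_real (1 / (2 * sqrt x)) * k' x)) (at x)"
    by (intro has_vector_derivative_add has_vector_derivative_mult s i k k' x)
  have "(of_real (1 / (2 * sqrt x)) * k' x + of_real (- 1 / (4 * x * sqrt x)) * k x)
      + (of_real (sqrt x) * (- z * k x - k' x / of_real x) + of_real (1 / (2 * sqrt x)) * k' x)
      = (1 / (2 * r) * k' x + - 1 / (4 * (r * r) * r) * k x)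
      + (r * (- z * k x - k' x / (r * r)) + 1 / (2 * r) * k' x)"
    using r(2) by (simp add: r_def)
  also have "\<dots> = - (z + 1 / (4 * (r * r)\<^sup>2)) * (r * k x)"
    using r(1) by (simp add: field_simps power2_eq_square)
  also have "\<dots> = - (z + of_real (1 / (4 * x\<^sup>2))) * (of_real (sqrt x) * k x)"
    using r(2) by (simp add: r_def)
  finally show "((\<lambda>x. of_real (1 / (2 * sqrt x)) * k x + of_real (sqrt x) * k' x) has_vector_derivative
      - (z + of_real (1 / (4 * x\<^sup>2))) * (of_real (sqrt x) * k x)) (at x)"
    using d by (simp only:)
qed

lemma AE_half_line_negligible:
  assumes "AE x in half_line. P x"
  obtains N where "negligible N" "\<And>x. 0 < x \<Longrightarrow> x \<notin> N \<Longrightarrow> P x"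
proof -
  have "AE x in lebesgue. x \<in> {0<..} \<longrightarrow> P x"
    using assms by (simp add: AE_restrict_space_iff)
  then obtain N where N: "N \<in> null_sets lebesgue" "{x \<in> space lebesgue. \<not> (x \<in> {0<..} \<longrightarrow> P x)} \<subseteq> N"
    unfolding eventually_ae_filter by blast
  show ?thesis
  proof (rule that)
    show "negligible N"
      using N(1) by (simp add: negligible_iff_null_sets)
    show "P x" if "0 < x" "x \<notin> N" for x
      using N(2) that by auto
  qed
qed

lemma regularD:
  assumes "g \<in> regular_functions"
  shows "g \<in> AC_loc" "D1 g \<in> AC_loc" "0 < x \<Longrightarrow> (g has_vector_derivative D1 g x) (at x)"
    "AE x in half_line. (D1 g has_vector_derivative D1 (D1 g) x) (at x)"
  using assms vector_derivative_works[of g "at x"]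
  by (auto simp: regular_functions_def intro: AC_loc_differentiable_AE)

lemma dom_TmaxD:
  assumes "g \<in> dom_Tmax"
  shows "g \<in> regular_functions" "square_integrable g" "square_integrable (tau0 g)"
  using assms by (auto simp: dom_Tmax_def)

text \<open>
  The Wronskian of \<open>u\<close> and \<open>g\<close> is absolutely continuous and its derivative is \<open>u (\<tau> g - z g)\<close> almost everywhere. No
  complex conjugate is involved, so \<open>z\<close> is the same for both functions.
\<close>

lemma Lagrange_identity:
  assumes u: "classical_solution z u u'" and g: "g \<in> regular_functions" and ab: "0 < a" "a \<le> b"
  shows "((\<lambda>x. u x * (tau0 g x - z * g x)) has_integral
    (u' b * g b - u b * D1 g b) - (u' a * g a - u a * D1 g a)) {a..b}"
proof -
  define B where "B x = u' x * g x - u x * D1 g x" for x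
  have "(\<lambda>x. u' x * g x + - 1 * (u x * D1 g x)) \<in> AC_loc"
    by (intro AC_loc_add_scale AC_loc_times classical_solution_regular[OF u] regularD[OF g])
  then have "B \<in> AC_loc"
    by (simp add: B_def[abs_def])
  then have B: "(D1 B has_integral B b - B a) {a..b}"
    by (rule AC_loc_has_integral[OF _ ab])
  obtain N where N: "negligible N"
    "\<And>x. 0 < x \<Longrightarrow> x \<notin> N \<Longrightarrow> (D1 g has_vector_derivative D1 (D1 g) x) (at x)"
    using AE_half_line_negligible[OF regularD(4)[OF g]] by blast
  have "((\<lambda>x. u x * (tau0 g x - z * g x)) has_integral B b - B a) {a..b}"
  proof (rule has_integral_spike[OF N(1) _ B])
    fix x assume x: "x \<in> {a..b} - N"
    then have x0: "0 < x"
      using ab by auto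
    let ?q = "complex_of_real (1 / (4 * x\<^sup>2))"
    have "(B has_vector_derivative (u' x * D1 g x + - (z + ?q) * u x * g x)
        - (u x * D1 (D1 g) x + u' x * D1 g x)) (at x)"
      unfolding B_def[abs_def]
      using u x0 x N(2)[OF x0] regularD(3)[OF g x0]
      by (intro has_vector_derivative_diff has_vector_derivative_mult) (auto simp: classical_solution_def)
    then have "D1 B x = (u' x * D1 g x + - (z + ?q) * u x * g x) - (u x * D1 (D1 g) x + u' x * D1 g x)"
      by (rule vector_derivative_at)
    also have "\<dots> = u x * (- D1 (D1 g) x - ?q * g x - z * g x)"
      by (simp add: algebra_simps)
    finally show "u x * (tau0 g x - z * g x) = D1 B x"
      by (simp add: tau0_def)
  qed
  then show ?thesis
    by (simp add: B_def)
qed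

lemma square_integrable_indicator:
  assumes "square_integrable f" "A \<in> sets lebesgue"
  shows "square_integrable (\<lambda>x. indicator A x * f x)"
proof -
  have [measurable]: "f \<in> borel_measurable half_line"
    using assms(1) by (simp add: square_integrable_def)
  have A: "A \<inter> {0<..} \<in> sets half_line"
    using assms(2) by (auto simp: sets_restrict_space)
  have [measurable]: "(\<lambda>x. indicator A x :: complex) \<in> borel_measurable half_line"
    using A by (simp add: borel_measurable_indicator_iff)
  show ?thesis
    unfolding square_integrable_def
  proof
    show "(\<lambda>x. indicator A x * f x) \<in> borel_measurable half_line"
      by measurable
    show "integrable half_line (\<lambda>x. (cmod (indicator A x * f x))\<^sup>2)"
    proof (rule Bochner_Integration.integrable_bound)
      show "integrable half_line (\<lambda>x. (cmod (f x))\<^sup>2)"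
        using assms(1) by (simp add: square_integrable_def)
      show "AE x in half_line. norm ((cmod (indicator A x * f x))\<^sup>2) \<le> norm ((cmod (f x))\<^sup>2)"
        by (auto simp: indicator_def)
      show "(\<lambda>x. (cmod (indicator A x * f x))\<^sup>2) \<in> borel_measurable half_line"
        by measurable
    qed
  qed
qed

lemma square_integrable_cong:
  assumes "square_integrable f" "\<And>x. 0 < x \<Longrightarrow> f x = g x"
  shows "square_integrable g"
proof -
  have "f \<in> borel_measurable half_line \<longleftrightarrow> g \<in> borel_measurable half_line"
    using assms(2) by (intro measurable_cong) simp
  moreover have "integrable half_line (\<lambda>x. (cmod (f x))\<^sup>2) \<longleftrightarrow> integrable half_line (\<lambda>x. (cmod (g x))\<^sup>2)"
    using assms(2) by (intro Bochner_Integration.integrable_cong) auto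
  ultimately show ?thesis
    using assms(1) by (simp add: square_integrable_def)
qed

lemma square_integrable_bound:
  assumes c: "continuous_on {0<..} f" and B: "B integrable_on {0<..}" "\<And>x. 0 < x \<Longrightarrow> (cmod (f x))\<^sup>2 \<le> B x"
  shows "square_integrable f"
  unfolding square_integrable_def
proof
  show "f \<in> borel_measurable half_line"
    using c by (intro continuous_imp_measurable_on_sets_lebesgue) auto
  show "integrable half_line (\<lambda>x. (cmod (f x))\<^sup>2)"
    by (rule integrable_half_line_bound[OF _ B(1)]) (use B(2) c in \<open>auto intro!: continuous_intros\<close>)
qed

lemma integrable_product:
  assumes "square_integrable f" "square_integrable g"
  shows "integrable half_line (\<lambda>x. f x * g x)"
proof -
  have "square_integrable (\<lambda>x. cnj (f x))"
    using assms(1) by (auto simp: square_integrable_def intro: measurable_cnj)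
  from square_integrable_product[OF this assms(2)] show ?thesis
    by simp
qed

lemma integrable_half_line_restrict:
  fixes f :: "real \<Rightarrow> 'b::euclidean_space"
  assumes "integrable half_line f" "A \<subseteq> {0<..}" "A \<in> sets lebesgue"
  shows "f absolutely_integrable_on A"
proof -
  have "f absolutely_integrable_on {0<..}"
    using assms(1) by (simp add: absolutely_integrable_lebesgue_on)
  then show ?thesis
    by (rule set_integrable_subset) (use assms in auto)
qed

text \<open>
  By the Lagrange identity the Wronskian differs from a constant by an indefinite integral, which is continuous up to
  the endpoint 0.
\<close>

lemma Wronskian_tendsto_0:
  assumes u: "classical_solution z u u'" and g: "g \<in> regular_functions" and b: "0 < b"
    and int: "integrable half_line (\<lambda>x. indicator {0<..b} x * u x * (tau0 g x - z * g x))"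
  obtains l where "((\<lambda>x. u' x * g x - u x * D1 g x) \<longlongrightarrow> l) (at_right 0)"
proof -
  let ?F = "\<lambda>x. indicator {0<..b} x * u x * (tau0 g x - z * g x)"
  let ?B = "\<lambda>x. u' x * g x - u x * D1 g x"
  have "{0<..b} \<subseteq> {0<..}"
    by auto
  from integrable_half_line_restrict[OF int this] have "?F integrable_on {0<..b}"
    by (simp add: absolutely_integrable_on_def)
  then have F: "?F integrable_on {0..b}"
    by (rule integrable_spike_set) (auto intro: negligible_subset[of "{0}"])
  have eq: "integral {x..b} ?F = ?B b - ?B x" if "x \<in> {0<..b}" for x
  proof (rule integral_unique)
    show "(?F has_integral ?B b - ?B x) {x..b}"
      by (rule has_integral_eq[OF _ Lagrange_identity[OF u g]]) (use that in auto)
  qed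
  have "continuous_on {0..b} (\<lambda>x. integral {x..b} ?F)"
    by (rule indefinite_integral_continuous_1'[OF F])
  then have "((\<lambda>x. integral {x..b} ?F) \<longlongrightarrow> integral {0..b} ?F) (at 0 within {0..b})"
    using b by (simp add: continuous_on)
  then have "((\<lambda>x. integral {x..b} ?F) \<longlongrightarrow> integral {0..b} ?F) (at_right 0)"
    using b by (simp add: at_within_Icc_at_right)
  then have "((\<lambda>x. ?B b - integral {x..b} ?F) \<longlongrightarrow> ?B b - integral {0..b} ?F) (at_right 0)"
    by (intro tendsto_intros)
  moreover have "\<forall>\<^sub>F x in at_right 0. ?B b - integral {x..b} ?F = ?B x"
    using b by (intro eventually_at_rightI[of 0 b]) (auto simp: eq)
  ultimately have "(?B \<longlongrightarrow> ?B b - integral {0..b} ?F) (at_right 0)"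
    by (rule Lim_transform_eventually)
  then show ?thesis
    by (rule that)
qed

text \<open>
  The Pluecker relation between the 2-by-2 minors of four vectors in the plane. With \<open>p\<close>, \<open>q\<close> a fundamental system for
  \<open>z = 0\<close>, it expresses a Wronskian through boundary forms, each of which has a limit at 0.
\<close>

lemma Pluecker:
  fixes u g p q u' g' p' q' :: complex
  assumes "p' * q - p * q' = 1"
  shows "u' * g - u * g' = (p' * u - p * u') * (q' * g - q * g') - (q' * u - q * u') * (p' * g - p * g')"
proof -
  have "(p' * u - p * u') * (q' * g - q * g') - (q' * u - q * u') * (p' * g - p * g')
      = (p' * q - p * q') * (u' * g - u * g')"
    by (simp add: algebra_simps)
  then show ?thesis
    using assms by simp
qed

text \<open>
  The second derivative \<open>- \<tau> g - g / (4 x\<^sup>2)\<close> is bounded by \<open>|\<tau> g|\<^sup>2 + |g|\<^sup>2 + 2\<close> on \<open>[1,\<infinity>)\<close>, so \<open>D1 g\<close> grows at most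
  linearly and \<open>g\<close> at most quadratically. This suffices against the exponential decay of the Weyl solution.
\<close>

lemma dom_Tmax_growth:
  assumes "g \<in> dom_Tmax"
  obtains C where "\<And>x. 1 \<le> x \<Longrightarrow> cmod (D1 g x) \<le> C * x" "\<And>x. 1 \<le> x \<Longrightarrow> cmod (g x) \<le> C * x\<^sup>2"
proof -
  note g = dom_TmaxD[OF assms]
  let ?b = "\<lambda>x. (cmod (tau0 g x))\<^sup>2 + (cmod (g x))\<^sup>2"
  have b: "integrable half_line ?b"
    using g(2,3) by (auto simp: square_integrable_def)
  have b0: "?b integrable_on {0<..}"
    using b integrable_half_line_restrict[OF b order_refl] by (auto simp: absolutely_integrable_on_def)
  define S where "S = integral {0<..} ?b"
  have S0: "S \<ge> 0"
    unfolding S_def by (intro Henstock_Kurzweil_Integration.integral_nonneg b0) auto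
  have D: "cmod (D1 g x) \<le> (cmod (D1 g 1) + S + 2) * x" if x: "1 \<le> x" for x
  proof -
    have h: "(D1 (D1 g) has_integral D1 g x - D1 g 1) {1..x}"
      using x by (intro AC_loc_has_integral regularD[OF g(1)]) auto
    have "{1..x} \<subseteq> {0<..}"
      by auto
    from integrable_half_line_restrict[OF b this] have bi: "?b integrable_on {1..x}"
      by (simp add: absolutely_integrable_on_def)
    have "norm (integral {1..x} (D1 (D1 g))) \<le> integral {1..x} (\<lambda>t. ?b t + 2)"
    proof (rule integral_norm_bound_integral)
      show "D1 (D1 g) integrable_on {1..x}"
        using h by (rule has_integral_integrable)
      show "(\<lambda>t. ?b t + 2) integrable_on {1..x}"
        by (intro integrable_add bi integrable_const_ivl)
      fix t assume t: "t \<in> {1..x}"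
      have sq: "r \<le> r\<^sup>2 + 1" if "0 \<le> r" for r :: real
      proof -
        have "0 \<le> (r - 1 / 2)\<^sup>2"
          by simp
        then show ?thesis
          unfolding power2_diff by (simp add: power2_eq_square)
      qed
      have t4: "1 / (4 * t\<^sup>2) \<le> 1" "0 \<le> 1 / (4 * t\<^sup>2)"
        using t by (auto simp: field_simps intro: order_trans[of _ 4])
      have "D1 (D1 g) t = - tau0 g t - of_real (1 / (4 * t\<^sup>2)) * g t"
        by (simp add: tau0_def)
      then have "cmod (D1 (D1 g) t) \<le> cmod (tau0 g t) + cmod (of_real (1 / (4 * t\<^sup>2)) * g t)"
        by (metis norm_minus_cancel norm_triangle_ineq4)
      also have "cmod (of_real (1 / (4 * t\<^sup>2)) * g t) \<le> 1 * cmod (g t)"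
        unfolding norm_mult norm_of_real using t4 by (intro mult_right_mono) auto
      finally show "norm (D1 (D1 g) t) \<le> ?b t + 2"
        using sq[of "cmod (tau0 g t)"] sq[of "cmod (g t)"] by simp
    qed
    also have "\<dots> = integral {1..x} ?b + 2 * (x - 1)"
      using x by (subst Henstock_Kurzweil_Integration.integral_add[OF bi integrable_const_ivl]) (simp add: mult.commute)
    also have "integral {1..x} ?b \<le> S"
      unfolding S_def by (intro integral_subset_le bi b0) auto
    finally have "cmod (D1 g x - D1 g 1) \<le> S + 2 * (x - 1)"
      using integral_unique[OF h] by simp
    moreover have "cmod (D1 g x) \<le> cmod (D1 g 1) + cmod (D1 g x - D1 g 1)"
      by (metis add.commute diff_add_cancel norm_triangle_ineq)
    ultimately have "cmod (D1 g x) \<le> (cmod (D1 g 1) + S) * 1 + 2 * x"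
      by simp
    also have "\<dots> \<le> (cmod (D1 g 1) + S) * x + 2 * x"
      using x S0 by (intro add_right_mono mult_left_mono) auto
    finally show ?thesis
      by (simp add: algebra_simps)
  qed
  define C where "C = cmod (D1 g 1) + S + 2"
  have C0: "C \<ge> 0"
    using S0 by (simp add: C_def)
  have G: "cmod (g x) \<le> (cmod (g 1) + C) * x\<^sup>2" if x: "1 \<le> x" for x
  proof -
    have h: "(D1 g has_integral g x - g 1) {1..x}"
      using x by (intro AC_loc_has_integral regularD[OF g(1)]) auto
    have "norm (g x - g 1) \<le> (C * x) * measure lborel {1..x}"
    proof (rule has_integral_bound_real[OF _ _ h])
      show "0 \<le> C * x"
        using C0 x by simp
      show "finite ({}::real set)"
        by simp
      fix t assume "t \<in> {1..x} - {}"
      then have "cmod (D1 g t) \<le> C * t" "C * t \<le> C * x"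
        using D[of t] C0 by (auto simp: C_def intro: mult_left_mono)
      then show "norm (D1 g t) \<le> C * x"
        by simp
    qed
    also have "\<dots> \<le> C * x * x"
      using C0 x by (intro mult_left_mono) auto
    finally have "cmod (g x) \<le> cmod (g 1) * 1 + C * x\<^sup>2"
      using norm_triangle_ineq[of "g 1" "g x - g 1"] by (simp add: power2_eq_square mult.assoc)
    also have "\<dots> \<le> cmod (g 1) * x\<^sup>2 + C * x\<^sup>2"
      using x by (intro add_right_mono mult_left_mono) auto
    finally show ?thesis
      by (simp add: distrib_right)
  qed
  show ?thesis
  proof (rule that[of "cmod (g 1) + C"])
    fix x :: real assume x: "1 \<le> x"
    have "C * x \<le> (cmod (g 1) + C) * x"
      using x by (intro mult_right_mono) auto
    then show "cmod (D1 g x) \<le> (cmod (g 1) + C) * x"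
      using D[OF x] by (simp add: C_def)
    show "cmod (g x) \<le> (cmod (g 1) + C) * x\<^sup>2"
      by (rule G[OF x])
  qed
qed

section \<open>Square-integrable solutions at nonnegative spectral parameters\<close>

text \<open>
  Put \<open>G = \<surd>x k\<close> and \<open>m = x k'\<close>. The energy \<open>F = m\<^sup>2 + \<mu> (x k)\<^sup>2\<close> has derivative \<open>2 \<mu> x k\<^sup>2 \<ge> 0\<close>. If \<open>F\<close> is positive at
  some point, then, as \<open>(k m)' = (m\<^sup>2 - \<mu> (x k)\<^sup>2) / x = F / x - 2 \<mu> G\<^sup>2\<close> and \<open>G\<^sup>2\<close> is integrable, \<open>k m\<close> grows at
  least like a logarithm. So \<open>k\<^sup>2\<close> is eventually increasing, and \<open>G\<^sup>2 = x k\<^sup>2\<close> is bounded below by a positive constant,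
  which contradicts integrability. Hence \<open>F = 0\<close>, so \<open>k\<close> is constant, and integrability makes it 0.
  
  The argument covers \<open>\<mu> = 0\<close>, where \<open>F = m\<^sup>2\<close> is constant.
\<close>

lemma no_square_integrable_real_solution:
  fixes G G' :: "real \<Rightarrow> real"
  assumes lam: "\<mu> \<ge> 0"
    and d: "\<And>x. 1 < x \<Longrightarrow> (G has_real_derivative G' x) (at x)"
    and d': "\<And>x. 1 < x \<Longrightarrow> (G' has_real_derivative - (\<mu> + 1 / (4 * x\<^sup>2)) * G x) (at x)"
    and S: "\<And>a b. 1 < a \<Longrightarrow> a \<le> b \<Longrightarrow> integral {a..b} (\<lambda>x. (G x)\<^sup>2) \<le> S"
    and x: "1 < x"
  shows "G x = 0 \<and> G' x = 0"
proof -
  define k where "k x = G x / sqrt x" for x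
  define m where "m x = sqrt x * G' x - G x / (2 * sqrt x)" for x
  have Gk: "G x = sqrt x * k x" if "1 < x" for x
    using that by (simp add: k_def)
  have G2: "(G x)\<^sup>2 = x * (k x)\<^sup>2" if "1 < x" for x
    using that by (simp add: Gk power_mult_distrib)
  have dk: "(k has_real_derivative m x / x) (at x)" if x: "1 < x" for x
  proof -
    have "(k has_real_derivative (G' x * sqrt x - G x * (inverse (sqrt x) / 2)) / (sqrt x * sqrt x)) (at x)"
      unfolding k_def[abs_def] using x by (auto intro!: derivative_eq_intros d)
    moreover have "(G' x * sqrt x - G x * (inverse (sqrt x) / 2)) / (sqrt x * sqrt x) = m x / x"
      using x by (simp add: m_def field_simps)
    ultimately show ?thesis
      by (simp only:)
  qed
  have dm: "(m has_real_derivative - \<mu> * x * k x) (at x)" if x: "1 < x" for x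
  proof -
    define r where "r = sqrt x"
    have r: "r \<noteq> 0" "x = r * r"
      using x by (auto simp: r_def)
    have "(m has_real_derivative (sqrt x * (- (\<mu> + 1 / (4 * x\<^sup>2)) * G x) + (inverse (sqrt x) / 2) * G' x)
        - (G' x * (2 * sqrt x) - G x * (2 * (inverse (sqrt x) / 2))) / (2 * sqrt x * (2 * sqrt x))) (at x)"
      unfolding m_def[abs_def] using x by (auto intro!: derivative_eq_intros d d')
    moreover have "(sqrt x * (- (\<mu> + 1 / (4 * x\<^sup>2)) * G x) + (inverse (sqrt x) / 2) * G' x)
        - (G' x * (2 * sqrt x) - G x * (2 * (inverse (sqrt x) / 2))) / (2 * sqrt x * (2 * sqrt x)) = - \<mu> * x * k x"
      unfolding k_def r_def[symmetric] unfolding r(2) using r(1) by (simp add: field_simps power2_eq_square)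
    ultimately show ?thesis
      by (simp only:)
  qed
  define F where "F x = (m x)\<^sup>2 + \<mu> * (x * k x)\<^sup>2" for x
  have dF: "(F has_real_derivative 2 * \<mu> * x * (k x)\<^sup>2) (at x)" if x: "1 < x" for x
  proof -
    have "(F has_real_derivative of_nat 2 * (- \<mu> * x * k x * m x ^ (2 - Suc 0))
        + \<mu> * (of_nat 2 * ((x * (m x / x) + 1 * k x) * (x * k x) ^ (2 - Suc 0)))) (at x)"
      unfolding F_def[abs_def]
      by (intro DERIV_add DERIV_cmult DERIV_power DERIV_mult' DERIV_ident dk dm x)
    moreover have "of_nat 2 * (- \<mu> * x * k x * m x ^ (2 - Suc 0))
        + \<mu> * (of_nat 2 * ((x * (m x / x) + 1 * k x) * (x * k x) ^ (2 - Suc 0))) = 2 * \<mu> * x * (k x)\<^sup>2"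
      using x by (simp add: power2_eq_square algebra_simps)
    ultimately show ?thesis
      by (simp only:)
  qed
  have Fmono: "F x \<le> F y" if "1 < x" "x \<le> y" for x y
  proof (rule DERIV_nonneg_imp_nondecreasing[OF that(2)])
    fix t assume t: "x \<le> t" "t \<le> y"
    then have "1 < t"
      using that by simp
    moreover have "0 \<le> 2 * \<mu> * t * (k t)\<^sup>2"
      using lam \<open>1 < t\<close> by simp
    ultimately show "\<exists>D. (F has_real_derivative D) (at t) \<and> 0 \<le> D"
      using dF by blast
  qed
  have cG: "continuous_on A G" if "A \<subseteq> {1<..}" for A
  proof (rule continuous_at_imp_continuous_on, rule ballI)
    show "isCont G x" if "x \<in> A" for x
      using \<open>A \<subseteq> {1<..}\<close> that by (intro DERIV_isCont[OF d]) auto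
  qed
  \<comment> \<open>A positive lower bound \<open>n\<close> for \<open>G\<^sup>2\<close> from some point on contradicts the bound \<open>S\<close> on the integrals.\<close>
  have large: False if n: "0 < n" and le: "\<And>x. x1 \<le> x \<Longrightarrow> n \<le> (G x)\<^sup>2" and x1: "1 < x1" for n x1
  proof -
    define T where "T = (\<bar>S\<bar> + 1) / n"
    have T: "0 < T" "n * T = \<bar>S\<bar> + 1"
      using n by (auto simp: T_def)
    have c: "continuous_on {x1..x1 + T} (\<lambda>x. (G x)\<^sup>2)"
      using x1 by (intro continuous_on_power cG) auto
    have "integral {x1..x1 + T} (\<lambda>x. n) \<le> integral {x1..x1 + T} (\<lambda>x. (G x)\<^sup>2)"
      by (intro integral_le integrable_continuous_interval c) (use le in auto)
    also have "\<dots> \<le> S"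
      using x1 T by (intro S) auto
    finally show False
      using T by (simp add: mult.commute)
  qed
  have F0: "F x0 = 0" if x0: "1 < x0" for x0
  proof (rule ccontr)
    assume "F x0 \<noteq> 0"
    moreover have "F x0 \<ge> 0"
      using lam by (simp add: F_def)
    ultimately have c: "F x0 > 0"
      by simp
    define I where "I y = integral {x0..y} (\<lambda>x. (G x)\<^sup>2)" for y
    have dI: "(I has_real_derivative (G y)\<^sup>2) (at y)" if y: "x0 < y" for y
    proof -
      have "continuous_on {x0..y + 1} (\<lambda>x. (G x)\<^sup>2)"
        using x0 by (intro continuous_on_power cG) auto
      then have "(I has_real_derivative (G y)\<^sup>2) (at y within {x0..y + 1})"
        unfolding I_def[abs_def] using y by (intro integral_has_real_derivative) auto
      then show ?thesis
        using y by (simp add: at_within_Icc_at)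
    qed
    \<comment> \<open>The derivative of \<open>h\<close> is \<open>(F y - F x0) / y\<close>, so monotonicity of \<open>F\<close> bounds \<open>h\<close> from below.\<close>
    define h where "h y = k y * m y - F x0 * ln y + 2 * \<mu> * I y" for y
    define x1 where "x1 = x0 + 1"
    have dh: "(h has_real_derivative (F y - F x0) / y) (at y)" if y: "x0 < y" for y
    proof -
      have y1: "1 < y" "y \<noteq> 0"
        using y x0 by auto
      have "(h has_real_derivative (k y * (- \<mu> * y * k y) + m y / y * m y) - F x0 * (1 / y) + 2 * \<mu> * (G y)\<^sup>2) (at y)"
        unfolding h_def[abs_def] using y y1 by (auto intro!: derivative_eq_intros dk dm dI)
      moreover have "(k y * (- \<mu> * y * k y) + m y / y * m y) - F x0 * (1 / y) + 2 * \<mu> * (G y)\<^sup>2 = (F y - F x0) / y"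
        unfolding G2[OF y1(1)] F_def[of y] using y1 by (simp add: field_simps power2_eq_square)
      ultimately show ?thesis
        by (simp only:)
    qed
    have hmono: "h x1 \<le> h y" if "x1 \<le> y" for y
    proof (rule DERIV_nonneg_imp_nondecreasing[OF that])
      fix t assume t: "x1 \<le> t" "t \<le> y"
      then have "x0 < t"
        by (simp add: x1_def)
      moreover then have "0 \<le> (F t - F x0) / t"
        using Fmono[OF x0, of t] x0 by simp
      ultimately show "\<exists>D. (h has_real_derivative D) (at t) \<and> 0 \<le> D"
        using dh by blast
    qed
    define A where "A = h x1 - 2 * \<mu> * \<bar>S\<bar>"
    have R: "k y * m y \<ge> F x0 * ln y + A" if y: "x1 \<le> y" for y
    proof -
      have "I y \<le> \<bar>S\<bar>"
        unfolding I_def using S[of x0 y] x0 y by (auto simp: x1_def)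
      then have "2 * \<mu> * I y \<le> 2 * \<mu> * \<bar>S\<bar>"
        using lam by (intro mult_left_mono) auto
      then show ?thesis
        using hmono[OF y] by (simp add: h_def A_def)
    qed
    \<comment> \<open>From this point on the logarithmic lower bound for \<open>k m\<close> exceeds 1.\<close>
    define x2 where "x2 = max x1 (exp ((1 + \<bar>A\<bar>) / F x0))"
    have R1: "k y * m y \<ge> 1" if y: "x2 \<le> y" for y
    proof -
      have "exp ((1 + \<bar>A\<bar>) / F x0) \<le> y"
        using y by (simp add: x2_def)
      then have "(1 + \<bar>A\<bar>) / F x0 \<le> ln y"
        by (metis exp_gt_zero ln_exp ln_mono order_less_le_trans)
      then have "1 + \<bar>A\<bar> \<le> F x0 * ln y"
        using c by (simp add: field_simps)
      then show ?thesis
        using R[of y] y by (simp add: x2_def)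
    qed
    have x2: "1 < x2"
      using x0 by (auto simp: x2_def x1_def)
    have kmono: "(k x2)\<^sup>2 \<le> (k y)\<^sup>2" if "x2 \<le> y" for y
    proof (rule DERIV_nonneg_imp_nondecreasing[OF that])
      fix t assume t: "x2 \<le> t" "t \<le> y"
      have "((\<lambda>x. (k x)\<^sup>2) has_real_derivative 2 * k t * (m t / t)) (at t)"
        using t x2 by (auto intro!: derivative_eq_intros dk)
      moreover have "0 \<le> 2 * k t * (m t / t)"
        using R1[of t] t x2 by simp
      ultimately show "\<exists>D. ((\<lambda>x. (k x)\<^sup>2) has_real_derivative D) (at t) \<and> 0 \<le> D"
        by blast
    qed
    show False
    proof (rule large[of "(k x2)\<^sup>2" x2])
      show "0 < (k x2)\<^sup>2"
        using R1[of x2] by auto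
      show "(k x2)\<^sup>2 \<le> (G y)\<^sup>2" if "x2 \<le> y" for y
      proof -
        have "1 * (k x2)\<^sup>2 \<le> y * (k y)\<^sup>2"
          using kmono[OF that] that x2 by (intro mult_mono) auto
        then show ?thesis
          using that x2 by (simp add: G2)
      qed
    qed (rule x2)
  qed
  have m0: "m x = 0" if "1 < x" for x
  proof -
    have "(m x)\<^sup>2 \<le> F x"
      using lam by (simp add: F_def)
    then show ?thesis
      using F0[OF that] by simp
  qed
  have kconst: "k y = k 2" if y: "1 < y" for y
  proof -
    have "\<exists>c. \<forall>x\<in>{1<..}. k x = c"
    proof (rule has_field_derivative_zero_constant)
      show "(k has_real_derivative 0) (at x within {1<..})" if "x \<in> {1<..}" for x
        using dk[of x] m0[of x] that by (auto intro: has_field_derivative_at_within)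
    qed simp
    then show ?thesis
      using y by force
  qed
  have "k 2 = 0"
  proof (rule ccontr)
    assume "k 2 \<noteq> 0"
    show False
    proof (rule large[of "(k 2)\<^sup>2" 2])
      show "(k 2)\<^sup>2 \<le> (G y)\<^sup>2" if "2 \<le> y" for y
      proof -
        have "1 * (k 2)\<^sup>2 \<le> y * (k 2)\<^sup>2"
          using that by (intro mult_right_mono) auto
        then show ?thesis
          using that kconst[of y] by (simp add: G2)
      qed
    qed (use \<open>k 2 \<noteq> 0\<close> in auto)
  qed
  then have "G x = 0"
    using kconst[OF x] Gk[OF x] by simp
  moreover have "G' x = 0"
    using m0[OF x] x \<open>G x = 0\<close> by (simp add: m_def)
  ultimately show ?thesis
    by simp
qed

text \<open>
  Beyond 1 the second derivative agrees almost everywhere with a continuous function, so \<open>D1 g\<close> is continuously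
  differentiable there and the estimate for real solutions applies to the real and the imaginary part of \<open>g\<close>.
\<close>

lemma dom_Tmax_solution_vanishes:
  assumes lam: "\<mu> \<ge> 0" and g: "g \<in> dom_Tmax"
    and eq: "AE x in half_line. 1 < x \<longrightarrow> tau0 g x = of_real \<mu> * g x" and x: "1 < x"
  shows "g x = 0 \<and> D1 g x = 0"
proof -
  note g' = dom_TmaxD[OF g]
  note r = regularD[OF g'(1)]
  let ?c = "\<lambda>x. - (of_real \<mu> + of_real (1 / (4 * x\<^sup>2))) * g x"
  have cont: "continuous_on {0<..} g"
    using r(3) by (auto intro!: continuous_at_imp_continuous_on has_vector_derivative_continuous)
  obtain N where N: "negligible N" "\<And>x. 0 < x \<Longrightarrow> x \<notin> N \<Longrightarrow> 1 < x \<longrightarrow> tau0 g x = of_real \<mu> * g x"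
    using AE_half_line_negligible[OF eq] by blast
  have d2: "(D1 g has_vector_derivative ?c x) (at x)" if x: "1 < x" for x
  proof -
    have cc: "continuous_on {1..x + 1} ?c"
      by (intro continuous_intros continuous_on_subset[OF cont]) auto
    have I: "integral {1..y} ?c = D1 g y - D1 g 1" if y: "1 < y" for y
    proof (rule integral_unique, rule has_integral_spike[of "insert 1 N"])
      show "(D1 (D1 g) has_integral D1 g y - D1 g 1) {1..y}"
        using y by (intro AC_loc_has_integral r) auto
      show "negligible (insert 1 N)"
        using N(1) by simp
      fix t assume t: "t \<in> {1..y} - insert 1 N"
      then have "1 < t" "tau0 g t = of_real \<mu> * g t"
        using N(2)[of t] by auto
      then have "- D1 (D1 g) t - of_real (1 / (4 * t\<^sup>2)) * g t = of_real \<mu> * g t"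
        by (simp only: tau0_def)
      then show "?c t = D1 (D1 g) t"
        by algebra
    qed
    have "((\<lambda>y. integral {1..y} ?c) has_vector_derivative ?c x) (at x within {1..x + 1})"
      using x by (intro integral_has_vector_derivative cc) auto
    then have "((\<lambda>y. integral {1..y} ?c) has_vector_derivative ?c x) (at x)"
      using x by (simp add: at_within_Icc_at)
    then have "((\<lambda>y. integral {1..y} ?c + D1 g 1) has_vector_derivative ?c x) (at x)"
      by (auto intro!: derivative_eq_intros)
    then show ?thesis
      by (rule has_vector_derivative_transform_within_open[of _ _ _ "{1<..}"]) (use x I in auto)
  qed
  have sq: "integrable half_line (\<lambda>x. (cmod (g x))\<^sup>2)"
    using g'(2) by (simp add: square_integrable_def)
  have "{0<..} \<subseteq> {0::real<..}" by simp
  from integrable_half_line_restrict[OF sq this] have sq0: "(\<lambda>x. (cmod (g x))\<^sup>2) integrable_on {0<..}"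
    by (simp add: absolutely_integrable_on_def)
  \<comment> \<open>To be used with the real and the imaginary part in place of \<open>p\<close>.\<close>
  have part: "p (g x) = 0 \<and> p (D1 g x) = 0"
    if p: "bounded_linear p" "\<And>c u. p (of_real c * u) = c * p u" "\<And>u. (p u)\<^sup>2 \<le> (cmod u)\<^sup>2" for p :: "complex \<Rightarrow> real"
  proof (rule no_square_integrable_real_solution[OF lam _ _ _ x])
    show "((\<lambda>x. p (g x)) has_real_derivative p (D1 g x)) (at x)" if "1 < x" for x
      unfolding has_real_derivative_iff_has_vector_derivative
      using that by (intro bounded_linear.has_vector_derivative[OF p(1)] r) auto
    show "((\<lambda>x. p (D1 g x)) has_real_derivative - (\<mu> + 1 / (4 * x\<^sup>2)) * p (g x)) (at x)" if "1 < x" for x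
    proof -
      have "((\<lambda>x. p (D1 g x)) has_real_derivative p (?c x)) (at x)"
        unfolding has_real_derivative_iff_has_vector_derivative
        using that by (intro bounded_linear.has_vector_derivative[OF p(1)] d2) auto
      moreover have "?c x = of_real (- (\<mu> + 1 / (4 * x\<^sup>2))) * g x"
        by simp
      ultimately show ?thesis
        by (simp only: p(2))
    qed
    show "integral {a..b} (\<lambda>x. (p (g x))\<^sup>2) \<le> integral {0<..} (\<lambda>x. (cmod (g x))\<^sup>2)" if "1 < a" "a \<le> b" for a b
    proof -
      have ca: "continuous_on {a..b} (\<lambda>x. (cmod (g x))\<^sup>2)"
        using that by (intro continuous_intros continuous_on_subset[OF cont]) auto
      have "continuous_on {a..b} (\<lambda>x. (p (g x))\<^sup>2)"
        using that by (intro continuous_intros bounded_linear.continuous_on[OF p(1)] continuous_on_subset[OF cont]) auto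
      then have "integral {a..b} (\<lambda>x. (p (g x))\<^sup>2) \<le> integral {a..b} (\<lambda>x. (cmod (g x))\<^sup>2)"
        by (intro integral_le integrable_continuous_interval ca p(3))
      also have "\<dots> \<le> integral {0<..} (\<lambda>x. (cmod (g x))\<^sup>2)"
        using that by (intro integral_subset_le sq0 integrable_continuous_interval ca) auto
      finally show ?thesis .
    qed
  qed
  have "(Re u)\<^sup>2 \<le> (cmod u)\<^sup>2" "(Im u)\<^sup>2 \<le> (cmod u)\<^sup>2" for u
    by (simp_all add: cmod_power2)
  then show ?thesis
    using part[OF bounded_linear_Re] part[OF bounded_linear_Im] by (simp add: complex_eq_iff)
qed

section \<open>Boundary values at the origin\<close>

lemma classical_solution_cong:
  assumes "classical_solution z u u'" "\<And>x. 0 < x \<Longrightarrow> u x = v x"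
  shows "classical_solution z v u'"
  unfolding classical_solution_def
proof (intro allI impI conjI)
  fix x :: real assume x: "0 < x"
  then have "(u has_vector_derivative u' x) (at x)"
    using assms(1) by (simp add: classical_solution_def)
  then show "(v has_vector_derivative u' x) (at x)"
    by (rule has_vector_derivative_pos_cong) (use assms(2) x in auto)
  show "(u' has_vector_derivative - (z + of_real (1 / (4 * x\<^sup>2))) * v x) (at x)"
    using assms x by (simp add: classical_solution_def)
qed

text \<open>
  The fundamental system of \<open>\<tau> u = 0\<close> that prescribes \<open>\<phi>\<close> and \<open>\<psi>\<close> near 0, continued to the whole half-line.
\<close>

definition phi0 :: "real \<Rightarrow> complex" where "phi0 x = of_real (sqrt x)"
definition phi0' :: "real \<Rightarrow> complex" where "phi0' x = of_real (1 / (2 * sqrt x))"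
definition psi0 :: "real \<Rightarrow> complex" where "psi0 x = of_real (- sqrt x * ln x)"
definition psi0' :: "real \<Rightarrow> complex" where
  "psi0' x = of_real (1 / (2 * sqrt x)) * of_real (- ln x) + of_real (sqrt x) * of_real (- 1 / x)"

lemma phi0_solution: "classical_solution 0 phi0 phi0'"
proof -
  have "classical_solution 0 (\<lambda>x. of_real (sqrt x) * 1) (\<lambda>x. of_real (1 / (2 * sqrt x)) * 1 + of_real (sqrt x) * 0)"
    by (rule classical_solution_sqrt_times) auto
  then show ?thesis
    by (simp add: phi0_def[abs_def] phi0'_def[abs_def])
qed

lemma psi0_solution: "classical_solution 0 psi0 psi0'"
proof -
  have "classical_solution 0 (\<lambda>x. of_real (sqrt x) * of_real (- ln x)) psi0'"
    unfolding psi0'_def[abs_def]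
  proof (rule classical_solution_sqrt_times)
    fix x :: real assume x: "0 < x"
    show "((\<lambda>x. complex_of_real (- ln x)) has_vector_derivative of_real (- 1 / x)) (at x)"
      using x by (intro of_real_has_vector_derivative) (auto intro!: derivative_eq_intros)
    have "((\<lambda>x. complex_of_real (- 1 / x)) has_vector_derivative of_real (1 / x\<^sup>2)) (at x)"
      using x by (intro of_real_has_vector_derivative) (auto intro!: derivative_eq_intros simp: power2_eq_square)
    then show "((\<lambda>x. complex_of_real (- 1 / x)) has_vector_derivative - 0 * of_real (- ln x) - of_real (- 1 / x) / of_real x) (at x)"
      by (simp add: power2_eq_square)
  qed
  then show ?thesis
    by (rule classical_solution_cong) (simp add: psi0_def)
qed

lemma fundamental_Wronskian:
  assumes "0 < x"
  shows "phi0' x * psi0 x - phi0 x * psi0' x = 1"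
proof -
  define r where "r = sqrt x"
  have r: "r \<noteq> 0" "x = r * r"
    using assms by (auto simp: r_def)
  have "phi0' x * psi0 x - phi0 x * psi0' x
      = of_real (1 / (2 * r) * (- r * ln x) - r * (1 / (2 * r) * - ln x + r * (- 1 / (r * r))))"
    unfolding phi0_def phi0'_def psi0_def psi0'_def r_def
    using assms by simp
  also have "1 / (2 * r) * (- r * ln x) - r * (1 / (2 * r) * - ln x + r * (- 1 / (r * r))) = 1"
    using r(1) by (simp add: field_simps)
  finally show ?thesis
    by simp
qed

text \<open>
  For \<open>g = \<surd>x k\<close> the brackets with the fundamental system reduce to \<open>- x k'\<close> and \<open>ln x \<cdot> x k' - k\<close>, for which the
  limits of Bessel functions at 0 are known.
\<close>

lemma boundary_forms_sqrt_times:
  fixes k k' :: "real \<Rightarrow> complex"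
  assumes x: "0 < x"
  defines "g \<equiv> of_real (sqrt x) * k x"
    and "g' \<equiv> of_real (1 / (2 * sqrt x)) * k x + of_real (sqrt x) * k' x"
  shows "phi0' x * g - phi0 x * g' = - (of_real x * k' x)"
    "psi0' x * g - psi0 x * g' = of_real (ln x) * (of_real x * k' x) - k x"
proof -
  define r where "r = complex_of_real (sqrt x)"
  define l where "l = complex_of_real (ln x)"
  have r: "r \<noteq> 0" "complex_of_real x = r * r"
    using x by (simp_all add: r_def flip: of_real_mult)
  have "phi0' x * g - phi0 x * g' = 1 / (2 * r) * (r * k x) - r * (1 / (2 * r) * k x + r * k' x)"
    unfolding phi0_def phi0'_def g_def g'_def r_def by simp
  also have "\<dots> = - (of_real x * k' x)"
    unfolding r(2) using r(1) by (simp add: field_simps)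
  finally show "phi0' x * g - phi0 x * g' = - (of_real x * k' x)" .
  have "psi0' x * g - psi0 x * g'
      = (1 / (2 * r) * - l + r * (- 1 / of_real x)) * (r * k x) - (- r * l) * (1 / (2 * r) * k x + r * k' x)"
    unfolding psi0_def psi0'_def g_def g'_def r_def l_def by simp
  also have "\<dots> = l * (of_real x * k' x) - k x"
    unfolding r(2) using r(1) by (simp add: field_simps)
  finally show "psi0' x * g - psi0 x * g' = of_real (ln x) * (of_real x * k' x) - k x"
    by (simp add: l_def)
qed

locale boundary_pair =
  fixes \<phi> \<psi> :: "real \<Rightarrow> complex"
  assumes phi: "\<phi> \<in> dom_Tmax" and psi: "\<psi> \<in> dom_Tmax"
    and phi_eq: "\<And>x. 0 < x \<Longrightarrow> x < 1 \<Longrightarrow> \<phi> x = of_real (sqrt x)"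
    and psi_eq: "\<And>x. 0 < x \<Longrightarrow> x < 1 \<Longrightarrow> \<psi> x = of_real (- sqrt x * ln x)"
begin

lemma bracket_near_0:
  assumes u: "classical_solution 0 u u'" and eq: "\<And>x. 0 < x \<Longrightarrow> x < 1 \<Longrightarrow> \<eta> x = u x"
    and real: "\<And>x. 0 < x \<Longrightarrow> u x \<in> \<real>" "\<And>x. 0 < x \<Longrightarrow> u' x \<in> \<real>"
    and x: "0 < x" "x < 1"
  shows "bracket g \<eta> x = u' x * g x - u x * D1 g x"
proof -
  have "(u has_vector_derivative u' x) (at x)"
    using u x by (simp add: classical_solution_def)
  then have "(\<eta> has_vector_derivative u' x) (at x)"
    by (rule has_vector_derivative_transform_within_open[of _ _ _ "{0<..<1}"]) (use eq x in auto)
  then have "D1 \<eta> x = u' x"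
    by (rule vector_derivative_at)
  moreover have "cnj (u' x) = u' x" "cnj (u x) = u x"
    using real x by (auto simp: Reals_cnj_iff)
  ultimately show ?thesis
    using eq[OF x] by (simp add: bracket_def mult.commute)
qed

lemma phi0_real: "phi0 x \<in> \<real>" "phi0' x \<in> \<real>" "psi0 x \<in> \<real>" "psi0' x \<in> \<real>"
  by (auto simp: phi0_def phi0'_def psi0_def psi0'_def)

lemma bracket_phi: "0 < x \<Longrightarrow> x < 1 \<Longrightarrow> bracket g \<phi> x = phi0' x * g x - phi0 x * D1 g x"
  by (rule bracket_near_0[OF phi0_solution]) (auto simp: phi_eq phi0_def phi0'_def)

lemma bracket_psi: "0 < x \<Longrightarrow> x < 1 \<Longrightarrow> bracket g \<psi> x = psi0' x * g x - psi0 x * D1 g x"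
  by (rule bracket_near_0[OF psi0_solution])
     (use phi0_real in \<open>auto simp: psi_eq psi0_def psi0'_def\<close>)

lemma eventually_unit: "\<forall>\<^sub>F x in at_right (0::real). 0 < x \<and> x < 1"
  by (rule eventually_at_rightI[of 0 1]) auto

lemma bracket0_eq:
  assumes "((\<lambda>x. u' x * g x - u x * D1 g x) \<longlongrightarrow> l) (at_right 0)"
    and "\<And>x. 0 < x \<Longrightarrow> x < 1 \<Longrightarrow> bracket g \<eta> x = u' x * g x - u x * D1 g x"
  shows "bracket0 g \<eta> = l"
proof -
  have "(bracket g \<eta> \<longlongrightarrow> l) (at_right 0)"
    by (rule Lim_transform_eventually[OF assms(1)])
       (use eventually_unit in \<open>eventually_elim, simp add: assms(2)\<close>)
  then show ?thesis
    unfolding bracket0_def by (intro tendsto_Lim) auto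
qed

text \<open>
  \<open>bracket0\<close> is a choice of limit and says something only once the limit exists. It exists because \<open>\<phi>\<close> and \<open>\<psi>\<close> are
  square integrable and coincide near 0 with solutions for \<open>z = 0\<close>, so that the Lagrange identity applies up to 0.
\<close>

lemma bracket0_tendsto:
  assumes g: "g \<in> dom_Tmax"
  shows "((\<lambda>x. phi0' x * g x - phi0 x * D1 g x) \<longlongrightarrow> bracket0 g \<phi>) (at_right 0)"
    "((\<lambda>x. psi0' x * g x - psi0 x * D1 g x) \<longlongrightarrow> bracket0 g \<psi>) (at_right 0)"
proof -
  have *: "((\<lambda>x. u' x * g x - u x * D1 g x) \<longlongrightarrow> bracket0 g \<eta>) (at_right 0)"
    if u: "classical_solution 0 u u'" and sq: "square_integrable \<eta>" and eq: "\<And>x. 0 < x \<Longrightarrow> x < 1 \<Longrightarrow> \<eta> x = u x"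
      and br: "\<And>x. 0 < x \<Longrightarrow> x < 1 \<Longrightarrow> bracket g \<eta> x = u' x * g x - u x * D1 g x" for u u' \<eta>
  proof -
    have "integrable half_line (\<lambda>x. (indicator {0<..1 / 2} x * \<eta> x) * tau0 g x)"
      by (intro integrable_product square_integrable_indicator sq dom_TmaxD g) auto
    moreover have "(indicator {0<..1 / 2} x * \<eta> x) * tau0 g x = indicator {0<..1 / 2} x * u x * (tau0 g x - 0 * g x)" for x
      using eq[of x] by (auto simp: indicator_def)
    ultimately have "integrable half_line (\<lambda>x. indicator {0<..1 / 2} x * u x * (tau0 g x - 0 * g x))"
      by simp
    then obtain l where l: "((\<lambda>x. u' x * g x - u x * D1 g x) \<longlongrightarrow> l) (at_right 0)"
      using Wronskian_tendsto_0[OF u dom_TmaxD(1)[OF g], of "1 / 2"] by auto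
    with bracket0_eq[OF l br] show ?thesis
      by simp
  qed
  show "((\<lambda>x. phi0' x * g x - phi0 x * D1 g x) \<longlongrightarrow> bracket0 g \<phi>) (at_right 0)"
    by (rule *[OF phi0_solution dom_TmaxD(2)[OF phi]]) (auto simp: phi_eq phi0_def bracket_phi)
  show "((\<lambda>x. psi0' x * g x - psi0 x * D1 g x) \<longlongrightarrow> bracket0 g \<psi>) (at_right 0)"
    by (rule *[OF psi0_solution dom_TmaxD(2)[OF psi]]) (auto simp: psi_eq psi0_def bracket_psi)
qed

text \<open>
  The Pluecker relation with the fundamental system as \<open>p\<close> and \<open>q\<close>.
\<close>

lemma Wronskian_limit_0:
  assumes g: "g \<in> dom_Tmax"
    and a: "((\<lambda>x. phi0' x * u x - phi0 x * u' x) \<longlongrightarrow> a) (at_right 0)"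
    and b: "((\<lambda>x. psi0' x * u x - psi0 x * u' x) \<longlongrightarrow> b) (at_right 0)"
  shows "((\<lambda>x. u' x * g x - u x * D1 g x) \<longlongrightarrow> a * bracket0 g \<psi> - b * bracket0 g \<phi>) (at_right 0)"
proof (rule Lim_transform_eventually)
  show "((\<lambda>x. (phi0' x * u x - phi0 x * u' x) * (psi0' x * g x - psi0 x * D1 g x)
      - (psi0' x * u x - psi0 x * u' x) * (phi0' x * g x - phi0 x * D1 g x))
      \<longlongrightarrow> a * bracket0 g \<psi> - b * bracket0 g \<phi>) (at_right 0)"
    by (intro tendsto_intros a b bracket0_tendsto g)
  show "\<forall>\<^sub>F x in at_right 0.
      (phi0' x * u x - phi0 x * u' x) * (psi0' x * g x - psi0 x * D1 g x)
      - (psi0' x * u x - psi0 x * u' x) * (phi0' x * g x - phi0 x * D1 g x)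
      = u' x * g x - u x * D1 g x"
    using eventually_unit
  proof eventually_elim
    case (elim x)
    then show ?case
      using Pluecker[OF fundamental_Wronskian[of x], where u = "u x" and u' = "u' x" and g = "g x" and g' = "D1 g x"] by simp
  qed
qed

end

section \<open>Bessel functions as solutions on the half-line\<close>

lemma square_integrable_of_decay:
  fixes f :: "real \<Rightarrow> complex"
  assumes c: "continuous_on {0<..} f" and l0: "(f \<longlongrightarrow> 0) (at_right 0)"
    and a: "0 < a" and decay: "\<And>x. 1 \<le> x \<Longrightarrow> cmod (f x) \<le> M * x * exp (- a * x)"
  shows "square_integrable f"
proof -
  have "\<forall>\<^sub>F x in at_right 0. cmod (f x) < 1"
    using tendstoD[OF l0, of 1] by (simp add: dist_norm)
  then obtain d where d: "d > 0" "\<And>x. 0 < x \<Longrightarrow> x < d \<Longrightarrow> cmod (f x) < 1"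
    unfolding eventually_at_right_field by auto
  have "bounded (f ` {d..1})"
    using d(1) by (intro compact_imp_bounded compact_continuous_image continuous_on_subset[OF c]) auto
  then obtain B where "\<forall>x\<in>{d..1}. cmod (f x) \<le> B"
    unfolding bounded_iff by auto
  then have B: "cmod (f x) \<le> max B 1" if "0 < x" "x \<le> 1" for x
    using d(2)[of x] that by (cases "x < d") (auto simp: le_max_iff_disj)
  have "M \<ge> 0"
    using order_trans[OF norm_ge_zero decay[of 1]] by (simp add: zero_le_mult_iff)
  define C where "C = (max B 1)\<^sup>2 * exp a + M\<^sup>2 * (2 / a\<^sup>2)"
  show ?thesis
  proof (rule square_integrable_bound[OF c exp_neg_integrable[OF a, of C]])
    fix x :: real assume x: "0 < x"
    have nn: "(max B 1)\<^sup>2 * exp a \<ge> 0" "M\<^sup>2 * (2 / a\<^sup>2) \<ge> 0"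
      using a by auto
    show "(cmod (f x))\<^sup>2 \<le> C * exp (- a * x)"
    proof (cases "x \<le> 1")
      case True
      have "(cmod (f x))\<^sup>2 \<le> (max B 1)\<^sup>2 * 1"
        using B[OF x True] by (simp add: power_mono)
      also have "\<dots> \<le> (max B 1)\<^sup>2 * exp (a - a * x)"
        using True a x by (intro mult_left_mono) (auto simp: mult_left_le)
      also have "\<dots> = (max B 1)\<^sup>2 * exp a * exp (- a * x)"
        by (simp add: exp_add[symmetric])
      also have "\<dots> \<le> C * exp (- a * x)"
        unfolding C_def using nn by (intro mult_right_mono) auto
      finally show ?thesis .
    next
      case False
      have "(a * x)\<^sup>2 \<le> fact 2 * exp (a * x)"
        using a x by (intro power_le_exp) auto
      then have "x\<^sup>2 \<le> 2 / a\<^sup>2 * exp (a * x)"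
        using a by (simp add: power_mult_distrib field_simps fact_numeral)
      then have "x\<^sup>2 * exp (- a * x) \<le> 2 / a\<^sup>2 * exp (a * x) * exp (- a * x)"
        by (intro mult_right_mono) auto
      also have "\<dots> = 2 / a\<^sup>2"
        by (simp add: exp_add[symmetric])
      finally have e: "x\<^sup>2 * exp (- a * x) \<le> 2 / a\<^sup>2" .
      have "(cmod (f x))\<^sup>2 \<le> (M * x * exp (- a * x))\<^sup>2"
        using decay[of x] False by (intro power_mono) auto
      also have "\<dots> = M\<^sup>2 * (x\<^sup>2 * exp (- a * x)) * exp (- a * x)"
        by (simp add: power2_eq_square)
      also have "\<dots> \<le> M\<^sup>2 * (2 / a\<^sup>2) * exp (- a * x)"
        using e by (intro mult_right_mono mult_left_mono) auto
      also have "\<dots> \<le> C * exp (- a * x)"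
        unfolding C_def using nn by (intro mult_right_mono) auto
      finally show ?thesis .
    qed
  qed
qed

lemma square_integrable_near_0:
  fixes f :: "real \<Rightarrow> complex"
  assumes c: "continuous_on {0<..} f" and l0: "(f \<longlongrightarrow> 0) (at_right 0)"
  shows "square_integrable (\<lambda>x. indicator {0<..1} x * f x)"
proof -
  \<comment> \<open>A continuous continuation beyond 1 with exponential decay.\<close>
  define h where "h x = f (min x 1) * of_real (exp (- max (x - 1) 0))" for x
  have "square_integrable h"
  proof (rule square_integrable_of_decay[of _ 1 "cmod (f 1) * exp 1"])
    show "continuous_on {0<..} h"
      unfolding h_def[abs_def]
      by (intro continuous_intros continuous_on_compose2[OF c]) auto
    show "(h \<longlongrightarrow> 0) (at_right 0)"
      by (rule Lim_transform_eventually[OF l0], rule eventually_at_rightI[of 0 1]) (auto simp: h_def)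
    show "cmod (h x) \<le> cmod (f 1) * exp 1 * x * exp (- 1 * x)" if "1 \<le> x" for x
    proof -
      have "h x = f 1 * of_real (exp (1 - x))"
        using that by (simp add: h_def)
      then have "cmod (h x) = cmod (f 1) * exp (1 - x)"
        by (simp only: norm_mult norm_of_real abs_exp_cancel)
      also have "\<dots> = cmod (f 1) * exp 1 * 1 * exp (- x)"
        by (simp add: exp_diff exp_minus field_simps)
      also have "\<dots> \<le> cmod (f 1) * exp 1 * x * exp (- x)"
        using that by (intro mult_right_mono mult_left_mono) auto
      finally show ?thesis
        by simp
    qed
  qed simp
  from square_integrable_indicator[OF this, of "{0<..1}"] have "square_integrable (\<lambda>x. indicator {0<..1} x * h x)"
    by simp
  then show ?thesis
    by (rule square_integrable_cong) (auto simp: h_def indicator_def)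
qed

lemma ray_has_vector_derivative:
  assumes "(f has_field_derivative d) (at (\<kappa> * of_real x))"
  shows "((\<lambda>x. f (\<kappa> * complex_of_real x)) has_vector_derivative \<kappa> * d) (at x)"
proof -
  have "((\<lambda>x. \<kappa> * complex_of_real x) has_vector_derivative \<kappa> * of_real 1) (at x)"
    by (intro has_vector_derivative_mult_right of_real_has_vector_derivative DERIV_ident)
  from field_vector_diff_chain_at[OF this assms] show ?thesis
    by (simp add: comp_def)
qed

text \<open>
  Scaling by \<open>\<kappa>\<close> turns the modified Bessel equation into the equation for \<open>k\<close> with \<open>- z = \<kappa>\<^sup>2\<close>.
\<close>

lemma modified_bessel_classical_solution:
  assumes f: "modified_bessel f f'" and \<kappa>: "Re \<kappa> > 0" "\<kappa>\<^sup>2 = - z"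
  shows "classical_solution z (\<lambda>x. of_real (sqrt x) * f (\<kappa> * of_real x))
    (\<lambda>x. of_real (1 / (2 * sqrt x)) * f (\<kappa> * of_real x) + of_real (sqrt x) * (\<kappa> * f' (\<kappa> * of_real x)))"
proof (rule classical_solution_sqrt_times)
  fix x :: real assume x: "0 < x"
  then have re: "0 < Re (\<kappa> * of_real x)"
    using \<kappa> by simp
  have nz: "\<kappa> \<noteq> 0" "x \<noteq> 0"
    using \<kappa> x by auto
  show "((\<lambda>x. f (\<kappa> * of_real x)) has_vector_derivative \<kappa> * f' (\<kappa> * of_real x)) (at x)"
    using f re by (intro ray_has_vector_derivative) (simp add: modified_bessel_def)
  have "((\<lambda>x. \<kappa> * f' (\<kappa> * of_real x)) has_vector_derivative
      \<kappa> * (\<kappa> * (f (\<kappa> * of_real x) - f' (\<kappa> * of_real x) / (\<kappa> * of_real x)))) (at x)"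
    using f re by (intro has_vector_derivative_mult_right ray_has_vector_derivative) (simp add: modified_bessel_def)
  moreover have "\<kappa> * (\<kappa> * (f (\<kappa> * of_real x) - f' (\<kappa> * of_real x) / (\<kappa> * of_real x)))
      = \<kappa>\<^sup>2 * f (\<kappa> * of_real x) - \<kappa> * f' (\<kappa> * of_real x) / of_real x"
    using nz by (simp add: power2_eq_square right_diff_distrib)
  ultimately show "((\<lambda>x. \<kappa> * f' (\<kappa> * of_real x)) has_vector_derivative
      - z * f (\<kappa> * of_real x) - \<kappa> * f' (\<kappa> * of_real x) / of_real x) (at x)"
    unfolding \<kappa>(2) by simp
qed

text \<open>
  In contrast to the Macdonald function, \<open>I\<close> is entire, so the real part of \<open>\<kappa>\<close> is arbitrary. The case of imaginary
  \<open>\<kappa>\<close> serves the spectral parameters in \<open>[0,\<infinity>)\<close>.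
\<close>

lemma regular_bessel_solution:
  assumes \<kappa>: "\<kappa>\<^sup>2 = - z"
  shows "classical_solution z (\<lambda>x. of_real (sqrt x) * bessel_I (\<kappa> * of_real x))
    (\<lambda>x. of_real (1 / (2 * sqrt x)) * bessel_I (\<kappa> * of_real x) + of_real (sqrt x) * (\<kappa> * bessel_I' (\<kappa> * of_real x)))"
proof (rule classical_solution_sqrt_times)
  fix x :: real assume x: "0 < x"
  let ?s = "\<kappa> * complex_of_real x"
  note d = pow_series_square_derivative[OF entire_I0] pow_series_square_derivative[OF entire_coeffs_diffs[OF entire_I0]]
  show "((\<lambda>x. bessel_I (\<kappa> * of_real x)) has_vector_derivative \<kappa> * bessel_I' ?s) (at x)"
    unfolding bessel_I_def[abs_def] bessel_I'_def by (rule ray_has_vector_derivative, rule d)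
  let ?P1 = "pow_series (diffs I0_coeff) (?s\<^sup>2 / 4)" and ?P2 = "pow_series (diffs (diffs I0_coeff)) (?s\<^sup>2 / 4)"
  have "(bessel_I' has_field_derivative ?s / 2 * (?s / 2 * ?P2) + 1 / 2 * ?P1) (at ?s)"
    unfolding bessel_I'_def[abs_def] by (rule derivative_eq_intros d refl | simp)+
  then have "((\<lambda>x. \<kappa> * bessel_I' (\<kappa> * of_real x)) has_vector_derivative
      \<kappa> * (\<kappa> * (?s / 2 * (?s / 2 * ?P2) + 1 / 2 * ?P1))) (at x)"
    by (intro has_vector_derivative_mult_right ray_has_vector_derivative)
  moreover have "\<kappa> * (\<kappa> * (?s / 2 * (?s / 2 * ?P2) + 1 / 2 * ?P1)) = \<kappa>\<^sup>2 * ((?s\<^sup>2 / 4 * ?P2 + ?P1) - ?P1 / 2)"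
    by (simp add: power2_eq_square algebra_simps)
  moreover have "\<dots> = - z * bessel_I ?s - \<kappa> * bessel_I' ?s / of_real x"
    unfolding I0_euler using x by (simp add: \<kappa>[symmetric] bessel_I_def bessel_I'_def power2_eq_square algebra_simps)
  ultimately show "((\<lambda>x. \<kappa> * bessel_I' (\<kappa> * of_real x)) has_vector_derivative
      - z * bessel_I ?s - \<kappa> * bessel_I' ?s / of_real x) (at x)"
    by simp
qed

lemma sqrt_times_tendsto_0:
  assumes k: "((\<lambda>x. k x + c * complex_of_real (ln x)) \<longlongrightarrow> l) (at_right 0)"
  shows "((\<lambda>x. of_real (sqrt x) * k x) \<longlongrightarrow> 0) (at_right 0)"
proof -
  have "((\<lambda>x. sqrt x) \<longlongrightarrow> 0) (at_right 0)" "((\<lambda>x. sqrt x * ln x) \<longlongrightarrow> 0) (at_right 0)"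
    by real_asymp+
  from this[THEN tendsto_of_real]
  have s: "((\<lambda>x. complex_of_real (sqrt x)) \<longlongrightarrow> 0) (at_right 0)"
    "((\<lambda>x. complex_of_real (sqrt x * ln x)) \<longlongrightarrow> 0) (at_right 0)"
    by simp_all
  have "((\<lambda>x. of_real (sqrt x) * (k x + c * of_real (ln x)) - c * complex_of_real (sqrt x * ln x)) \<longlongrightarrow> 0 * l - c * 0) (at_right 0)"
    by (intro tendsto_intros s k)
  then show ?thesis
    by (simp add: algebra_simps)
qed

section \<open>Exclusion of nonnegative spectral parameters\<close>

definition regular_solution :: "complex \<Rightarrow> real \<Rightarrow> complex" where
  "regular_solution z x = of_real (sqrt x) * bessel_I (decay_rate z * of_real x)"

lemma regular_solution_0: "(regular_solution z \<longlongrightarrow> 0) (at_right 0)"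
  unfolding regular_solution_def[abs_def]
  by (rule sqrt_times_tendsto_0[where c = 0]) (use bessel_I_ray(1) in simp)

context boundary_pair
begin

text \<open>
  Let \<open>Y\<close> be the regular solution. As \<open>g\<close> vanishes beyond 1, the Lagrange identity gives
  \<open>\<integral> |Y|\<^sup>2\<close> over \<open>(0,1]\<close> as minus the limit at 0 of the Wronskian of \<open>Y\<close> and \<open>g\<close>. This limit is 0, since the brackets of
  both functions with \<open>\<phi>\<close> vanish at 0. But \<open>Y\<close> behaves like \<open>\<surd>x\<close> at 0 and is not zero.
\<close>

lemma nonneg_not_regular_value:
  assumes z: "z \<in> \<real>\<^sub>\<ge>\<^sub>0" and g: "g \<in> dom_Tmax" and bc: "bracket0 g \<phi> = 0"
    and eq: "AE x in half_line. tau0 g x - z * g x = indicator {0<..1} x * cnj (regular_solution z x)"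
  shows False
proof -
  let ?\<kappa> = "decay_rate z"
  let ?k = "\<lambda>x. bessel_I (?\<kappa> * of_real x)" and ?k' = "\<lambda>x. ?\<kappa> * bessel_I' (?\<kappa> * of_real x)"
  define Y where "Y = regular_solution z"
  define Y' where "Y' x = of_real (1 / (2 * sqrt x)) * ?k x + of_real (sqrt x) * ?k' x" for x
  have Y: "classical_solution z Y Y'"
    using regular_bessel_solution[OF decay_rate_square]
    by (simp add: Y_def Y'_def[abs_def] regular_solution_def[abs_def])
  obtain \<mu> where \<mu>: "z = of_real \<mu>" "0 \<le> \<mu>"
    using z by (auto elim: nonneg_Reals_cases)
  have "AE x in half_line. 1 < x \<longrightarrow> tau0 g x = of_real \<mu> * g x"
    using eq by eventually_elim (auto simp: \<mu>(1))
  then have g2: "g 2 = 0" "D1 g 2 = 0"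
    using dom_Tmax_solution_vanishes[OF \<mu>(2) g, of 2] by auto
  define B where "B x = Y' x * g x - Y x * D1 g x" for x
  have pos: "\<forall>\<^sub>F x in at_right (0::real). 0 < x"
    by (rule eventually_at_right_less)
  have forms: "phi0' x * Y x - phi0 x * Y' x = - (?\<kappa> * of_real x * bessel_I' (?\<kappa> * of_real x))"
    "psi0' x * Y x - psi0 x * Y' x
      = of_real (ln x) * (?\<kappa> * of_real x * bessel_I' (?\<kappa> * of_real x)) - bessel_I (?\<kappa> * of_real x)" if "0 < x" for x
    unfolding Y_def Y'_def regular_solution_def boundary_forms_sqrt_times[OF that, of ?k ?k']
    by (simp_all only: mult_ac)
  have "((\<lambda>x. - (?\<kappa> * of_real x * bessel_I' (?\<kappa> * of_real x))) \<longlongrightarrow> - 0) (at_right 0)"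
    by (intro tendsto_minus bessel_I_ray)
  then have a: "((\<lambda>x. phi0' x * Y x - phi0 x * Y' x) \<longlongrightarrow> - 0) (at_right 0)"
    by (rule Lim_transform_eventually)
       (use pos in \<open>eventually_elim, simp add: forms\<close>)
  have b: "((\<lambda>x. psi0' x * Y x - psi0 x * Y' x) \<longlongrightarrow> - 1) (at_right 0)"
    by (rule Lim_transform_eventually[OF bessel_I_ray(3)[of ?\<kappa>]])
       (use pos in \<open>eventually_elim, simp add: forms\<close>)
  have B0: "(B \<longlongrightarrow> 0) (at_right 0)"
    using Wronskian_limit_0[OF g a b] by (simp add: B_def[abs_def] bc)
  define h where "h x = indicator {0<..1} x * (cmod (Y x))\<^sup>2" for x :: real
  obtain N where N: "negligible N"
    "\<And>x. 0 < x \<Longrightarrow> x \<notin> N \<Longrightarrow> tau0 g x - z * g x = indicator {0<..1} x * cnj (Y x)"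
    using AE_half_line_negligible[OF eq] unfolding Y_def by blast
  have I: "(h has_integral - Re (B \<epsilon>)) {\<epsilon>..2}" if \<epsilon>: "0 < \<epsilon>" "\<epsilon> \<le> 2" for \<epsilon>
  proof -
    have "((\<lambda>x. Y x * (tau0 g x - z * g x)) has_integral B 2 - B \<epsilon>) {\<epsilon>..2}"
      unfolding B_def by (rule Lagrange_identity[OF Y dom_TmaxD(1)[OF g] \<epsilon>])
    then have "((\<lambda>x. complex_of_real (h x)) has_integral B 2 - B \<epsilon>) {\<epsilon>..2}"
    proof (rule has_integral_spike[OF N(1), rotated])
      fix x assume "x \<in> {\<epsilon>..2} - N"
      then have "0 < x" "x \<notin> N"
        using \<epsilon> by auto
      then show "complex_of_real (h x) = Y x * (tau0 g x - z * g x)"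
        using N(2)[of x] by (simp add: h_def complex_norm_square indicator_def del: of_real_power)
    qed
    from has_integral_linear[OF this bounded_linear_Re] show ?thesis
      by (simp add: comp_def B_def g2)
  qed
  have "\<forall>\<^sub>F x in at_right 0. dist (?k x) 1 < 1 / 2"
    by (rule tendstoD[OF bessel_I_ray(1)]) simp
  then obtain d where d: "d > 0" "\<And>x. 0 < x \<Longrightarrow> x < d \<Longrightarrow> dist (?k x) 1 < 1 / 2"
    unfolding eventually_at_right_field by auto
  define e where "e = min d 1"
  have e: "0 < e" "e \<le> 1" "e \<le> d"
    using d(1) by (auto simp: e_def)
  \<comment> \<open>Below \<open>e\<close> the Bessel factor exceeds \<open>1 / 2\<close> in modulus, hence \<open>h x \<ge> x / 4\<close>.\<close>
  have low: "e / 16 \<le> h x" if x: "x \<in> {e / 4..e / 2}" for x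
  proof -
    have x0: "0 < x" "x < d" "x \<le> 1"
      using x e by auto
    have "1 / 2 \<le> cmod (?k x)"
      using d(2)[OF x0(1,2)] norm_triangle_ineq2[of 1 "1 - ?k x"] by (simp add: dist_norm norm_minus_commute)
    then have "(1 / 2)\<^sup>2 \<le> (cmod (?k x))\<^sup>2"
      by (intro power_mono) auto
    moreover have "h x = x * (cmod (?k x))\<^sup>2"
      using x0 by (simp add: h_def Y_def regular_solution_def norm_mult power_mult_distrib)
    ultimately have "x * (1 / 2)\<^sup>2 \<le> h x"
      using x0 by (simp add: mult_left_mono)
    moreover have "e / 16 \<le> x * (1 / 2)\<^sup>2"
      using x by (simp add: power2_eq_square)
    ultimately show ?thesis
      by simp
  qed
  have "e / 16 * (e / 4) \<le> - Re (B \<epsilon>)" if \<epsilon>: "0 < \<epsilon>" "\<epsilon> < e / 4" for \<epsilon>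
  proof -
    have \<epsilon>2: "\<epsilon> \<le> 2"
      using \<epsilon> e by simp
    have hi: "h integrable_on {\<epsilon>..2}"
      using I[OF \<epsilon>(1) \<epsilon>2] by (rule has_integral_integrable)
    have sub: "{e / 4..e / 2} \<subseteq> {\<epsilon>..2}"
      using \<epsilon> e by auto
    have hs: "h integrable_on {e / 4..e / 2}"
      by (rule integrable_on_subinterval[OF hi sub])
    have "e / 16 * (e / 4) = integral {e / 4..e / 2} (\<lambda>x. e / 16)"
      using e by simp
    also have "\<dots> \<le> integral {e / 4..e / 2} h"
      by (intro integral_le integrable_const_ivl hs low)
    also have "\<dots> \<le> integral {\<epsilon>..2} h"
      by (intro integral_subset_le sub hs hi) (auto simp: h_def)
    also have "\<dots> = - Re (B \<epsilon>)"
      by (rule integral_unique[OF I[OF \<epsilon>(1) \<epsilon>2]])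
    finally show ?thesis .
  qed
  then have "\<forall>\<^sub>F \<epsilon> in at_right 0. e / 16 * (e / 4) \<le> - Re (B \<epsilon>)"
    using e by (intro eventually_at_rightI[of 0 "e / 4"]) auto
  moreover have "((\<lambda>\<epsilon>. - Re (B \<epsilon>)) \<longlongrightarrow> - Re 0) (at_right 0)"
    by (intro tendsto_intros B0)
  ultimately have "e / 16 * (e / 4) \<le> - Re 0"
    by (intro tendsto_lowerbound) auto
  then show False
    using e by (simp add: zero_less_mult_iff mult_le_0_iff)
qed

end

section \<open>The Weyl solution\<close>

definition w_deriv :: "complex \<Rightarrow> real \<Rightarrow> complex" where
  "w_deriv z x = of_real (1 / (2 * sqrt x)) * bessel_K (decay_rate z * of_real x)
     + of_real (sqrt x) * (decay_rate z * bessel_K' (decay_rate z * of_real x))"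

text \<open>
  The boundary value \<open>[w,\<psi>](0)\<close> of the Weyl solution.
\<close>

definition w_boundary :: "complex \<Rightarrow> complex" where
  "w_boundary z = Ln (decay_rate z / 2) + euler_mascheroni"

context
  fixes z :: complex
  assumes z: "z \<notin> \<real>\<^sub>\<ge>\<^sub>0"
begin

lemma w_sol_solution: "classical_solution z (w_sol z) (w_deriv z)"
proof -
  have "classical_solution z (\<lambda>x. of_real (sqrt x) * bessel_K (decay_rate z * of_real x)) (w_deriv z)"
    unfolding w_deriv_def[abs_def]
    by (rule modified_bessel_classical_solution[OF modified_bessel_K Re_decay_rate[OF z] decay_rate_square])
  then show ?thesis
    by (rule classical_solution_cong) (simp add: w_sol_eq_bessel_K[OF z])
qed

lemma w_sol_boundary_forms:
  "((\<lambda>x. phi0' x * w_sol z x - phi0 x * w_deriv z x) \<longlongrightarrow> 1) (at_right 0)"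
  "((\<lambda>x. psi0' x * w_sol z x - psi0 x * w_deriv z x) \<longlongrightarrow> w_boundary z) (at_right 0)"
proof -
  have pos: "\<forall>\<^sub>F x in at_right (0::real). 0 < x"
    by (rule eventually_at_right_less)
  note K = bessel_K_near_0[OF Re_decay_rate[OF z]]
  let ?\<kappa> = "decay_rate z"
  have forms: "phi0' x * w_sol z x - phi0 x * w_deriv z x = - (?\<kappa> * of_real x * bessel_K' (?\<kappa> * of_real x))"
    "psi0' x * w_sol z x - psi0 x * w_deriv z x
      = of_real (ln x) * (?\<kappa> * of_real x * bessel_K' (?\<kappa> * of_real x)) - bessel_K (?\<kappa> * of_real x)" if "0 < x" for x
    unfolding w_sol_eq_bessel_K[OF z that] w_deriv_def boundary_forms_sqrt_times[OF that,
      of "\<lambda>x. bessel_K (?\<kappa> * of_real x)" "\<lambda>x. ?\<kappa> * bessel_K' (?\<kappa> * of_real x)"]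
    by (simp_all only: mult_ac)
  have "((\<lambda>x. - (decay_rate z * of_real x * bessel_K' (decay_rate z * of_real x))) \<longlongrightarrow> - (- 1)) (at_right 0)"
    by (intro tendsto_minus K)
  then have "((\<lambda>x. phi0' x * w_sol z x - phi0 x * w_deriv z x) \<longlongrightarrow> - (- 1)) (at_right 0)"
    by (rule Lim_transform_eventually)
       (use pos in \<open>eventually_elim, simp add: forms\<close>)
  then show "((\<lambda>x. phi0' x * w_sol z x - phi0 x * w_deriv z x) \<longlongrightarrow> 1) (at_right 0)"
    by simp
  show "((\<lambda>x. psi0' x * w_sol z x - psi0 x * w_deriv z x) \<longlongrightarrow> w_boundary z) (at_right 0)"
    unfolding w_boundary_def
    by (rule Lim_transform_eventually[OF K(3)])
       (use pos in \<open>eventually_elim, simp add: forms\<close>)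
qed

lemma w_sol_decay:
  "\<exists>M\<ge>0. \<forall>x\<ge>1. cmod (w_sol z x) \<le> M * x * exp (- Re (decay_rate z) * x) \<and>
    cmod (w_deriv z x) \<le> M * x * exp (- Re (decay_rate z) * x)"
proof -
  let ?\<kappa> = "decay_rate z"
  obtain A where A: "\<And>x. x \<ge> 1 \<Longrightarrow> norm (bessel_K (?\<kappa> * of_real x)) \<le> A * exp (- Re ?\<kappa> * x)"
    "\<And>x. x \<ge> 1 \<Longrightarrow> norm (bessel_K' (?\<kappa> * of_real x)) \<le> A * exp (- Re ?\<kappa> * x)"
    using bessel_K_decay[OF Re_decay_rate[OF z]] by blast
  have A0: "A \<ge> 0"
    using order_trans[OF norm_ge_zero A(1)[of 1]] by (simp add: zero_le_mult_iff)
  define M where "M = A + cmod ?\<kappa> * A"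
  have M: "A \<le> M" "0 \<le> M"
    using A0 by (auto simp: M_def)
  show ?thesis
  proof (intro exI[of _ M] conjI M(2) allI impI)
    fix x :: real assume x: "1 \<le> x"
    have sx: "1 \<le> sqrt x" "sqrt x \<le> x"
    proof -
      show s1: "1 \<le> sqrt x"
        using x by simp
      have "sqrt x * 1 \<le> sqrt x * sqrt x"
        using s1 x by (intro mult_left_mono) auto
      then show "sqrt x \<le> x"
        using x by simp
    qed
    let ?E = "exp (- Re ?\<kappa> * x)"
    have "cmod (w_sol z x) = sqrt x * norm (bessel_K (?\<kappa> * of_real x))"
      using x by (simp add: w_sol_eq_bessel_K[OF z] norm_mult)
    also have "\<dots> \<le> x * (A * ?E)"
      using sx x A(1)[OF x] by (intro mult_mono) auto
    also have "\<dots> \<le> x * (M * ?E)"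
      using M x by (intro mult_left_mono mult_right_mono) auto
    finally show "cmod (w_sol z x) \<le> M * x * ?E"
      by (simp add: mult_ac)
    have "cmod (w_deriv z x) \<le> 1 / (2 * sqrt x) * norm (bessel_K (?\<kappa> * of_real x))
        + sqrt x * (cmod ?\<kappa> * norm (bessel_K' (?\<kappa> * of_real x)))"
      unfolding w_deriv_def using x
      by (intro order_trans[OF norm_triangle_ineq] add_mono) (simp_all add: norm_mult norm_divide)
    also have "\<dots> \<le> x * (A * ?E) + x * (cmod ?\<kappa> * (A * ?E))"
    proof (intro add_mono mult_mono A x order_refl)
      have "1 \<le> 2 * sqrt x"
        using sx(1) by linarith
      then have "1 / (2 * sqrt x) \<le> 1"
        using x by (subst divide_le_eq_1_pos) auto
      then show "1 / (2 * sqrt x) \<le> x"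
        using x by (rule order_trans)
    qed (use sx x A0 in auto)
    also have "\<dots> = M * x * ?E"
      by (simp add: M_def algebra_simps)
    finally show "cmod (w_deriv z x) \<le> M * x * ?E" .
  qed
qed

lemma w_sol_square_integrable: "square_integrable (w_sol z)"
proof -
  obtain M where M: "M \<ge> 0" "\<And>x. 1 \<le> x \<Longrightarrow> cmod (w_sol z x) \<le> M * x * exp (- Re (decay_rate z) * x)"
    "\<And>x. 1 \<le> x \<Longrightarrow> cmod (w_deriv z x) \<le> M * x * exp (- Re (decay_rate z) * x)"
    using w_sol_decay by blast
  have "((\<lambda>x. of_real (sqrt x) * bessel_K (decay_rate z * of_real x)) \<longlongrightarrow> 0) (at_right 0)"
    by (rule sqrt_times_tendsto_0[where c = 1]) (use bessel_K_near_0(1)[OF Re_decay_rate[OF z]] in simp)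
  then have "(w_sol z \<longlongrightarrow> 0) (at_right 0)"
    by (rule Lim_transform_eventually)
       (use eventually_at_right_less[of 0] in \<open>eventually_elim, simp add: w_sol_eq_bessel_K[OF z]\<close>)
  then show ?thesis
    by (rule square_integrable_of_decay[OF classical_solution_continuous(1)[OF w_sol_solution] _ Re_decay_rate[OF z] M(2)])
qed

lemma w_sol_dom_Tmax: "w_sol z \<in> dom_Tmax"
proof -
  have "square_integrable (tau0 (w_sol z))"
    by (rule square_integrable_cong[OF square_integrable_scale[OF w_sol_square_integrable, of z]])
       (simp add: classical_solution_D1(3)[OF w_sol_solution])
  then show ?thesis
    using w_sol_square_integrable classical_solution_regular(3)[OF w_sol_solution] by (simp add: dom_Tmax_def)
qed

text \<open>
  Exponential decay of \<open>w\<close> and its derivative against polynomial growth of \<open>g\<close> and its derivative.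
\<close>

lemma w_sol_Wronskian_at_top:
  assumes g: "g \<in> dom_Tmax"
  shows "((\<lambda>x. w_deriv z x * g x - w_sol z x * D1 g x) \<longlongrightarrow> 0) at_top"
proof -
  obtain M where M: "M \<ge> 0" "\<And>x. 1 \<le> x \<Longrightarrow> cmod (w_sol z x) \<le> M * x * exp (- Re (decay_rate z) * x)"
    "\<And>x. 1 \<le> x \<Longrightarrow> cmod (w_deriv z x) \<le> M * x * exp (- Re (decay_rate z) * x)"
    using w_sol_decay by blast
  obtain C where C: "\<And>x. 1 \<le> x \<Longrightarrow> cmod (D1 g x) \<le> C * x" "\<And>x. 1 \<le> x \<Longrightarrow> cmod (g x) \<le> C * x\<^sup>2"
    using dom_Tmax_growth[OF g] by blast
  define a where "a = Re (decay_rate z)"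
  have a: "a > 0"
    using Re_decay_rate[OF z] by (simp add: a_def)
  show ?thesis
  proof (rule Lim_null_comparison)
    show "((\<lambda>x. M * x * exp (- a * x) * (C * x\<^sup>2) + M * x * exp (- a * x) * (C * x)) \<longlongrightarrow> 0) at_top"
      using a by real_asymp
    show "\<forall>\<^sub>F x in at_top. norm (w_deriv z x * g x - w_sol z x * D1 g x)
        \<le> M * x * exp (- a * x) * (C * x\<^sup>2) + M * x * exp (- a * x) * (C * x)"
      using eventually_ge_at_top[of 1]
    proof eventually_elim
      case (elim x)
      have "norm (w_deriv z x * g x - w_sol z x * D1 g x)
          \<le> norm (w_deriv z x) * norm (g x) + norm (w_sol z x) * norm (D1 g x)"
        unfolding norm_mult[symmetric] by (rule norm_triangle_ineq4)
      also have "\<dots> \<le> M * x * exp (- a * x) * (C * x\<^sup>2) + M * x * exp (- a * x) * (C * x)"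
        unfolding a_def using elim M(1) by (intro add_mono mult_mono M C) auto
      finally show ?case .
    qed
  qed
qed

text \<open>
  The function \<open>s\<^sup>2 (K\<^sup>2 - K'\<^sup>2) / 2\<close> is an antiderivative of \<open>s K\<^sup>2\<close>, as the modified Bessel equation shows. It vanishes at
  infinity, and at 0 it tends to \<open>- 1 / 2\<close> because \<open>s K'\<close> tends to \<open>- 1\<close>.
\<close>

lemma integral_w_sol_square: "(\<integral>x. w_sol z x * w_sol z x \<partial>half_line) = - (1 / (2 * z))"
proof -
  let ?\<kappa> = "decay_rate z"
  have \<kappa>: "?\<kappa> \<noteq> 0" "?\<kappa>\<^sup>2 = - z" "Re ?\<kappa> > 0"
    using Re_decay_rate[OF z] decay_rate_square by auto
  let ?K = "\<lambda>x. bessel_K (?\<kappa> * of_real x)" and ?K' = "\<lambda>x. bessel_K' (?\<kappa> * of_real x)"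
  let ?G = "\<lambda>x. (of_real x * ?K x)\<^sup>2 / 2 - (?\<kappa> * of_real x * ?K' x)\<^sup>2 / (2 * ?\<kappa>\<^sup>2)"
  have "(\<integral>x. w_sol z x * w_sol z x \<partial>half_line) = 0 - (0\<^sup>2 / 2 - (- 1)\<^sup>2 / (2 * ?\<kappa>\<^sup>2))"
  proof (rule integral_half_line_FTC)
    show "complex_integrable half_line (\<lambda>x. w_sol z x * w_sol z x)"
      by (intro integrable_product w_sol_square_integrable)
    show "(?G has_vector_derivative w_sol z x * w_sol z x) (at x)" if x: "0 < x" for x
    proof -
      have re: "0 < Re (?\<kappa> * of_real x)" and nz: "x \<noteq> 0"
        using x \<kappa> by simp_all
      note d = modified_bessel_K[unfolded modified_bessel_def, rule_format, OF re]
      have "((\<lambda>s. (s\<^sup>2 * ((bessel_K s)\<^sup>2 - (bessel_K' s)\<^sup>2)) / (2 * ?\<kappa>\<^sup>2)) has_field_derivative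
          (of_nat 2 * (1 * s ^ (2 - Suc 0)) * ((bessel_K s)\<^sup>2 - (bessel_K' s)\<^sup>2)
            + (of_nat 2 * (bessel_K' s * bessel_K s ^ (2 - Suc 0))
               - of_nat 2 * ((bessel_K s - bessel_K' s / s) * bessel_K' s ^ (2 - Suc 0))) * s\<^sup>2) / (2 * ?\<kappa>\<^sup>2)) (at s)"
        if "s = ?\<kappa> * of_real x" for s
        unfolding that by (intro DERIV_cdivide DERIV_mult DERIV_diff DERIV_power DERIV_ident
            d[THEN conjunct1] d[THEN conjunct2])
      from ray_has_vector_derivative[OF this[OF refl]]
      have D: "((\<lambda>x. ((?\<kappa> * of_real x)\<^sup>2 * ((?K x)\<^sup>2 - (?K' x)\<^sup>2)) / (2 * ?\<kappa>\<^sup>2)) has_vector_derivative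
          ?\<kappa> * ((of_nat 2 * (1 * (?\<kappa> * of_real x) ^ (2 - Suc 0)) * ((?K x)\<^sup>2 - (?K' x)\<^sup>2)
            + (of_nat 2 * (?K' x * ?K x ^ (2 - Suc 0))
               - of_nat 2 * ((?K x - ?K' x / (?\<kappa> * of_real x)) * ?K' x ^ (2 - Suc 0))) * (?\<kappa> * of_real x)\<^sup>2) / (2 * ?\<kappa>\<^sup>2))) (at x)" .
      have e1: "?\<kappa> * ((of_nat 2 * (1 * (?\<kappa> * of_real x) ^ (2 - Suc 0)) * ((?K x)\<^sup>2 - (?K' x)\<^sup>2)
            + (of_nat 2 * (?K' x * ?K x ^ (2 - Suc 0))
               - of_nat 2 * ((?K x - ?K' x / (?\<kappa> * of_real x)) * ?K' x ^ (2 - Suc 0))) * (?\<kappa> * of_real x)\<^sup>2) / (2 * ?\<kappa>\<^sup>2))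
          = of_real x * (?K x)\<^sup>2"
        using \<kappa>(1) nz by (simp add: field_simps power2_eq_square)
      have "w_sol z x * w_sol z x = (of_real (sqrt x) * of_real (sqrt x)) * (?K x)\<^sup>2"
        by (simp add: w_sol_eq_bessel_K[OF z x] power2_eq_square)
      also have "complex_of_real (sqrt x) * of_real (sqrt x) = of_real x"
        using x by (simp flip: of_real_mult)
      finally have e2: "w_sol z x * w_sol z x = of_real x * (?K x)\<^sup>2" .
      have e3: "(\<lambda>x. ((?\<kappa> * of_real x)\<^sup>2 * ((?K x)\<^sup>2 - (?K' x)\<^sup>2)) / (2 * ?\<kappa>\<^sup>2)) = ?G"
        using \<kappa>(1) by (simp add: fun_eq_iff power_mult_distrib right_diff_distrib diff_divide_distrib)
      show ?thesis
        using D unfolding e1 e2 e3 .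
    qed
    note K = bessel_K_near_0[OF \<kappa>(3)]
    have "((\<lambda>x::real. x) \<longlongrightarrow> 0) (at_right 0)" "((\<lambda>x::real. x * ln x) \<longlongrightarrow> 0) (at_right 0)"
      by real_asymp+
    from this[THEN tendsto_of_real]
    have s: "((\<lambda>x. complex_of_real x) \<longlongrightarrow> 0) (at_right 0)"
      "((\<lambda>x. complex_of_real (x * ln x)) \<longlongrightarrow> 0) (at_right 0)"
      by simp_all
    have "((\<lambda>x. of_real x * (?K x + of_real (ln x)) - complex_of_real (x * ln x)) \<longlongrightarrow> 0 * - (Ln (?\<kappa> / 2) + euler_mascheroni) - 0) (at_right 0)"
      by (intro tendsto_intros s K)
    then have xK: "((\<lambda>x. of_real x * ?K x) \<longlongrightarrow> 0) (at_right 0)"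
      by (simp add: distrib_left)
    show "(?G \<longlongrightarrow> 0\<^sup>2 / 2 - (- 1)\<^sup>2 / (2 * ?\<kappa>\<^sup>2)) (at_right 0)"
      by (intro tendsto_intros xK K) (use \<kappa> in auto)
    obtain A where A: "\<And>x. x \<ge> 1 \<Longrightarrow> norm (?K x) \<le> A * exp (- Re ?\<kappa> * x)"
      "\<And>x. x \<ge> 1 \<Longrightarrow> norm (?K' x) \<le> A * exp (- Re ?\<kappa> * x)"
      using bessel_K_decay[OF \<kappa>(3)] by blast
    have lim: "((\<lambda>x. of_real x * f x) \<longlongrightarrow> 0) at_top" if f: "\<And>x. x \<ge> 1 \<Longrightarrow> norm (f x) \<le> A * exp (- Re ?\<kappa> * x)" for f :: "real \<Rightarrow> complex"
    proof (rule Lim_null_comparison)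
      show "((\<lambda>x. x * (A * exp (- Re ?\<kappa> * x))) \<longlongrightarrow> 0) at_top"
        using \<kappa>(3) by real_asymp
      show "\<forall>\<^sub>F x in at_top. norm (of_real x * f x) \<le> x * (A * exp (- Re ?\<kappa> * x))"
        using eventually_ge_at_top[of 1]
      proof eventually_elim
        case (elim x)
        then show ?case
          using f[of x] by (simp add: norm_mult mult_left_mono)
      qed
    qed
    have "(?G \<longlongrightarrow> 0\<^sup>2 / 2 - (?\<kappa> * 0)\<^sup>2 / (2 * ?\<kappa>\<^sup>2)) at_top"
      unfolding mult.assoc by (intro tendsto_intros lim A) (use \<kappa> in auto)
    then show "(?G \<longlongrightarrow> 0) at_top"
      by simp
  qed
  also have "\<dots> = - (1 / (2 * z))"
    unfolding \<kappa>(2) by simp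
  finally show ?thesis .
qed

end

section \<open>The difference of the resolvents\<close>

lemma borel_measurable_half_line_AE:
  fixes f g :: "real \<Rightarrow> complex"
  assumes f: "f \<in> borel_measurable half_line" and eq: "AE x in half_line. f x = g x"
  shows "g \<in> borel_measurable half_line"
proof -
  have "(\<lambda>x. if x \<in> {0<..} then f x else 0) \<in> borel_measurable lebesgue"
    using f by (subst borel_measurable_if) auto
  moreover have "AE x in lebesgue. (if x \<in> {0<..} then f x else 0) = (if x \<in> {0<..} then g x else 0)"
  proof -
    have "AE x in lebesgue. x \<in> {0<..} \<longrightarrow> f x = g x"
      using eq by (simp add: AE_restrict_space_iff)
    then show ?thesis
      by eventually_elim auto
  qed
  ultimately have "(\<lambda>x. if x \<in> {0<..} then g x else 0) \<in> borel_measurable lebesgue"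
    by (rule borel_measurable_AE)
  then show ?thesis
    by (subst (asm) borel_measurable_if) auto
qed

lemma square_integrable_AE:
  assumes f: "square_integrable f" and eq: "AE x in half_line. f x = g x"
  shows "square_integrable g"
proof -
  have [measurable]: "f \<in> borel_measurable half_line" "g \<in> borel_measurable half_line"
    using f borel_measurable_half_line_AE[OF _ eq] by (auto simp: square_integrable_def)
  have "integrable half_line (\<lambda>x. (cmod (f x))\<^sup>2) \<longleftrightarrow> integrable half_line (\<lambda>x. (cmod (g x))\<^sup>2)"
  proof (rule integrable_cong_AE)
    show "AE x in half_line. (cmod (f x))\<^sup>2 = (cmod (g x))\<^sup>2"
      using eq by eventually_elim simp
  qed measurable
  then show ?thesis
    using f by (auto simp: square_integrable_def)
qed

lemma minus_abs:
  assumes "square_integrable f" "square_integrable g"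
  shows "abs_L2 f - z *\<^sub>C abs_L2 g = abs_L2 (\<lambda>x. f x - z * g x)"
proof -
  have zg: "square_integrable (\<lambda>x. z * g x)" "square_integrable (\<lambda>x. - 1 * (z * g x))"
    by (intro square_integrable_scale assms)+
  have "abs_L2 f - z *\<^sub>C abs_L2 g = abs_L2 f + (- 1) *\<^sub>C abs_L2 (\<lambda>x. z * g x)"
    by (simp only: minus_L2_def cscale_abs[OF assms(2)])
  also have "\<dots> = abs_L2 (\<lambda>x. f x + - 1 * (z * g x))"
    by (simp only: cscale_abs[OF zg(1)] plus_abs[OF assms(1) zg(2)])
  finally show ?thesis
    by simp
qed

lemma square_integrable_diff_scale:
  "square_integrable f \<Longrightarrow> square_integrable g \<Longrightarrow> square_integrable (\<lambda>x. f x - z * g x)"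
  using square_integrable_add[OF _ square_integrable_scale, of f g "- z"] by simp

lemma shifted_T_op:
  "(h, f) \<in> shifted (T_op \<phi> \<psi> \<theta>) z \<longleftrightarrow>
    (\<exists>g\<in>dom_T \<phi> \<psi> \<theta>. h = abs_L2 g \<and> f = abs_L2 (\<lambda>x. tau0 g x - z * g x))"
proof -
  have *: "abs_L2 (tau0 g) - z *\<^sub>C abs_L2 g = abs_L2 (\<lambda>x. tau0 g x - z * g x)" if "g \<in> dom_T \<phi> \<psi> \<theta>" for g
    using that by (intro minus_abs) (auto simp: dom_T_def dom_Tmax_def)
  have "(h, f) \<in> shifted (T_op \<phi> \<psi> \<theta>) z \<longleftrightarrow>
      (\<exists>g\<in>dom_T \<phi> \<psi> \<theta>. h = abs_L2 g \<and> f = abs_L2 (tau0 g) - z *\<^sub>C abs_L2 g)"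
    unfolding shifted_def T_op_def by blast
  then show ?thesis
    by (simp add: * cong: bex_cong)
qed

lemma resolvent_eq:
  assumes "z \<in> resolvent_set T" "(g, f) \<in> shifted T z"
  shows "resolvent T z f = g"
  using assms unfolding resolvent_def resolvent_set_def by (intro the1_equality) auto

text \<open>
  The expression \<open>\<tau> - z\<close> does not see a multiple of a solution. The equality holds only almost everywhere, because the
  values of \<open>D1\<close> at points where \<open>D1 g\<close> is not differentiable are not additive.
\<close>

lemma dom_Tmax_add_solution:
  assumes g: "g \<in> dom_Tmax" and u: "classical_solution z u u'" "u \<in> dom_Tmax"
    and f_def: "f = (\<lambda>x. g x + c * u x)"
  shows "f \<in> dom_Tmax" "0 < x \<Longrightarrow> D1 f x = D1 g x + c * D1 u x"
    "AE x in half_line. tau0 f x - z * f x = tau0 g x - z * g x"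
proof -
  note rg = regularD[OF dom_TmaxD(1)[OF g]] and ru = regularD[OF dom_TmaxD(1)[OF u(2)]]
  have df: "(f has_vector_derivative D1 g x + c * D1 u x) (at x)" if "0 < x" for x
    unfolding f_def by (intro has_vector_derivative_add has_vector_derivative_mult_right rg ru that)
  then have D: "D1 f x = D1 g x + c * D1 u x" if "0 < x" for x
    using that by (intro vector_derivative_at) auto
  then show "0 < x \<Longrightarrow> D1 f x = D1 g x + c * D1 u x" .
  have ae: "AE x in half_line. tau0 f x = tau0 g x + c * (z * u x)"
  proof -
    have "AE x in half_line. x \<in> {0<..}"
      using AE_space[of half_line] by simp
    with rg(4) show ?thesis
    proof eventually_elim
      case (elim x)
      then have x: "0 < x"
        by simp
      have "((\<lambda>x. D1 g x + c * D1 u x) has_vector_derivative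
          D1 (D1 g) x + c * (- (z + of_real (1 / (4 * x\<^sup>2))) * u x)) (at x)"
        by (intro has_vector_derivative_add has_vector_derivative_mult_right elim classical_solution_D1(4)[OF u(1) x])
      then have "(D1 f has_vector_derivative D1 (D1 g) x + c * (- (z + of_real (1 / (4 * x\<^sup>2))) * u x)) (at x)"
        by (rule has_vector_derivative_pos_cong) (use D x in auto)
      then have "D1 (D1 f) x = D1 (D1 g) x + c * (- (z + of_real (1 / (4 * x\<^sup>2))) * u x)"
        by (rule vector_derivative_at)
      then show ?case
        unfolding tau0_def by (simp add: f_def algebra_simps add_divide_distrib)
    qed
  qed
  then show "AE x in half_line. tau0 f x - z * f x = tau0 g x - z * g x"
    by eventually_elim (simp add: f_def algebra_simps)
  have "square_integrable (\<lambda>x. tau0 g x + c * (z * u x))"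
    using g u(2) by (intro square_integrable_add square_integrable_scale) (auto simp: dom_Tmax_def)
  then have "square_integrable (tau0 f)"
    by (rule square_integrable_AE) (use ae in \<open>eventually_elim, simp\<close>)
  moreover have "square_integrable f"
    unfolding f_def using g u(2) by (intro square_integrable_add square_integrable_scale) (auto simp: dom_Tmax_def)
  moreover have "f \<in> AC_loc"
    unfolding f_def by (intro AC_loc_add_scale rg ru)
  moreover have "D1 f \<in> AC_loc"
    by (rule AC_loc_cong[of "\<lambda>x. D1 g x + c * D1 u x"]) (auto intro!: AC_loc_add_scale rg ru simp: D)
  moreover have "f differentiable at x" if "0 < x" for x
    using df[OF that] by (rule differentiableI_vector)
  ultimately show "f \<in> dom_Tmax"
    by (simp add: dom_Tmax_def regular_functions_def)
qed

context boundary_pair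
begin

lemma bracket0_add_scale:
  assumes f: "f \<in> dom_Tmax" and g: "g \<in> dom_Tmax" and u: "u \<in> dom_Tmax"
    and eq: "\<And>x. 0 < x \<Longrightarrow> f x = g x + c * u x" "\<And>x. 0 < x \<Longrightarrow> D1 f x = D1 g x + c * D1 u x"
  shows "bracket0 f \<phi> = bracket0 g \<phi> + c * bracket0 u \<phi>" "bracket0 f \<psi> = bracket0 g \<psi> + c * bracket0 u \<psi>"
proof -
  have *: "l = l1 + c * l2"
    if "((\<lambda>x. v' x * f x - v x * D1 f x) \<longlongrightarrow> l) (at_right 0)"
      "((\<lambda>x. v' x * g x - v x * D1 g x) \<longlongrightarrow> l1) (at_right 0)"
      "((\<lambda>x. v' x * u x - v x * D1 u x) \<longlongrightarrow> l2) (at_right 0)" for v v' l l1 l2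
  proof (rule tendsto_unique[OF _ that(1)])
    have "((\<lambda>x. (v' x * g x - v x * D1 g x) + c * (v' x * u x - v x * D1 u x)) \<longlongrightarrow> l1 + c * l2) (at_right 0)"
      by (intro tendsto_intros that)
    then show "((\<lambda>x. v' x * f x - v x * D1 f x) \<longlongrightarrow> l1 + c * l2) (at_right 0)"
      by (rule Lim_transform_eventually)
         (use eventually_at_right_less[of 0] in \<open>eventually_elim, simp add: eq algebra_simps\<close>)
  qed simp
  show "bracket0 f \<phi> = bracket0 g \<phi> + c * bracket0 u \<phi>"
    by (rule *[OF bracket0_tendsto(1)[OF f] bracket0_tendsto(1)[OF g] bracket0_tendsto(1)[OF u]])
  show "bracket0 f \<psi> = bracket0 g \<psi> + c * bracket0 u \<psi>"
    by (rule *[OF bracket0_tendsto(2)[OF f] bracket0_tendsto(2)[OF g] bracket0_tendsto(2)[OF u]])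
qed

lemma bracket0_w_sol:
  assumes z: "z \<notin> \<real>\<^sub>\<ge>\<^sub>0"
  shows "bracket0 (w_sol z) \<phi> = 1" "bracket0 (w_sol z) \<psi> = w_boundary z"
proof -
  have D: "\<forall>\<^sub>F x in at_right 0. D1 (w_sol z) x = w_deriv z x"
    using eventually_at_right_less[of 0]
    by eventually_elim (rule classical_solution_D1(1)[OF w_sol_solution[OF z]])
  have "((\<lambda>x. phi0' x * w_sol z x - phi0 x * D1 (w_sol z) x) \<longlongrightarrow> 1) (at_right 0)"
    by (rule Lim_transform_eventually[OF w_sol_boundary_forms(1)[OF z]]) (use D in \<open>eventually_elim, simp\<close>)
  from tendsto_unique[OF _ bracket0_tendsto(1)[OF w_sol_dom_Tmax[OF z]] this] show "bracket0 (w_sol z) \<phi> = 1"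
    by simp
  have "((\<lambda>x. psi0' x * w_sol z x - psi0 x * D1 (w_sol z) x) \<longlongrightarrow> w_boundary z) (at_right 0)"
    by (rule Lim_transform_eventually[OF w_sol_boundary_forms(2)[OF z]]) (use D in \<open>eventually_elim, simp\<close>)
  from tendsto_unique[OF _ bracket0_tendsto(2)[OF w_sol_dom_Tmax[OF z]] this] show "bracket0 (w_sol z) \<psi> = w_boundary z"
    by simp
qed

text \<open>
  The Lagrange identity with \<open>u = w\<close> on the whole half-line; only the boundary term at 0 survives.
\<close>

lemma integral_w_sol_times:
  assumes z: "z \<notin> \<real>\<^sub>\<ge>\<^sub>0" and g: "g \<in> dom_Tmax"
  shows "(\<integral>x. w_sol z x * (tau0 g x - z * g x) \<partial>half_line) = w_boundary z * bracket0 g \<phi> - bracket0 g \<psi>"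
proof -
  let ?B = "\<lambda>x. w_deriv z x * g x - w_sol z x * D1 g x"
  let ?F = "\<lambda>x. w_sol z x * (tau0 g x - z * g x)"
  have "integrable half_line ?F"
    using g by (intro integrable_product w_sol_square_integrable[OF z] square_integrable_diff_scale)
      (auto simp: dom_Tmax_def)
  then have lim: "(\<lambda>n. integral {1 / real (Suc n)..real (Suc n)} ?F) \<longlonglongrightarrow> (\<integral>x. ?F x \<partial>half_line)"
    by (rule tendsto_integral_half_line)
  have "integral {1 / real (Suc n)..real (Suc n)} ?F = ?B (real (Suc n)) - ?B (1 / real (Suc n))" for n
    by (rule integral_unique, rule Lagrange_identity[OF w_sol_solution[OF z] dom_TmaxD(1)[OF g]])
       (simp_all add: field_simps)
  moreover have "(\<lambda>n. ?B (real (Suc n)) - ?B (1 / real (Suc n))) \<longlonglongrightarrow> 0 - (1 * bracket0 g \<psi> - w_boundary z * bracket0 g \<phi>)"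
    by (intro tendsto_diff filterlim_compose[OF w_sol_Wronskian_at_top[OF z g] seq_at_top]
        filterlim_compose[OF Wronskian_limit_0[OF g w_sol_boundary_forms[OF z]] seq_at_right_0])
  ultimately show ?thesis
    using LIMSEQ_unique[OF lim] by simp
qed

lemma resolvent_set_avoids_half_line:
  assumes "z \<in> resolvent_set (T_op \<phi> \<psi> 0)"
  shows "z \<notin> \<real>\<^sub>\<ge>\<^sub>0"
proof
  assume z: "z \<in> \<real>\<^sub>\<ge>\<^sub>0"
  let ?F = "\<lambda>x. indicator {0<..1} x * cnj (regular_solution z x)"
  have Y: "continuous_on {0<..} (regular_solution z)"
    using classical_solution_continuous(1)[OF regular_bessel_solution[OF decay_rate_square]]
    by (simp add: regular_solution_def[abs_def])
  have F: "square_integrable ?F"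
    using tendsto_cnj[OF regular_solution_0[of z]]
    by (intro square_integrable_near_0 continuous_on_cnj Y) simp
  have "\<exists>h. (h, abs_L2 ?F) \<in> shifted (T_op \<phi> \<psi> 0) z"
    using assms unfolding resolvent_set_def by blast
  then obtain g where g: "g \<in> dom_T \<phi> \<psi> 0" and eq: "abs_L2 ?F = abs_L2 (\<lambda>x. tau0 g x - z * g x)"
    unfolding shifted_T_op by blast
  have g': "g \<in> dom_Tmax" "bracket0 g \<phi> = 0"
    using g by (auto simp: dom_T_def)
  have "square_integrable (\<lambda>x. tau0 g x - z * g x)"
    using g' by (intro square_integrable_diff_scale) (auto simp: dom_Tmax_def)
  then have "AE x in half_line. tau0 g x - z * g x = ?F x"
    using eq F by (simp add: abs_L2_eq_iff eq_commute)
  then show False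
    by (rule nonneg_not_regular_value[OF z g'])
qed

end

lemma abs_L2_cong:
  assumes "square_integrable f" "AE x in half_line. f x = g x"
  shows "abs_L2 f = abs_L2 g"
  using assms square_integrable_AE[OF assms] by (simp add: abs_L2_eq_iff)

lemma abs_w_sol_nonzero:
  assumes z: "z \<notin> \<real>\<^sub>\<ge>\<^sub>0"
  shows "abs_L2 (w_sol z) \<noteq> 0"
proof
  assume "abs_L2 (w_sol z) = 0"
  then have ae: "AE x in half_line. w_sol z x = 0"
    using w_sol_square_integrable[OF z] by (simp add: zero_L2_def abs_L2_eq_iff square_integrable_zero)
  have "(\<integral>x. w_sol z x * w_sol z x \<partial>half_line) = (\<integral>x. 0 \<partial>half_line)"
  proof (rule integral_cong_AE)
    show "AE x in half_line. w_sol z x * w_sol z x = 0"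
      using ae by eventually_elim simp
    show "(\<lambda>x. w_sol z x * w_sol z x) \<in> borel_measurable half_line"
      by (intro borel_measurable_integrable integrable_product w_sol_square_integrable z)
  qed simp
  then show False
    using integral_w_sol_square[OF z] z by auto
qed

context boundary_pair
begin

text \<open>
  If the denominator vanished, \<open>w\<close> would satisfy the boundary condition for \<open>\<theta>\<close>, and \<open>T - z\<close> would not be injective.
\<close>

lemma denominator_nonzero:
  assumes \<theta>: "0 < \<theta>" "\<theta> < pi" and z: "z \<notin> \<real>\<^sub>\<ge>\<^sub>0" "z \<in> resolvent_set (T_op \<phi> \<psi> \<theta>)"
  shows "of_real (cot \<theta>) + w_boundary z \<noteq> 0"
proof
  assume zero: "of_real (cot \<theta>) + w_boundary z = 0"
  have s: "sin \<theta> \<noteq> 0"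
    using sin_gt_zero[OF \<theta>] by simp
  note w = w_sol_solution[OF z(1)] and wd = w_sol_dom_Tmax[OF z(1)]
  have "of_real (cos \<theta>) + of_real (sin \<theta>) * w_boundary z = complex_of_real (sin \<theta>) * (of_real (cot \<theta>) + w_boundary z)"
    using s by (simp add: cot_def distrib_left)
  then have wT: "w_sol z \<in> dom_T \<phi> \<psi> \<theta>"
    using wd bracket0_w_sol[OF z(1)] zero by (simp add: dom_T_def)
  \<comment> \<open>This is the zero function, in a form to which the lemma on adding solutions applies. It shows that
    \<open>\<tau> w - z w\<close> and its counterpart for 0 define the same class.\<close>
  define v where "v = (\<lambda>x. w_sol z x + - 1 * w_sol z x)"
  note v = dom_Tmax_add_solution[OF wd w wd v_def]
  have "bracket0 v \<phi> = 0" "bracket0 v \<psi> = 0"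
    using bracket0_add_scale[OF v(1) wd wd, of "- 1"] v(2) by (simp_all add: v_def)
  then have vT: "v \<in> dom_T \<phi> \<psi> \<theta>"
    using v(1) by (simp add: dom_T_def)
  have "(abs_L2 v, abs_L2 (\<lambda>x. tau0 v x - z * v x)) \<in> shifted (T_op \<phi> \<psi> \<theta>) z"
    "(abs_L2 (w_sol z), abs_L2 (\<lambda>x. tau0 (w_sol z) x - z * w_sol z x)) \<in> shifted (T_op \<phi> \<psi> \<theta>) z"
    unfolding shifted_T_op using vT wT by blast+
  moreover have "abs_L2 (\<lambda>x. tau0 v x - z * v x) = abs_L2 (\<lambda>x. tau0 (w_sol z) x - z * w_sol z x)"
    using v(1) by (intro abs_L2_cong square_integrable_diff_scale v(3)) (auto simp: dom_Tmax_def)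
  ultimately have "abs_L2 v = abs_L2 (w_sol z)"
    using resolvent_eq[OF z(2)] by metis
  moreover have "abs_L2 v = 0"
    by (simp add: v_def zero_L2_def)
  ultimately show False
    using abs_w_sol_nonzero[OF z(1)] by simp
qed

lemma cinner_w_sol_cnj:
  assumes z: "z \<notin> \<real>\<^sub>\<ge>\<^sub>0" and f: "square_integrable f"
  shows "cinner (abs_L2 (w_sol (cnj z))) (abs_L2 f) = (\<integral>x. w_sol z x * f x \<partial>half_line)"
proof -
  have "cnj z \<notin> \<real>\<^sub>\<ge>\<^sub>0"
    using z by (simp add: complex_nonneg_Reals_iff)
  then have "cinner (abs_L2 (w_sol (cnj z))) (abs_L2 f) = (\<integral>x. cnj (w_sol (cnj z) x) * f x \<partial>half_line)"
    by (intro cinner_abs w_sol_square_integrable f)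
  also have "\<dots> = (\<integral>x. w_sol z x * f x \<partial>half_line)"
    by (intro Bochner_Integration.integral_cong refl) (simp add: w_sol_cnj[OF z])
  finally show ?thesis .
qed

text \<open>
  The function \<open>g + c w\<close>, with \<open>g\<close> the solution for \<open>\<theta> = 0\<close>, satisfies the boundary condition for \<open>\<theta>\<close> for exactly this
  value of \<open>c\<close>, and solutions are unique in the resolvent set.
\<close>

lemma resolvent_difference:
  assumes \<theta>: "0 < \<theta>" "\<theta> < pi" and z: "z \<in> resolvent_set (T_op \<phi> \<psi> 0)" "z \<in> resolvent_set (T_op \<phi> \<psi> \<theta>)"
  shows "resolvent (T_op \<phi> \<psi> \<theta>) z f - resolvent (T_op \<phi> \<psi> 0) z f =
    (inverse (of_real (cot \<theta>) + w_boundary z) * cinner (abs_L2 (w_sol (cnj z))) f) *\<^sub>C abs_L2 (w_sol z)"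
proof -
  have nz: "z \<notin> \<real>\<^sub>\<ge>\<^sub>0"
    by (rule resolvent_set_avoids_half_line[OF z(1)])
  note w = w_sol_solution[OF nz] and wd = w_sol_dom_Tmax[OF nz]
  define D where "D = of_real (cot \<theta>) + w_boundary z"
  have D: "D \<noteq> 0"
    unfolding D_def by (rule denominator_nonzero[OF \<theta> nz z(2)])
  define c where "c = inverse D * cinner (abs_L2 (w_sol (cnj z))) f"
  have "\<exists>h. (h, f) \<in> shifted (T_op \<phi> \<psi> 0) z"
    using z(1) unfolding resolvent_set_def by blast
  then obtain g where g: "g \<in> dom_T \<phi> \<psi> 0" and f: "f = abs_L2 (\<lambda>x. tau0 g x - z * g x)"
    unfolding shifted_T_op by blast
  have gd: "g \<in> dom_Tmax" and bc: "bracket0 g \<phi> = 0"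
    using g by (auto simp: dom_T_def)
  have sq: "square_integrable (\<lambda>x. tau0 g x - z * g x)"
    using gd by (intro square_integrable_diff_scale) (auto simp: dom_Tmax_def)
  have "cinner (abs_L2 (w_sol (cnj z))) f = - bracket0 g \<psi>"
    unfolding f cinner_w_sol_cnj[OF nz sq] integral_w_sol_times[OF nz gd] bc by simp
  then have J: "bracket0 g \<psi> = - (c * D)"
    using D by (simp add: c_def)
  define v where "v = (\<lambda>x. g x + c * w_sol z x)"
  note v = dom_Tmax_add_solution[OF gd w wd v_def]
  have br: "bracket0 v \<phi> = c" "bracket0 v \<psi> = - (c * D) + c * w_boundary z"
    using bracket0_add_scale[OF v(1) gd wd, of c] v(2) bracket0_w_sol[OF nz] bc J by (simp_all add: v_def)
  have "sin \<theta> \<noteq> 0"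
    using sin_gt_zero[OF \<theta>] by simp
  then have "of_real (cos \<theta>) * c + of_real (sin \<theta>) * (- (c * D) + c * w_boundary z) = (0 :: complex)"
    by (simp add: D_def cot_def algebra_simps)
  then have vT: "v \<in> dom_T \<phi> \<psi> \<theta>"
    using v(1) br by (simp add: dom_T_def)
  have "abs_L2 (\<lambda>x. tau0 v x - z * v x) = f"
    unfolding f using v(1) by (intro abs_L2_cong square_integrable_diff_scale v(3)) (auto simp: dom_Tmax_def)
  then have "(abs_L2 v, f) \<in> shifted (T_op \<phi> \<psi> \<theta>) z"
    unfolding shifted_T_op using vT by blast
  then have R1: "resolvent (T_op \<phi> \<psi> \<theta>) z f = abs_L2 v"
    by (rule resolvent_eq[OF z(2)])
  have "(abs_L2 g, f) \<in> shifted (T_op \<phi> \<psi> 0) z"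
    unfolding shifted_T_op using g f by blast
  then have R0: "resolvent (T_op \<phi> \<psi> 0) z f = abs_L2 g"
    by (rule resolvent_eq[OF z(1)])
  have "abs_L2 v = abs_L2 g + c *\<^sub>C abs_L2 (w_sol z)"
    unfolding v_def using gd w_sol_square_integrable[OF nz]
    by (simp add: cscale_abs plus_abs square_integrable_scale dom_Tmax_def)
  then show ?thesis
    unfolding R1 R0 c_def D_def by simp
qed

end

theorem proposition5p6:
  fixes \<phi> \<psi> :: "real \<Rightarrow> complex" and \<theta> :: real and z :: complex
  assumes "\<phi> \<in> dom_Tmax" and "\<psi> \<in> dom_Tmax"
    and "\<And>x. 0 < x \<Longrightarrow> \<phi> x \<in> \<real>" and "\<And>x. 0 < x \<Longrightarrow> \<psi> x \<in> \<real>"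
    and "\<forall>\<^sub>F x in at_top. \<phi> x = 0" and "\<forall>\<^sub>F x in at_top. \<psi> x = 0"
    and "\<And>x. 0 < x \<Longrightarrow> x < 1 \<Longrightarrow> \<phi> x = of_real (sqrt x)"
    and "\<And>x. 0 < x \<Longrightarrow> x < 1 \<Longrightarrow> \<psi> x = of_real (- sqrt x * ln x)"
    and "0 < \<theta>" and "\<theta> < pi"
    and "z \<in> resolvent_set (T_op \<phi> \<psi> 0) \<inter> resolvent_set (T_op \<phi> \<psi> \<theta>)"
  shows "square_integrable (w_sol z) \<and> square_integrable (w_sol (cnj z)) \<and>
    of_real (cot \<theta>) + branch_ln (branch_sqrt z / 2) + euler_mascheroni - \<i> * of_real pi / 2 \<noteq> 0 \<and>
    (\<lambda>f. resolvent (T_op \<phi> \<psi> \<theta>) z f - resolvent (T_op \<phi> \<psi> 0) z f) =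
      (\<lambda>f. (inverse (of_real (cot \<theta>) + branch_ln (branch_sqrt z / 2) + euler_mascheroni
               - \<i> * of_real pi / 2)
            * cinner (abs_L2 (w_sol (cnj z))) f) *\<^sub>C abs_L2 (w_sol z)) \<and>
    trace_class (\<lambda>f. resolvent (T_op \<phi> \<psi> \<theta>) z f - resolvent (T_op \<phi> \<psi> 0) z f) \<and>
    op_trace (\<lambda>f. resolvent (T_op \<phi> \<psi> \<theta>) z f - resolvent (T_op \<phi> \<psi> 0) z f) =
      - (1 / (2 * z * (of_real (cot \<theta>) + branch_ln (branch_sqrt z / 2) + euler_mascheroni
               - \<i> * of_real pi / 2)))"
proof -
  interpret boundary_pair \<phi> \<psi>
    by unfold_locales (fact assms)+
  have z0: "z \<in> resolvent_set (T_op \<phi> \<psi> 0)" and z\<theta>: "z \<in> resolvent_set (T_op \<phi> \<psi> \<theta>)"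
    using assms(11) by auto
  have z: "z \<notin> \<real>\<^sub>\<ge>\<^sub>0"
    by (rule resolvent_set_avoids_half_line[OF z0])
  then have cz: "cnj z \<notin> \<real>\<^sub>\<ge>\<^sub>0"
    by (simp add: complex_nonneg_Reals_iff)
  define D where "D = of_real (cot \<theta>) + w_boundary z"
  have D: "of_real (cot \<theta>) + branch_ln (branch_sqrt z / 2) + euler_mascheroni - \<i> * of_real pi / 2 = D"
    unfolding D_def w_boundary_def by (rule denominator_eq[OF z])
  have "D \<noteq> 0"
    unfolding D_def by (rule denominator_nonzero[OF assms(9,10) z z\<theta>])
  have diff: "(\<lambda>f. resolvent (T_op \<phi> \<psi> \<theta>) z f - resolvent (T_op \<phi> \<psi> 0) z f)
      = (\<lambda>f. (inverse D * cinner (abs_L2 (w_sol (cnj z))) f) *\<^sub>C abs_L2 (w_sol z))"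
    unfolding D_def by (rule ext) (rule resolvent_difference[OF assms(9,10) z0 z\<theta>])
  have ww: "cinner (abs_L2 (w_sol (cnj z))) (abs_L2 (w_sol z)) = - (1 / (2 * z))"
    unfolding cinner_w_sol_cnj[OF z w_sol_square_integrable[OF z]] by (rule integral_w_sol_square[OF z])
  have trace: "op_trace (\<lambda>f. (inverse D * cinner (abs_L2 (w_sol (cnj z))) f) *\<^sub>C abs_L2 (w_sol z))
      = - (1 / (2 * z * D))"
    unfolding op_trace_rank_one ww by (simp add: field_simps)
  show ?thesis
    unfolding D diff trace
    using w_sol_square_integrable[OF z] w_sol_square_integrable[OF cz] \<open>D \<noteq> 0\<close> trace_class_rank_one by simp
qed

end
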